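(* Let $G$ be a finite group with a split $BN$-pair of characteristic $p$ (with the notation $B,N,U,H,W,w_0,n_0$ as in the context), let $k$ be a field with $|U|1_k\neq 0$, and let $\sigma\colon U\rightarrow k^\times$ be a non-degenerate group homomorphism. Let $\Gamma_\sigma:=kG\,\underline{\mathfrak{u}}_\sigma$ (a projective $kG$-module) and let $\operatorname{St}_k:=kG\mathfrak{e}\subseteq kG\underline{\mathfrak{b}}$, where $\mathfrak{e}:=\sum_{w\in W}(-1)^{l(w)}n_w\underline{\mathfrak{b}}$. Then $$\dim\operatorname{Hom}_{kG}(\Gamma_\sigma,\operatorname{St}_k)=\dim\operatorname{Hom}_{kG}(\Gamma_\sigma,kG\underline{\mathfrak{b}})=1.$$ Hence there is a unique (up to isomorphism; and exactly one in any given decomposition of $\Gamma_\sigma$ into indecomposables) indecomposable direct summand $P_{\operatorname{St}}$ of $\Gamma_\sigma$ such that $\operatorname{Hom}_{kG}(P_{\operatorname{St}},\operatorname{St}_k)\neq 0$. The unique simple quotient of the projective indecomposable module $P_{\operatorname{St}}$ is isomorphic to $D_\sigma:=\mathcal{S}_\sigma/(\mathcal{S}_\sigma\cap\mathcal{S}_{\sigma^*}^\perp)$.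
   Context: Split $BN$-pair: $G$ is a finite group with subgroups $B,N$ such that $G=\langle B,N\rangle$; $H:=B\cap N$ is normal in $N$; $W:=N/H$ is generated by a set $S$ of elements of order $2$ such that, writing $n_w\in N$ for a representative of $w\in W$ (i.e. $Hn_w=w$), one has $n_sBn_w\subseteq Bn_{sw}B\cup Bn_wB$ and $n_sBn_s\neq B$ for all $s\in S$, $w\in W$. Moreover there is a prime $p$ such that $B=U\rtimes H$, where $U$ is a normal $p$-subgroup of $B$ and $H$ is abelian of order prime to $p$, and $\bigcap_{n\in N}nBn^{-1}=H$. Then $(W,S)$ is a finite Coxeter system with length function $l$; $w_0\in W$ is the unique element of maximal length ($w_0^2=1$), $n_0\in N$ is a representative of $w_0$, $V:=n_0^{-1}Un_0$, and for $w\in W$ one sets $U_w:=U\cap n_w^{-1}Vn_w$ (independent of the choices of $n_0,n_w$). The sharp Bruhat decomposition holds: $G=\coprod_{w\in W}Bn_wU_w$, where each $g\in Bn_wB$ is uniquely of the form $bn_wu$ with $b\in B$, $u\in U_w$. Let $k$ be a field. All $kG$-modules are finite-dimensional left modules. Put $\underline{\mathfrak{b}}:=\sum_{b\in B}b\in kG$. On $kG\underline{\mathfrak{b}}$ there is a non-singular $G$-invariant symmetric bilinear form $\langle\;,\;\rangle$ with $\langle g\underline{\mathfrak{b}},g'\underline{\mathfrak{b}}\rangle=1$ if $gB=g'B$ and $0$ otherwise. For $X\subseteq kG\underline{\mathfrak{b}}$, $X^\perp:=\{a\in kG\underline{\mathfrak{b}}\mid \langle a,x\rangle=0\text{ for all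 }x\in X\}$. For a group homomorphism $\sigma\colon U\to k^\times$ put $\underline{\mathfrak{u}}_\sigma:=\sum_{u\in U}\sigma(u)u\in kG$, $\mathcal{S}_\sigma:=kG\,\underline{\mathfrak{u}}_\sigma n_0\underline{\mathfrak{b}}\subseteq kG\underline{\mathfrak{b}}$, and let $\sigma^*\colon U\to k^\times$, $\sigma^*(u)=\sigma(u)^{-1}$ (with $\mathcal{S}_{\sigma^*}$ defined likewise). The homomorphism $\sigma$ is called non-degenerate if its restriction to $U_s$ is non-trivial for every $s\in S$. *)

theory Defs
  imports
    "HOL-Algebra.Generated_Groups"
    "HOL-Algebra.Multiplicative_Group"
    "HOL-Algebra.Ideal"
    "Jordan_Normal_Form.VS_Connect"
begin

section \<open>Split BN-pairs\<close>

text \<open>An element \<open>w\<close> of the Weyl group is literally a coset of \<open>H = B \<inter> N\<close> in \<open>N\<close>, so that the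
  representatives \<open>n\<^sub>w\<close> of \<open>w\<close> are exactly the elements of \<open>w\<close>.\<close>

definition weyl_group :: "('g, 'r) monoid_scheme \<Rightarrow> 'g set \<Rightarrow> 'g set \<Rightarrow> 'g set monoid" where
  "weyl_group G B N = (G\<lparr>carrier := N\<rparr>) Mod (B \<inter> N)"

locale split_BN_pair = group G for G (structure) +
  fixes B N U :: "'a set" and S :: "'a set set" and p :: nat
  assumes finite_G: "finite (carrier G)"
    and subgroup_B: "subgroup B G"
    and subgroup_N: "subgroup N G"
    and generate_BN: "generate G (B \<union> N) = carrier G"
    and normal_H: "(B \<inter> N) \<lhd> (G\<lparr>carrier := N\<rparr>)"
    and S_subset: "S \<subseteq> carrier (weyl_group G B N)"
    and S_order: "s \<in> S \<Longrightarrow> group.ord (weyl_group G B N) s = 2"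
    and generate_S: "generate (weyl_group G B N) S = carrier (weyl_group G B N)"
    and exchange: "\<lbrakk>s \<in> S; w \<in> carrier (weyl_group G B N); ns \<in> s; nw \<in> w;
        nsw \<in> s \<otimes>\<^bsub>weyl_group G B N\<^esub> w\<rbrakk>
      \<Longrightarrow> (ns <# B) #> nw \<subseteq> ((B #> nsw) <#> B) \<union> ((B #> nw) <#> B)"
    and not_normalize: "\<lbrakk>s \<in> S; ns \<in> s\<rbrakk> \<Longrightarrow> (ns <# B) #> ns \<noteq> B"
    and prime_p: "Factorial_Ring.prime p"
    and normal_U: "U \<lhd> (G\<lparr>carrier := B\<rparr>)"
    and p_group_U: "\<exists>a. card U = p ^ a"
    and B_eq_UH: "U <#> (B \<inter> N) = B"
    and U_Int_H: "U \<inter> (B \<inter> N) = {\<one>}"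
    and abelian_H: "comm_group (G\<lparr>carrier := B \<inter> N\<rparr>)"
    and coprime_H: "coprime (card (B \<inter> N)) p"
    and saturated: "(\<Inter>n\<in>N. (n <# B) #> inv n) = B \<inter> N"

definition word_length :: "('w, 'r) monoid_scheme \<Rightarrow> 'w set \<Rightarrow> 'w \<Rightarrow> nat" where
  "word_length W S w =
    (LEAST k. \<exists>ss. set ss \<subseteq> S \<and> length ss = k \<and> foldr (mult W) ss \<one>\<^bsub>W\<^esub> = w)"

definition longest_element :: "('w, 'r) monoid_scheme \<Rightarrow> 'w set \<Rightarrow> 'w \<Rightarrow> bool" where
  "longest_element W S w0 \<longleftrightarrow>
    w0 \<in> carrier W \<and> (\<forall>w\<in>carrier W. word_length W S w \<le> word_length W S w0)"

definition conj_set :: "('g, 'r) monoid_scheme \<Rightarrow> 'g set \<Rightarrow> 'g \<Rightarrow> 'g set" where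
  "conj_set G X g = (inv\<^bsub>G\<^esub> g <#\<^bsub>G\<^esub> X) #>\<^bsub>G\<^esub> g"

text \<open>The group \<open>U\<^sub>w = U \<inter> n\<^sub>w\<inverse> V n\<^sub>w\<close> with \<open>V = n\<^sub>0\<inverse> U n\<^sub>0\<close>, where \<open>n\<close> is a representative
  of \<open>w\<close>.\<close>

definition root_part :: "('g, 'r) monoid_scheme \<Rightarrow> 'g set \<Rightarrow> 'g \<Rightarrow> 'g \<Rightarrow> 'g set" where
  "root_part G U n0 n = U \<inter> conj_set G (conj_set G U n0) n"

definition nondegenerate ::
  "('g, 'r) monoid_scheme \<Rightarrow> 'g set \<Rightarrow> 'g set set \<Rightarrow> 'g \<Rightarrow> ('g \<Rightarrow> 'k::field) \<Rightarrow> bool" where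
  "nondegenerate G U S n0 \<sigma> \<longleftrightarrow> (\<forall>s\<in>S. \<forall>ns\<in>s. \<exists>u\<in>root_part G U n0 ns. \<sigma> u \<noteq> 1)"


section \<open>Left modules over a ring\<close>

text \<open>The locale \<^locale>\<open>Module.module\<close> is restricted to commutative rings. Its record type and the notions
  \<^const>\<open>Module.submodule\<close>, \<^const>\<open>LinearCombinations.module_hom\<close> and \<open>ring.func_space\<close> are not.\<close>

locale left_module = R?: ring R + M?: abelian_group M
  for R :: "('a, 'r) ring_scheme" (structure) and M :: "('a, 'b, 'm) module_scheme" (structure) +
  assumes l_smult_closed: "\<lbrakk>a \<in> carrier R; x \<in> carrier M\<rbrakk> \<Longrightarrow> a \<odot>\<^bsub>M\<^esub> x \<in> carrier M"
    and l_smult_l_distr: "\<lbrakk>a \<in> carrier R; b \<in> carrier R; x \<in> carrier M\<rbrakk>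
      \<Longrightarrow> (a \<oplus>\<^bsub>R\<^esub> b) \<odot>\<^bsub>M\<^esub> x = a \<odot>\<^bsub>M\<^esub> x \<oplus>\<^bsub>M\<^esub> b \<odot>\<^bsub>M\<^esub> x"
    and l_smult_r_distr: "\<lbrakk>a \<in> carrier R; x \<in> carrier M; y \<in> carrier M\<rbrakk>
      \<Longrightarrow> a \<odot>\<^bsub>M\<^esub> (x \<oplus>\<^bsub>M\<^esub> y) = a \<odot>\<^bsub>M\<^esub> x \<oplus>\<^bsub>M\<^esub> a \<odot>\<^bsub>M\<^esub> y"
    and l_smult_assoc: "\<lbrakk>a \<in> carrier R; b \<in> carrier R; x \<in> carrier M\<rbrakk>
      \<Longrightarrow> (a \<otimes>\<^bsub>R\<^esub> b) \<odot>\<^bsub>M\<^esub> x = a \<odot>\<^bsub>M\<^esub> (b \<odot>\<^bsub>M\<^esub> x)"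
    and l_smult_one: "x \<in> carrier M \<Longrightarrow> \<one>\<^bsub>R\<^esub> \<odot>\<^bsub>M\<^esub> x = x"

definition regular_module :: "('a, 'r) ring_scheme \<Rightarrow> ('a, 'a) module" where
  "regular_module R = \<lparr>carrier = carrier R, mult = mult R, one = one R,
     zero = zero R, add = add R, smult = mult R\<rparr>"

text \<open>\<^const>\<open>cgenideal\<close> is the set \<open>{x a | x \<in> R}\<close>, which is just a left ideal unless \<open>R\<close> is
  commutative.\<close>

definition lideal :: "('a, 'r) ring_scheme \<Rightarrow> 'a \<Rightarrow> ('a, 'a) module" where
  "lideal R a = (regular_module R)\<lparr>carrier := PIdl\<^bsub>R\<^esub> a\<rparr>"

definition quotient_module :: "('a, 'b, 'm) module_scheme \<Rightarrow> 'b set \<Rightarrow> ('a, 'b set) module" where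
  "quotient_module M X = \<lparr>carrier = a_rcosets\<^bsub>M\<^esub> X, mult = undefined, one = undefined,
     zero = X, add = set_add M, smult = (\<lambda>r C. \<Union>x\<in>C. X +>\<^bsub>M\<^esub> (r \<odot>\<^bsub>M\<^esub> x))\<rparr>"

definition module_iso ::
  "('a, 'r) ring_scheme \<Rightarrow> ('a, 'b, 'm) module_scheme \<Rightarrow> ('a, 'c, 'n) module_scheme \<Rightarrow> bool" where
  "module_iso R M M' \<longleftrightarrow>
    (\<exists>f\<in>LinearCombinations.module_hom R M M'. bij_betw f (carrier M) (carrier M'))"

definition simple_module :: "('a, 'r) ring_scheme \<Rightarrow> ('a, 'b, 'm) module_scheme \<Rightarrow> bool" where
  "simple_module R M \<longleftrightarrow> carrier M \<noteq> {\<zero>\<^bsub>M\<^esub>} \<and>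
    (\<forall>X. Module.submodule X R M \<longrightarrow> X = {\<zero>\<^bsub>M\<^esub>} \<or> X = carrier M)"

definition internal_sum2 ::
  "('a, 'r) ring_scheme \<Rightarrow> ('a, 'b, 'm) module_scheme \<Rightarrow> 'b set \<Rightarrow> 'b set \<Rightarrow> bool" where
  "internal_sum2 R M X Y \<longleftrightarrow> Module.submodule X R M \<and> Module.submodule Y R M \<and>
    X <+>\<^bsub>M\<^esub> Y = carrier M \<and> X \<inter> Y = {\<zero>\<^bsub>M\<^esub>}"

definition direct_summand ::
  "('a, 'r) ring_scheme \<Rightarrow> ('a, 'b, 'm) module_scheme \<Rightarrow> 'b set \<Rightarrow> bool" where
  "direct_summand R M X \<longleftrightarrow> (\<exists>Y. internal_sum2 R M X Y)"

definition indecomposable :: "('a, 'r) ring_scheme \<Rightarrow> ('a, 'b, 'm) module_scheme \<Rightarrow> bool" where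
  "indecomposable R M \<longleftrightarrow> carrier M \<noteq> {\<zero>\<^bsub>M\<^esub>} \<and>
    (\<forall>X Y. internal_sum2 R M X Y \<longrightarrow> X = {\<zero>\<^bsub>M\<^esub>} \<or> Y = {\<zero>\<^bsub>M\<^esub>})"

definition internal_direct_sum ::
  "('a, 'r) ring_scheme \<Rightarrow> ('a, 'b, 'm) module_scheme \<Rightarrow> 'i set \<Rightarrow> ('i \<Rightarrow> 'b set) \<Rightarrow> bool" where
  "internal_direct_sum R M I X \<longleftrightarrow> finite I \<and> (\<forall>i\<in>I. Module.submodule (X i) R M) \<and>
    (\<forall>x\<in>carrier M. \<exists>!f. f \<in> Pi\<^sub>E I X \<and> x = (\<Oplus>\<^bsub>M\<^esub>i\<in>I. f i))"

text \<open>Only finitely generated modules occur, so it suffices to consider free modules \<open>R\<^sup>n\<close>.\<close>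

definition projective_module :: "('a, 'r) ring_scheme \<Rightarrow> ('a, 'b, 'm) module_scheme \<Rightarrow> bool" where
  "projective_module R M \<longleftrightarrow> (\<exists>(n::nat) X. direct_summand R (ring.func_space R {..<n}) X \<and>
    module_iso R M ((ring.func_space R {..<n})\<lparr>carrier := X\<rparr>))"


section \<open>The group algebra\<close>

definition of_elt :: "'g \<Rightarrow> 'g \<Rightarrow> 'k::field" where
  "of_elt g = (\<lambda>x. if x = g then 1 else 0)"

text \<open>The record is a \<open>k\<close>-algebra: its \<open>smult\<close> is scalar multiplication. As a module over itself,
  \<open>kG\<close> is \<^term>\<open>regular_module (group_algebra G)\<close>.\<close>

definition group_algebra :: "('g, 'r) monoid_scheme \<Rightarrow> ('k::field, 'g \<Rightarrow> 'k) module" where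
  "group_algebra G = \<lparr>carrier = {a. \<forall>x. x \<notin> carrier G \<longrightarrow> a x = 0},
     mult = (\<lambda>a b x. if x \<in> carrier G
        then (\<Sum>y\<in>carrier G. a y * b (inv\<^bsub>G\<^esub> y \<otimes>\<^bsub>G\<^esub> x)) else 0),
     one = of_elt \<one>\<^bsub>G\<^esub>, zero = (\<lambda>_. 0), add = (\<lambda>a b x. a x + b x),
     smult = (\<lambda>c a x. c * a x)\<rparr>"

definition hom_space ::
  "('g, 'r) monoid_scheme \<Rightarrow> ('g \<Rightarrow> 'k::field, 'b, 'm) module_scheme
    \<Rightarrow> ('g \<Rightarrow> 'k, 'c, 'n) module_scheme \<Rightarrow> ('k, 'b \<Rightarrow> 'c) module" where
  "hom_space G M M' = \<lparr>
     carrier = LinearCombinations.module_hom (group_algebra G) M M' \<inter> extensional (carrier M),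
     mult = undefined, one = undefined,
     zero = (\<lambda>x\<in>carrier M. \<zero>\<^bsub>M'\<^esub>),
     add = (\<lambda>f f'. \<lambda>x\<in>carrier M. f x \<oplus>\<^bsub>M'\<^esub> f' x),
     smult = (\<lambda>c f. \<lambda>x\<in>carrier M.
       (c \<odot>\<^bsub>group_algebra G\<^esub> \<one>\<^bsub>group_algebra G\<^esub>) \<odot>\<^bsub>M'\<^esub> f x)\<rparr>"

definition b_sum :: "('g, 'r) monoid_scheme \<Rightarrow> 'g set \<Rightarrow> 'g \<Rightarrow> 'k::field" where
  "b_sum G B = (\<Oplus>\<^bsub>group_algebra G\<^esub>b\<in>B. of_elt b)"

definition u_sum :: "('g, 'r) monoid_scheme \<Rightarrow> 'g set \<Rightarrow> ('g \<Rightarrow> 'k) \<Rightarrow> 'g \<Rightarrow> 'k::field" where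
  "u_sum G U \<sigma> = (\<Oplus>\<^bsub>group_algebra G\<^esub>u\<in>U. \<sigma> u \<odot>\<^bsub>group_algebra G\<^esub> of_elt u)"

definition steinberg_element :: "('g, 'r) monoid_scheme \<Rightarrow> 'g set \<Rightarrow> 'g set \<Rightarrow> 'g set set
    \<Rightarrow> ('g set \<Rightarrow> 'g) \<Rightarrow> 'g \<Rightarrow> 'k::field" where
  "steinberg_element G B N S n = (\<Oplus>\<^bsub>group_algebra G\<^esub>w\<in>carrier (weyl_group G B N).
     (- 1) ^ word_length (weyl_group G B N) S w \<odot>\<^bsub>group_algebra G\<^esub>
       (of_elt (n w) \<otimes>\<^bsub>group_algebra G\<^esub> b_sum G B))"

definition perm_module :: "('g, 'r) monoid_scheme \<Rightarrow> 'g set \<Rightarrow> ('g \<Rightarrow> 'k::field, 'g \<Rightarrow> 'k) module" where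
  "perm_module G B = lideal (group_algebra G) (b_sum G B)"

definition steinberg_module :: "('g, 'r) monoid_scheme \<Rightarrow> 'g set \<Rightarrow> 'g set \<Rightarrow> 'g set set
    \<Rightarrow> ('g set \<Rightarrow> 'g) \<Rightarrow> ('g \<Rightarrow> 'k::field, 'g \<Rightarrow> 'k) module" where
  "steinberg_module G B N S n = lideal (group_algebra G) (steinberg_element G B N S n)"

definition gelfand_graev ::
  "('g, 'r) monoid_scheme \<Rightarrow> 'g set \<Rightarrow> ('g \<Rightarrow> 'k::field) \<Rightarrow> ('g \<Rightarrow> 'k, 'g \<Rightarrow> 'k) module" where
  "gelfand_graev G U \<sigma> = lideal (group_algebra G) (u_sum G U \<sigma>)"

definition S_module :: "('g, 'r) monoid_scheme \<Rightarrow> 'g set \<Rightarrow> 'g set \<Rightarrow> 'g \<Rightarrow> ('g \<Rightarrow> 'k::field)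
    \<Rightarrow> ('g \<Rightarrow> 'k, 'g \<Rightarrow> 'k) module" where
  "S_module G B U n0 \<sigma> = lideal (group_algebra G)
     (u_sum G U \<sigma> \<otimes>\<^bsub>group_algebra G\<^esub> of_elt n0 \<otimes>\<^bsub>group_algebra G\<^esub> b_sum G B)"

text \<open>Elements of \<open>kG b\<close> are constant on the left cosets of \<open>B\<close>; the coordinate of \<open>a\<close> at the basis
  vector \<open>g b\<close> is \<open>a g\<close>. See \<open>perm_form_basis\<close> below.\<close>

definition perm_form :: "('g, 'r) monoid_scheme \<Rightarrow> 'g set \<Rightarrow> ('g \<Rightarrow> 'k) \<Rightarrow> ('g \<Rightarrow> 'k) \<Rightarrow> 'k::field" where
  "perm_form G B a a' = (\<Sum>C\<in>(\<lambda>g. g <#\<^bsub>G\<^esub> B) ` carrier G. a (SOME g. g \<in> C) * a' (SOME g. g \<in> C))"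

definition perp :: "('g, 'r) monoid_scheme \<Rightarrow> 'g set \<Rightarrow> ('g \<Rightarrow> 'k::field) set \<Rightarrow> ('g \<Rightarrow> 'k) set" where
  "perp G B X = {a \<in> carrier (perm_module G B). \<forall>x\<in>X. perm_form G B a x = 0}"

definition D_module :: "('g, 'r) monoid_scheme \<Rightarrow> 'g set \<Rightarrow> 'g set \<Rightarrow> 'g \<Rightarrow> ('g \<Rightarrow> 'k::field)
    \<Rightarrow> ('g \<Rightarrow> 'k, ('g \<Rightarrow> 'k) set) module" where
  "D_module G B U n0 \<sigma> = quotient_module (S_module G B U n0 \<sigma>)
     (carrier (S_module G B U n0 \<sigma>) \<inter>
      perp G B (carrier (S_module G B U n0 (\<lambda>u. inverse (\<sigma> u)))))"


section \<open>Sanity checks\<close>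

lemma group_algebra_abelian_group: "abelian_group (group_algebra G :: ('k::field, 'g \<Rightarrow> 'k) module)"
proof (rule abelian_groupI)
  fix x :: "'g \<Rightarrow> 'k" assume "x \<in> carrier (group_algebra G)"
  then show "\<exists>y\<in>carrier (group_algebra G). y \<oplus>\<^bsub>group_algebra G\<^esub> x = \<zero>\<^bsub>group_algebra G\<^esub>"
    by (intro bexI[of _ "\<lambda>g. - x g"]) (auto simp: group_algebra_def)
qed (auto simp: group_algebra_def)

lemma of_elt_closed: "g \<in> carrier G \<Longrightarrow> of_elt g \<in> carrier (group_algebra G)"
  by (auto simp: of_elt_def group_algebra_def)

lemma finsum_group_algebra:
  fixes f :: "'i \<Rightarrow> 'g \<Rightarrow> 'k::field"
  assumes "finite A" and "f \<in> A \<rightarrow> carrier (group_algebra G)"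
  shows "(\<Oplus>\<^bsub>group_algebra G\<^esub>i\<in>A. f i) x = (\<Sum>i\<in>A. f i x)"
proof -
  interpret K: abelian_group "group_algebra G :: ('k, 'g \<Rightarrow> 'k) module"
    by (rule group_algebra_abelian_group)
  show ?thesis using assms
  proof (induction A rule: finite_induct)
    case empty
    show ?case unfolding K.finsum_empty by (simp add: group_algebra_def)
  next
    case (insert a A)
    then have "(\<Oplus>\<^bsub>group_algebra G\<^esub>i\<in>insert a A. f i) =
        f a \<oplus>\<^bsub>group_algebra G\<^esub> (\<Oplus>\<^bsub>group_algebra G\<^esub>i\<in>A. f i)"
      by (intro K.finsum_insert) auto
    with insert show ?case by (simp add: group_algebra_def)
  qed
qed

lemma (in group) group_algebra_ring:
  assumes fin: "finite (carrier G)"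
  shows "ring (group_algebra G :: ('k::field, 'a \<Rightarrow> 'k) module)"
proof (rule ringI)
  let ?K = "group_algebra G :: ('k, 'a \<Rightarrow> 'k) module"
  show "abelian_group ?K" by (rule group_algebra_abelian_group)
  show "Group.monoid ?K"
  proof
    show "a \<otimes>\<^bsub>?K\<^esub> b \<in> carrier ?K" for a b by (simp add: group_algebra_def)
    show "\<one>\<^bsub>?K\<^esub> \<in> carrier ?K" by (auto simp: group_algebra_def of_elt_def)
  next
    fix a assume a: "a \<in> carrier ?K"
    have "(\<Sum>y\<in>carrier G. of_elt \<one> y * a (inv y \<otimes> x)) = a x" if "x \<in> carrier G" for x
    proof -
      have "(\<Sum>y\<in>carrier G. of_elt \<one> y * a (inv y \<otimes> x)) =
          (\<Sum>y\<in>carrier G. if y = \<one> then a (inv y \<otimes> x) else 0)"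
        by (intro sum.cong) (auto simp: of_elt_def)
      also have "\<dots> = a x" using that fin by simp
      finally show ?thesis .
    qed
    then show "\<one>\<^bsub>?K\<^esub> \<otimes>\<^bsub>?K\<^esub> a = a" using a by (auto simp: group_algebra_def)
    have "(\<Sum>y\<in>carrier G. a y * of_elt \<one> (inv y \<otimes> x)) = a x" if "x \<in> carrier G" for x
    proof -
      have "(\<Sum>y\<in>carrier G. a y * of_elt \<one> (inv y \<otimes> x)) =
          (\<Sum>y\<in>carrier G. if y = x then a y else 0)"
      proof (intro sum.cong refl)
        fix y assume "y \<in> carrier G"
        then have "inv y \<otimes> x = \<one> \<longleftrightarrow> y = x"
          by (metis that inv_closed inv_equality inv_inv l_inv)
        then show "a y * of_elt \<one> (inv y \<otimes> x) = (if y = x then a y else 0)"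
          by (simp add: of_elt_def)
      qed
      also have "\<dots> = a x" using that fin by simp
      finally show ?thesis .
    qed
    then show "a \<otimes>\<^bsub>?K\<^esub> \<one>\<^bsub>?K\<^esub> = a" using a by (auto simp: group_algebra_def)
  next
    fix a b c assume "a \<in> carrier ?K" "b \<in> carrier ?K" "c \<in> carrier ?K"
    have "(\<Sum>y\<in>carrier G. (\<Sum>z\<in>carrier G. a z * b (inv z \<otimes> y)) * c (inv y \<otimes> x)) =
        (\<Sum>z\<in>carrier G. a z * (\<Sum>y\<in>carrier G. b y * c (inv y \<otimes> (inv z \<otimes> x))))"
      if x: "x \<in> carrier G" for x
    proof -
      have "(\<Sum>y\<in>carrier G. (\<Sum>z\<in>carrier G. a z * b (inv z \<otimes> y)) * c (inv y \<otimes> x)) =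
          (\<Sum>z\<in>carrier G. a z * (\<Sum>y\<in>carrier G. b (inv z \<otimes> y) * c (inv y \<otimes> x)))"
        by (simp add: sum_distrib_right sum_distrib_left mult.assoc) (rule sum.swap)
      also have "(\<Sum>y\<in>carrier G. b (inv z \<otimes> y) * c (inv y \<otimes> x)) =
          (\<Sum>y\<in>carrier G. b y * c (inv y \<otimes> (inv z \<otimes> x)))" if z: "z \<in> carrier G" for z
      proof (rule sum.reindex_bij_witness[of _ "\<lambda>y. z \<otimes> y" "\<lambda>y. inv z \<otimes> y"])
        fix y assume y: "y \<in> carrier G"
        show "z \<otimes> (inv z \<otimes> y) = y" "inv z \<otimes> (z \<otimes> y) = y" using y z
          by (simp_all add: m_assoc[symmetric])
        have "inv (inv z \<otimes> y) \<otimes> (inv z \<otimes> x) = inv y \<otimes> x" using x y z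
          by (simp add: inv_mult_group m_assoc) (simp add: m_assoc[symmetric])
        then show "b (inv z \<otimes> y) * c (inv (inv z \<otimes> y) \<otimes> (inv z \<otimes> x)) =
            b (inv z \<otimes> y) * c (inv y \<otimes> x)" by simp
      qed (use z in auto)
      then have "(\<Sum>z\<in>carrier G. a z * (\<Sum>y\<in>carrier G. b (inv z \<otimes> y) * c (inv y \<otimes> x))) =
          (\<Sum>z\<in>carrier G. a z * (\<Sum>y\<in>carrier G. b y * c (inv y \<otimes> (inv z \<otimes> x))))"
        by (intro sum.cong) auto
      finally show ?thesis .
    qed
    then show "a \<otimes>\<^bsub>?K\<^esub> b \<otimes>\<^bsub>?K\<^esub> c = a \<otimes>\<^bsub>?K\<^esub> (b \<otimes>\<^bsub>?K\<^esub> c)"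
      by (auto simp: group_algebra_def intro!: ext)
  qed
qed (auto simp: group_algebra_def fun_eq_iff sum.distrib algebra_simps)

lemma (in group) of_elt_mult_b_sum:
  assumes fin: "finite (carrier G)" and B: "subgroup B G" and g: "g \<in> carrier G"
  shows "(of_elt g \<otimes>\<^bsub>group_algebra G\<^esub> b_sum G B :: 'a \<Rightarrow> 'k::field) =
    (\<lambda>x. if x \<in> g <# B then 1 else 0)"
proof
  fix x
  have sub: "B \<subseteq> carrier G" and finB: "finite B"
    using B fin by (auto simp: subgroup_def intro: finite_subset)
  have b: "(b_sum G B :: 'a \<Rightarrow> 'k) y = (if y \<in> B then 1 else 0)" for y
  proof -
    have "(b_sum G B :: 'a \<Rightarrow> 'k) y = (\<Sum>b\<in>B. of_elt b y)"
      unfolding b_sum_def using sub by (intro finsum_group_algebra finB) (auto intro: of_elt_closed)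
    also have "\<dots> = (if y \<in> B then 1 else 0)" using finB by (simp add: of_elt_def)
    finally show ?thesis .
  qed
  have mem: "inv g \<otimes> x \<in> B \<longleftrightarrow> x \<in> g <# B" if x: "x \<in> carrier G"
  proof
    assume "inv g \<otimes> x \<in> B"
    moreover have "x = g \<otimes> (inv g \<otimes> x)" using g x by (simp add: m_assoc[symmetric])
    ultimately show "x \<in> g <# B" unfolding l_coset_def by blast
  next
    assume "x \<in> g <# B"
    then obtain b where "b \<in> B" "x = g \<otimes> b" by (auto simp: l_coset_def)
    moreover from this have "inv g \<otimes> x = b" using g sub by (auto simp: m_assoc[symmetric])
    ultimately show "inv g \<otimes> x \<in> B" by simp
  qed
  show "(of_elt g \<otimes>\<^bsub>group_algebra G\<^esub> b_sum G B :: 'a \<Rightarrow> 'k) x = (if x \<in> g <# B then 1 else 0)"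
  proof (cases "x \<in> carrier G")
    case True
    have "(\<Sum>y\<in>carrier G. of_elt g y * (b_sum G B :: 'a \<Rightarrow> 'k) (inv y \<otimes> x)) =
        (\<Sum>y\<in>carrier G. if y = g then b_sum G B (inv y \<otimes> x) else 0)"
      by (intro sum.cong) (auto simp: of_elt_def)
    also have "\<dots> = b_sum G B (inv g \<otimes> x)" using fin g by simp
    finally show ?thesis using True mem by (simp add: group_algebra_def b)
  next
    case False
    then have "x \<notin> g <# B" using l_coset_subset_G[OF sub g] by auto
    then show ?thesis using False by (simp add: group_algebra_def)
  qed
qed

lemma (in group) perm_form_basis:
  assumes fin: "finite (carrier G)" and B: "subgroup B G"
    and g: "g \<in> carrier G" and g': "g' \<in> carrier G"
  shows "perm_form G B (of_elt g \<otimes>\<^bsub>group_algebra G\<^esub> b_sum G B)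
      (of_elt g' \<otimes>\<^bsub>group_algebra G\<^esub> b_sum G B) = (if g <# B = g' <# B then 1 else (0::'k::field))"
proof -
  let ?L = "(\<lambda>g. g <# B) ` carrier G"
  have mem: "(SOME x. x \<in> C) \<in> h <# B \<longleftrightarrow> C = h <# B" if C: "C \<in> ?L" and h: "h \<in> carrier G" for C h
  proof -
    from C obtain c where c: "c \<in> carrier G" "C = c <# B" by auto
    have "c \<in> C" using c subgroup.one_closed[OF B] by (force simp: l_coset_def)
    then have s: "(SOME x. x \<in> C) \<in> C" by (rule someI)
    show ?thesis
      using s c h B by (metis l_repr_independence)
  qed
  have "perm_form G B (of_elt g \<otimes>\<^bsub>group_algebra G\<^esub> b_sum G B)
      (of_elt g' \<otimes>\<^bsub>group_algebra G\<^esub> b_sum G B) =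
      (\<Sum>C\<in>?L. if C = g <# B then if g <# B = g' <# B then 1 else (0::'k) else 0)"
    unfolding perm_form_def of_elt_mult_b_sum[OF fin B g] of_elt_mult_b_sum[OF fin B g']
    by (intro sum.cong refl) (simp add: mem g g')
  also have "\<dots> = (if g <# B = g' <# B then 1 else 0)" using fin g by simp
  finally show ?thesis .
qed

lemma (in ring) left_module_lideal:
  assumes a: "a \<in> carrier R"
  shows "left_module R (lideal R a)"
proof -
  have P: "PIdl a = {x \<otimes> a |x. x \<in> carrier R}" by (simp add: cgenideal_def)
  have "abelian_group (lideal R a)"
  proof (rule abelian_groupI)
    fix x y assume "x \<in> carrier (lideal R a)" "y \<in> carrier (lideal R a)"
    then obtain u v where "u \<in> carrier R" "v \<in> carrier R" "x = u \<otimes> a" "y = v \<otimes> a"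
      by (auto simp: lideal_def regular_module_def P)
    with a show "x \<oplus>\<^bsub>lideal R a\<^esub> y \<in> carrier (lideal R a)"
      by (auto simp: lideal_def regular_module_def P intro!: exI[of _ "u \<oplus> v"] simp: l_distr)
  next
    show "\<zero>\<^bsub>lideal R a\<^esub> \<in> carrier (lideal R a)"
      using a by (auto simp: lideal_def regular_module_def P intro!: exI[of _ \<zero>])
  next
    fix x assume "x \<in> carrier (lideal R a)"
    then obtain u where u: "u \<in> carrier R" "x = u \<otimes> a"
      by (auto simp: lideal_def regular_module_def P)
    show "\<exists>y\<in>carrier (lideal R a). y \<oplus>\<^bsub>lideal R a\<^esub> x = \<zero>\<^bsub>lideal R a\<^esub>"
    proof
      show "(\<ominus> u) \<otimes> a \<in> carrier (lideal R a)"
        using u by (auto simp: lideal_def regular_module_def P intro!: exI[of _ "\<ominus> u"])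
      show "(\<ominus> u) \<otimes> a \<oplus>\<^bsub>lideal R a\<^esub> x = \<zero>\<^bsub>lideal R a\<^esub>"
        using u a by (simp add: lideal_def regular_module_def l_minus l_neg)
    qed
  qed (use a in \<open>auto simp: lideal_def regular_module_def P a_ac\<close>)
  moreover have "ring R" by (rule ring_axioms)
  moreover have "left_module_axioms R (lideal R a)"
  proof
    fix r x assume "r \<in> carrier R" "x \<in> carrier (lideal R a)"
    with a show "r \<odot>\<^bsub>lideal R a\<^esub> x \<in> carrier (lideal R a)"
      by (auto simp: lideal_def regular_module_def P m_assoc[symmetric])
  qed (use a in \<open>auto simp: lideal_def regular_module_def P l_distr r_distr m_assoc\<close>)
  ultimately show ?thesis by (simp add: left_module_def)
qed

lemma (in group) vectorspace_hom_space:
  fixes M :: "('a \<Rightarrow> 'k::field, 'b, 'm) module_scheme"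
    and M' :: "('a \<Rightarrow> 'k, 'c, 'n) module_scheme"
  assumes fin: "finite (carrier G)"
    and "left_module (group_algebra G) M" and "left_module (group_algebra G) M'"
  shows "vectorspace class_ring (hom_space G M M')"
proof -
  let ?K = "group_algebra G :: ('k, 'a \<Rightarrow> 'k) module"
  let ?c = "\<lambda>c. c \<odot>\<^bsub>?K\<^esub> \<one>\<^bsub>?K\<^esub>"
  interpret M: left_module ?K M by fact
  interpret N: left_module ?K M' by fact
  have c: "?c c \<in> carrier ?K" for c by (auto simp: group_algebra_def of_elt_def)
  have c_add: "?c (a + b) = ?c a \<oplus>\<^bsub>?K\<^esub> ?c b" for a b
    by (auto simp: group_algebra_def algebra_simps)
  have c_left: "(?c a \<otimes>\<^bsub>?K\<^esub> r) = a \<odot>\<^bsub>?K\<^esub> r" if "r \<in> carrier ?K" for a r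
  proof -
    have "?c a \<otimes>\<^bsub>?K\<^esub> r = a \<odot>\<^bsub>?K\<^esub> (\<one>\<^bsub>?K\<^esub> \<otimes>\<^bsub>?K\<^esub> r)"
      by (auto simp: group_algebra_def sum_distrib_left mult.assoc intro!: ext)
    then show ?thesis using that by simp
  qed
  have c_right: "(r \<otimes>\<^bsub>?K\<^esub> ?c a) = a \<odot>\<^bsub>?K\<^esub> r" if "r \<in> carrier ?K" for a r
  proof -
    have "r \<otimes>\<^bsub>?K\<^esub> ?c a = a \<odot>\<^bsub>?K\<^esub> (r \<otimes>\<^bsub>?K\<^esub> \<one>\<^bsub>?K\<^esub>)"
      by (auto simp: group_algebra_def sum_distrib_left mult.left_commute intro!: ext)
    then show ?thesis using that by simp
  qed
  have c_mult: "?c (a * b) = ?c a \<otimes>\<^bsub>?K\<^esub> ?c b" for a b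
    using c_left[OF c[of b], of a] by (simp add: group_algebra_def mult.assoc)
  have c_one: "?c 1 = \<one>\<^bsub>?K\<^esub>" by (auto simp: group_algebra_def)
  have swap: "?c a \<odot>\<^bsub>M'\<^esub> (r \<odot>\<^bsub>M'\<^esub> x) = r \<odot>\<^bsub>M'\<^esub> (?c a \<odot>\<^bsub>M'\<^esub> x)"
    if "r \<in> carrier ?K" "x \<in> carrier M'" for a r x
    using that c by (simp add: N.l_smult_assoc[symmetric] c_left c_right)
  note defs = hom_space_def LinearCombinations.module_hom_def
  have zero: "r \<odot>\<^bsub>M'\<^esub> \<zero>\<^bsub>M'\<^esub> = \<zero>\<^bsub>M'\<^esub>" if "r \<in> carrier ?K" for r
    using that by (metis N.M.add.l_cancel_one' N.M.zero_closed N.M.r_zero N.l_smult_closed N.l_smult_r_distr)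
  have "abelian_group (hom_space G M M')"
  proof (rule abelian_groupI)
    fix f assume f: "f \<in> carrier (hom_space G M M')"
    have neg: "r \<odot>\<^bsub>M'\<^esub> (\<ominus>\<^bsub>M'\<^esub> x) = \<ominus>\<^bsub>M'\<^esub> (r \<odot>\<^bsub>M'\<^esub> x)"
      if "r \<in> carrier ?K" "x \<in> carrier M'" for r x
    proof -
      have "r \<odot>\<^bsub>M'\<^esub> (\<ominus>\<^bsub>M'\<^esub> x) \<oplus>\<^bsub>M'\<^esub> r \<odot>\<^bsub>M'\<^esub> x = \<zero>\<^bsub>M'\<^esub>"
        using that by (simp add: N.l_smult_r_distr[symmetric] N.M.l_neg zero)
      then show ?thesis
        using that by (metis N.M.minus_equality N.M.a_inv_closed N.l_smult_closed)
    qed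
    show "\<exists>y\<in>carrier (hom_space G M M'). y \<oplus>\<^bsub>hom_space G M M'\<^esub> f = \<zero>\<^bsub>hom_space G M M'\<^esub>"
      using f by (intro bexI[of _ "\<lambda>x\<in>carrier M. \<ominus>\<^bsub>M'\<^esub> f x"])
        (auto simp: defs N.M.l_neg N.M.minus_add neg Pi_iff M.l_smult_closed)
  next
    fix f f' assume "f \<in> carrier (hom_space G M M')" "f' \<in> carrier (hom_space G M M')"
    then show "f \<oplus>\<^bsub>hom_space G M M'\<^esub> f' \<in> carrier (hom_space G M M')"
      by (auto simp: defs Pi_iff M.l_smult_closed N.l_smult_closed N.l_smult_r_distr N.M.a_ac)
  next
    show "\<zero>\<^bsub>hom_space G M M'\<^esub> \<in> carrier (hom_space G M M')"
      by (auto simp: defs M.l_smult_closed zero)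
  qed (auto simp: defs Pi_iff N.M.a_ac extensional_def fun_eq_iff)
  moreover have "module_axioms class_ring (hom_space G M M')"
  proof
    fix a f assume "f \<in> carrier (hom_space G M M')"
    then show "a \<odot>\<^bsub>hom_space G M M'\<^esub> f \<in> carrier (hom_space G M M')"
      using c by (auto simp: defs Pi_iff M.l_smult_closed N.l_smult_closed N.l_smult_r_distr swap)
  qed (use c in \<open>auto simp: defs Pi_iff N.l_smult_closed N.l_smult_l_distr N.l_smult_r_distr
      N.l_smult_assoc N.l_smult_one c_add c_mult c_one extensional_def fun_eq_iff\<close>)
  moreover have "cring (class_ring :: 'k ring)" "field (class_ring :: 'k ring)"
    by (rule class_cring.is_cring, rule class_field)
  ultimately show ?thesis
    by (simp add: vectorspace_def Module.module_def)
qed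

end

theory Submission
  imports Defs "HOL-Library.Function_Algebras"
begin

text \<open>Put \<open>e = |U|\<inverse> u\<^sub>\<sigma>\<close>, an idempotent with \<open>\<Gamma>\<^sub>\<sigma> = kG e\<close>, so that \<open>Hom(\<Gamma>\<^sub>\<sigma>, M) = e M\<close>. As \<open>G = U N B\<close>, an
  element of \<open>e kG b\<close> is determined by its values on \<open>N\<close>; non-degeneracy makes it vanish at each \<open>n \<notin> w0\<close>,
  because then some \<open>U\<^sub>s\<close> satisfies \<open>n\<inverse> U\<^sub>s n \<subseteq> B\<close>. Hence \<open>e kG b\<close> is the line spanned by \<open>v = u\<^sub>\<sigma> n0 b\<close>, and
  \<open>u\<^sub>\<sigma>\<close> maps the Steinberg element to \<open>\<plusminus> v\<close>. An idempotent \<open>f\<close> in \<open>e kG e\<close> satisfies \<open>f v = v\<close> or \<open>f v = 0\<close>,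
  and the first case singles out the summands with a non-zero map to the Steinberg module. By Fitting's
  lemma, right multiplication by \<open>x \<in> kG f\<close> with \<open>x v = v\<close> is bijective on an indecomposable \<open>kG f\<close>. Finally,
  a submodule \<open>X\<close> of \<open>kG b\<close> either contains \<open>v\<close> or satisfies \<open>u\<^sub>\<sigma> X = 0\<close>, which by adjunction means that it
  is orthogonal to \<open>S\<close> of the inverse character.\<close>

section \<open>The exchange condition\<close>

text \<open>The BN-pair axioms do not speak of lengths, while two facts about w0 are needed: B meets
  n0^{-1} B n0 only in H, and for n not in w0 some U_s satisfies n^{-1} U_s n \<subseteq> B. Both
  have one source: if l(xy) = l(x) + l(y), an element of B that xy conjugates into B is already
  conjugated into B by y. As every element of W is a length-additive suffix of w0, the first fact
  follows from saturation. For the second, let w be the class of n and choose s with l(sw) > l(w);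
  then w0 s = x w^{-1} with lengths adding up, and w0 s conjugates U_s into U. Additivity rests on
  the exchange condition, which a half-space criterion extracts from the relation BsB BwB = BswB.
  The first fact also makes the cosets u n0 B distinct, so that v takes the value 1 at n0 and spans
  a genuine line. The module theory is carried out in an abstract ring with chain conditions on left
  ideals, where homomorphisms out of a left ideal generated by an idempotent become right
  multiplications.\<close>

locale involution_system = group W for W (structure) +
  fixes S :: "'a set"
  assumes S_closed: "S \<subseteq> carrier W"
    and S_square: "s \<in> S \<Longrightarrow> s \<otimes> s = \<one>"
    and S_generate: "generate W S = carrier W"
begin

abbreviation wprod :: "'a list \<Rightarrow> 'a" where "wprod ss \<equiv> foldr (\<otimes>) ss \<one>"

text \<open>Otherwise the simplifier turns the product of \<open>xs @ ys\<close> into a fold with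
  start value \<open>wprod ys\<close>, which \<open>wprod_append\<close> no longer matches.\<close>

declare foldr_append [simp del]

abbreviation len :: "'a \<Rightarrow> nat" where "len \<equiv> word_length W S"

lemma S_carrier [simp]: "s \<in> S \<Longrightarrow> s \<in> carrier W"
  using S_closed by auto

lemma wprod_closed [simp]: "set ss \<subseteq> S \<Longrightarrow> wprod ss \<in> carrier W"
  by (induction ss) auto

lemma wprod_append: "set xs \<subseteq> S \<Longrightarrow> set ys \<subseteq> S \<Longrightarrow> wprod (xs @ ys) = wprod xs \<otimes> wprod ys"
  by (induction xs) (auto simp: m_assoc)

lemma S_inv: "s \<in> S \<Longrightarrow> inv s = s"
  by (simp add: S_square inv_equality)

lemma S_cancel [simp]: "s \<in> S \<Longrightarrow> w \<in> carrier W \<Longrightarrow> s \<otimes> (s \<otimes> w) = w"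
  by (simp add: m_assoc[symmetric] S_square)

lemma S_cancel_right [simp]: "s \<in> S \<Longrightarrow> w \<in> carrier W \<Longrightarrow> w \<otimes> s \<otimes> s = w"
  by (simp add: m_assoc S_square)

lemma wprod_rev: "set ss \<subseteq> S \<Longrightarrow> wprod (rev ss) = inv (wprod ss)"
  by (induction ss) (auto simp: wprod_append inv_mult_group S_inv)

lemma ex_word:
  assumes "w \<in> carrier W"
  shows "\<exists>ss. set ss \<subseteq> S \<and> wprod ss = w"
proof -
  from assms have "w \<in> generate W S" by (simp add: S_generate)
  then show ?thesis
  proof (induction rule: generate.induct)
    case one
    show ?case by (rule exI[of _ "[]"]) simp
  next
    case (incl s)
    then show ?case by (intro exI[of _ "[s]"]) simp
  next
    case (inv s)
    then show ?case by (intro exI[of _ "[s]"]) (simp add: S_inv)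
  next
    case (eng a b)
    then obtain as bs where "set as \<subseteq> S" "wprod as = a" "set bs \<subseteq> S" "wprod bs = b" by blast
    then show ?case by (intro exI[of _ "as @ bs"]) (simp add: wprod_append)
  qed
qed

lemma len_le: "set ss \<subseteq> S \<Longrightarrow> len (wprod ss) \<le> length ss"
  unfolding word_length_def by (rule Least_le) auto

lemma ex_reduced:
  assumes "w \<in> carrier W"
  shows "\<exists>ss. set ss \<subseteq> S \<and> length ss = len w \<and> wprod ss = w"
proof -
  have "\<exists>k ss. set ss \<subseteq> S \<and> length ss = k \<and> wprod ss = w" using ex_word[OF assms] by auto
  from LeastI_ex[OF this] show ?thesis unfolding word_length_def by auto
qed

lemma len_mult_le:
  assumes "v \<in> carrier W" "w \<in> carrier W"
  shows "len (v \<otimes> w) \<le> len v + len w"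
proof -
  obtain vs where vs: "set vs \<subseteq> S" "length vs = len v" "wprod vs = v" using ex_reduced[OF assms(1)] by auto
  obtain ws where ws: "set ws \<subseteq> S" "length ws = len w" "wprod ws = w" using ex_reduced[OF assms(2)] by auto
  have "len (wprod (vs @ ws)) \<le> length (vs @ ws)" by (rule len_le) (use vs ws in auto)
  then show ?thesis using vs ws by (simp add: wprod_append)
qed

lemma len_inv:
  assumes "w \<in> carrier W"
  shows "len (inv w) = len w"
proof -
  have le: "len (inv v) \<le> len v" if v: "v \<in> carrier W" for v
  proof -
    obtain vs where vs: "set vs \<subseteq> S" "length vs = len v" "wprod vs = v" using ex_reduced[OF v] by auto
    then show ?thesis using len_le[of "rev vs"] by (simp add: wprod_rev)
  qed
  show ?thesis using le[OF assms] le[of "inv w"] assms by simp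
qed

lemma len_eq_0: "w \<in> carrier W \<Longrightarrow> len w = 0 \<Longrightarrow> w = \<one>"
  using ex_reduced by fastforce

lemma len_S_le: "s \<in> S \<Longrightarrow> len s \<le> 1"
  using len_le[of "[s]"] by simp

end

text \<open>\<open>P s\<close> is the half-space of elements lying on the same side of the wall of s
  as the identity: it contains 1, it is disjoint from its image under s, and a step from w to wt
  leaves it only by crossing that wall, which means sw = wt. This is the classical criterion for the
  exchange condition. By \<open>ascent_iff\<close>, \<open>P s w\<close> turns out to be a statement
  about lengths.\<close>

locale exchange_system = involution_system W S for W (structure) and S +
  fixes P :: "'a \<Rightarrow> 'a \<Rightarrow> bool"
  assumes P_one: "s \<in> S \<Longrightarrow> P s \<one>"
    and P_flip: "\<lbrakk>s \<in> S; w \<in> carrier W; P s w\<rbrakk> \<Longrightarrow> \<not> P s (s \<otimes> w)"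
    and P_cross: "\<lbrakk>s \<in> S; t \<in> S; w \<in> carrier W; P s w; \<not> P s (w \<otimes> t)\<rbrakk> \<Longrightarrow> s \<otimes> w = w \<otimes> t"
begin

text \<open>The prefixes of the word form a walk that starts at 1 inside \<open>P s\<close> and ends
  outside. At the letter where the walk leaves, \<open>P_cross\<close> gives the relation.\<close>

lemma exchange_word:
  assumes "s \<in> S" "set ss \<subseteq> S" "\<not> P s (wprod ss)"
  shows "\<exists>xs t ys. ss = xs @ t # ys \<and> s \<otimes> wprod xs = wprod xs \<otimes> t"
  using assms
proof (induction ss rule: rev_induct)
  case Nil
  then show ?case using P_one by auto
next
  case (snoc t ss)
  show ?case
  proof (cases "P s (wprod ss)")
    case True
    with snoc.prems have "s \<otimes> wprod ss = wprod ss \<otimes> t"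
      by (intro P_cross) (auto simp: wprod_append)
    then show ?thesis by blast
  next
    case False
    with snoc obtain xs u ys where "ss = xs @ u # ys" "s \<otimes> wprod xs = wprod xs \<otimes> u" by auto
    then show ?thesis by (intro exI[of _ xs] exI[of _ u] exI[of _ "ys @ [t]"]) simp
  qed
qed

lemma exchange_delete:
  assumes s: "s \<in> S" and xs: "set xs \<subseteq> S" and t: "t \<in> S" and ys: "set ys \<subseteq> S"
    and eq: "s \<otimes> wprod xs = wprod xs \<otimes> t"
  shows "s \<otimes> wprod (xs @ t # ys) = wprod (xs @ ys)"
proof -
  have "s \<otimes> wprod (xs @ t # ys) = s \<otimes> wprod xs \<otimes> (t \<otimes> wprod ys)"
    using s xs t ys by (simp add: wprod_append m_assoc)
  also have "\<dots> = wprod xs \<otimes> (t \<otimes> (t \<otimes> wprod ys))"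
    unfolding eq using s xs t ys by (simp add: m_assoc)
  also have "\<dots> = wprod (xs @ ys)" using assms by (simp add: wprod_append)
  finally show ?thesis .
qed

lemma len_descent:
  assumes s: "s \<in> S" and w: "w \<in> carrier W" and nP: "\<not> P s w"
  shows "len (s \<otimes> w) < len w"
proof -
  obtain ss where ss: "set ss \<subseteq> S" "length ss = len w" "wprod ss = w" using ex_reduced[OF w] by auto
  then obtain xs t ys where d: "ss = xs @ t # ys" "s \<otimes> wprod xs = wprod xs \<otimes> t"
    using exchange_word[OF s ss(1)] nP by auto
  have "s \<otimes> w = wprod (xs @ ys)"
    using exchange_delete[OF s _ _ _ d(2), of ys] ss d(1) by simp
  moreover have "len (wprod (xs @ ys)) \<le> length (xs @ ys)" by (rule len_le) (use ss d in auto)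
  ultimately show ?thesis using ss(2) d(1) by simp
qed

text \<open>By \<open>P_flip\<close> the element sw is outside the half-space, so
  \<open>len_descent\<close> applies to it and returns to w.\<close>

lemma len_ascent:
  assumes s: "s \<in> S" and w: "w \<in> carrier W" and P: "P s w"
  shows "len (s \<otimes> w) = len w + 1"
proof -
  have "len (s \<otimes> (s \<otimes> w)) < len (s \<otimes> w)"
    using s w P by (intro len_descent P_flip) auto
  moreover have "len (s \<otimes> w) \<le> len s + len w" by (rule len_mult_le) (use s w in auto)
  ultimately show ?thesis using s w len_S_le[OF s] by simp
qed

lemma ascent_iff: "s \<in> S \<Longrightarrow> w \<in> carrier W \<Longrightarrow> P s w \<longleftrightarrow> len w \<le> len (s \<otimes> w)"
  using len_ascent len_descent by (metis less_eq_Suc_le not_less_eq_eq Suc_eq_plus1 le_add1)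

section \<open>Full descent sets and the longest element\<close>

text \<open>Induction on a reduced word \<open>s # ws\<close> of \<open>w\<close>: the letter deleted by the exchange condition cannot lie
  in \<open>ws\<close>, since \<open>s # ws\<close> is reduced.\<close>

lemma prefix_of_full_descent:
  assumes z: "z \<in> carrier W" and desc: "\<And>s. s \<in> S \<Longrightarrow> \<not> P s z" and w: "w \<in> carrier W"
  shows "\<exists>y\<in>carrier W. z = w \<otimes> y \<and> len z = len w + len y"
proof -
  have "\<exists>y\<in>carrier W. z = wprod ws \<otimes> y \<and> len z = length ws + len y"
    if "set ws \<subseteq> S" "length ws = len (wprod ws)" for ws
    using that
  proof (induction ws)
    case Nil
    then show ?case using z by simp
  next
    case (Cons s ws)
    then have s: "s \<in> S" and ws: "set ws \<subseteq> S" by auto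
    have "len (s \<otimes> wprod ws) \<le> len s + len (wprod ws)" by (rule len_mult_le) (use s ws in auto)
    with Cons.prems len_S_le[OF s] len_le[OF ws] have red: "length ws = len (wprod ws)" by simp
    then obtain y where y: "y \<in> carrier W" "z = wprod ws \<otimes> y" "len z = length ws + len y"
      using Cons.IH ws by auto
    obtain us where us: "set us \<subseteq> S" "length us = len y" "wprod us = y"
      using ex_reduced[OF y(1)] by auto
    have "\<not> P s (wprod (ws @ us))" using desc[OF s] us y ws by (simp add: wprod_append)
    then obtain xs t ys where d: "ws @ us = xs @ t # ys" "s \<otimes> wprod xs = wprod xs \<otimes> t"
      using exchange_word[OF s, of "ws @ us"] ws us by auto
    have sub: "set xs \<subseteq> S" "t \<in> S" "set ys \<subseteq> S" using arg_cong[OF d(1), of set] ws us by auto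
    show ?case
    proof (cases "length xs < length ws")
      case True
      with d(1) obtain ys' where ys': "ws = xs @ t # ys'"
        by (auto simp: append_eq_append_conv2 append_eq_Cons_conv)
      then have "s \<otimes> wprod ws = wprod (xs @ ys')"
        using exchange_delete[OF s sub(1,2) _ d(2), of ys'] ws by simp
      moreover have "len (wprod (xs @ ys')) \<le> length (xs @ ys')" by (rule len_le) (use ws ys' in auto)
      ultimately have False using Cons.prems(2) ys' by simp
      then show ?thesis ..
    next
      case False
      then obtain us' where us': "xs = ws @ us'" "us = us' @ t # ys" using d(1)
        by (auto simp: append_eq_append_conv2 Cons_eq_append_conv)
      \<comment> \<open>Here the deleted letter lies in the word \<open>us\<close> of y. Since z =
        s(sz), deleting it lets s be prepended to \<open>ws\<close> at the cost of one letter of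
        \<open>us\<close>, so the total length is unchanged.\<close>
      have "z = s \<otimes> (s \<otimes> wprod (xs @ t # ys))"
        using s z y us ws d(1) by (metis S_cancel wprod_append)
      also have "\<dots> = s \<otimes> wprod (ws @ us' @ ys)"
        using exchange_delete[OF s sub(1,2,3) d(2)] us'(1) by simp
      also have "\<dots> = wprod (s # ws) \<otimes> wprod (us' @ ys)"
        using s ws us us' by (simp add: wprod_append m_assoc)
      finally have z_eq: "z = wprod (s # ws) \<otimes> wprod (us' @ ys)" .
      have c: "wprod (us' @ ys) \<in> carrier W" by (rule wprod_closed) (use us us' in auto)
      have "len (wprod (us' @ ys)) \<le> length (us' @ ys)" by (rule len_le) (use us us' in auto)
      moreover have "len z \<le> len (wprod (s # ws)) + len (wprod (us' @ ys))"
        unfolding z_eq by (rule len_mult_le) (use c Cons.prems in \<open>auto\<close>)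
      ultimately have "len z = length (s # ws) + len (wprod (us' @ ys))"
        using y(3) us(2) us'(2) Cons.prems(2) by (simp)
      then show ?thesis using z_eq c by blast
    qed
  qed
  then show ?thesis using ex_reduced[OF w] by metis
qed

lemma longest_descent:
  assumes "longest_element W S z" "s \<in> S"
  shows "\<not> P s z"
proof
  assume "P s z"
  then have "len (s \<otimes> z) = len z + 1" using assms by (intro len_ascent) (auto simp: longest_element_def)
  moreover have "len (s \<otimes> z) \<le> len z" using assms by (auto simp: longest_element_def)
  ultimately show False by simp
qed

lemma longest_inv: "longest_element W S z \<Longrightarrow> longest_element W S (inv z)"
  by (auto simp: longest_element_def len_inv)

text \<open>Prefixes become suffixes under inversion, and the inverse of a longest element is again
  longest.\<close>

lemma longest_suffix:
  assumes z: "longest_element W S z" and w: "w \<in> carrier W"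
  shows "\<exists>x\<in>carrier W. z = x \<otimes> w \<and> len z = len x + len w"
proof -
  have zc: "z \<in> carrier W" using z by (simp add: longest_element_def)
  obtain y where y: "y \<in> carrier W" "inv z = inv w \<otimes> y" "len (inv z) = len (inv w) + len y"
    using prefix_of_full_descent[of "inv z" "inv w"] longest_descent[OF longest_inv[OF z]] zc w by auto
  have "z = inv y \<otimes> w" using y w zc by (metis inv_inv inv_mult_group inv_closed)
  moreover have "len z = len (inv y) + len w" using y(3) len_inv[OF zc] len_inv[OF w] len_inv[OF y(1)] by simp
  ultimately show ?thesis using y(1) by blast
qed

text \<open>An element without ascents has every element as a length-additive prefix, in particular
  z; maximality of the length of z leaves no room for a further factor. This also yields uniqueness
  of the longest element.\<close>

lemma ex_ascent:
  assumes z: "longest_element W S z" and w: "w \<in> carrier W" and ne: "w \<noteq> z"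
  shows "\<exists>s\<in>S. P s w"
proof (rule ccontr)
  assume "\<not> ?thesis"
  then have d: "\<And>s. s \<in> S \<Longrightarrow> \<not> P s w" by blast
  have zc: "z \<in> carrier W" using z by (simp add: longest_element_def)
  obtain y where y: "y \<in> carrier W" "w = z \<otimes> y" "len w = len z + len y"
    using prefix_of_full_descent[OF w d zc] by auto
  moreover have "len w \<le> len z" using z w by (simp add: longest_element_def)
  ultimately have "len y = 0" by simp
  then have "y = \<one>" using y len_eq_0 by blast
  with y ne zc show False by simp
qed

end

section \<open>The Bruhat decomposition\<close>

context split_BN_pair
begin

abbreviation Weyl :: "'a set monoid" where "Weyl \<equiv> weyl_group G B N"

abbreviation cl :: "'a \<Rightarrow> 'a set" where "cl n \<equiv> (B \<inter> N) #> n"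

text \<open>The double coset BnB, bracketed as in the assumption \<open>exchange\<close>.\<close>

definition dcoset :: "'a \<Rightarrow> 'a set" where "dcoset n = (B #> n) <#> B"

abbreviation conjg :: "'a \<Rightarrow> 'a \<Rightarrow> 'a" where "conjg n x \<equiv> n \<otimes> x \<otimes> inv n"

lemma B_carrier [simp]: "b \<in> B \<Longrightarrow> b \<in> carrier G"
  using subgroup.mem_carrier[OF subgroup_B] .

lemma N_carrier [simp]: "n \<in> N \<Longrightarrow> n \<in> carrier G"
  using subgroup.mem_carrier[OF subgroup_N] .

lemma B_mult [simp]: "a \<in> B \<Longrightarrow> b \<in> B \<Longrightarrow> a \<otimes> b \<in> B"
  using subgroup.m_closed[OF subgroup_B] .

lemma N_mult [simp]: "a \<in> N \<Longrightarrow> b \<in> N \<Longrightarrow> a \<otimes> b \<in> N"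
  using subgroup.m_closed[OF subgroup_N] .

lemma B_inv [simp]: "b \<in> B \<Longrightarrow> inv b \<in> B"
  using subgroup.m_inv_closed[OF subgroup_B] .

lemma N_inv [simp]: "n \<in> N \<Longrightarrow> inv n \<in> N"
  using subgroup.m_inv_closed[OF subgroup_N] .

lemma B_one [simp]: "\<one> \<in> B"
  using subgroup.one_closed[OF subgroup_B] .

lemma N_one [simp]: "\<one> \<in> N"
  using subgroup.one_closed[OF subgroup_N] .

lemma U_subset_B: "U \<subseteq> B"
  using subgroup.subset[OF normal_imp_subgroup[OF normal_U]] by simp

lemma subgroup_H: "subgroup (B \<inter> N) G"
  using subgroups_Inter_pair[OF subgroup_B subgroup_N] .

lemma carrier_Weyl: "carrier Weyl = cl ` N"
  by (auto simp: weyl_group_def FactGroup_def RCOSETS_def r_coset_def)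

lemma one_Weyl: "\<one>\<^bsub>Weyl\<^esub> = B \<inter> N"
  by (simp add: weyl_group_def FactGroup_def)

lemma group_Weyl: "group Weyl"
  unfolding weyl_group_def by (rule normal.factorgroup_is_group[OF normal_H])

lemma mult_Weyl:
  assumes "n \<in> N" "m \<in> N"
  shows "cl n \<otimes>\<^bsub>Weyl\<^esub> cl m = cl (n \<otimes> m)"
  using normal.rcos_sum[OF normal_H, of n m] assms
  by (simp add: weyl_group_def FactGroup_def r_coset_def set_mult_def)

lemma cl_self: "n \<in> N \<Longrightarrow> n \<in> cl n"
  using rcos_self[OF _ subgroup_H] by simp

lemma mem_Weyl:
  assumes "w \<in> carrier Weyl" "n \<in> w"
  shows "n \<in> N" and "w = cl n"
proof -
  obtain m where m: "m \<in> N" "w = cl m" using assms(1) carrier_Weyl by auto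
  with assms(2) show "n \<in> N" by (auto simp: r_coset_def)
  show "w = cl n" using m assms(2) repr_independence[OF _ _ subgroup_H, of n m] by simp
qed

lemma ex_rep: "w \<in> carrier Weyl \<Longrightarrow> \<exists>n. n \<in> w"
  using carrier_Weyl cl_self by auto

lemma cl_carrier [simp]: "n \<in> N \<Longrightarrow> cl n \<in> carrier Weyl"
  by (auto simp: carrier_Weyl)

lemma S_ne_one: "s \<in> S \<Longrightarrow> s \<noteq> \<one>\<^bsub>Weyl\<^esub>"
  using S_order[of s] group.ord_eq_1[OF group_Weyl, of "\<one>\<^bsub>Weyl\<^esub>"] group.is_monoid[OF group_Weyl, THEN monoid.one_closed] by auto

end

sublocale split_BN_pair \<subseteq> W: involution_system Weyl S
proof -
  interpret W: group Weyl by (rule group_Weyl)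
  show "involution_system Weyl S"
  proof
    fix s assume s: "s \<in> S"
    then have c: "s \<in> carrier Weyl" using S_subset by auto
    show "s \<otimes>\<^bsub>Weyl\<^esub> s = \<one>\<^bsub>Weyl\<^esub>"
      using W.pow_ord_eq_1[OF c] S_order[OF s] c by (simp add: numeral_2_eq_2)
  qed (use S_subset generate_S in auto)
qed

context split_BN_pair
begin

lemma inv_cl:
  assumes "n \<in> N"
  shows "inv\<^bsub>Weyl\<^esub> (cl n) = cl (inv n)"
proof (rule W.inv_equality)
  have "cl (inv n) \<otimes>\<^bsub>Weyl\<^esub> cl n = cl \<one>" using assms by (simp add: mult_Weyl)
  also have "cl \<one> = \<one>\<^bsub>Weyl\<^esub>"
    using coset_mult_one subgroup.subset[OF subgroup_H] by (simp add: one_Weyl)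
  finally show "cl (inv n) \<otimes>\<^bsub>Weyl\<^esub> cl n = \<one>\<^bsub>Weyl\<^esub>" .
qed (use assms in auto)

lemma inv_rep: "w \<in> carrier Weyl \<Longrightarrow> n \<in> w \<Longrightarrow> inv n \<in> inv\<^bsub>Weyl\<^esub> w"
  using mem_Weyl[of w n] cl_self[of "inv n"] by (simp add: inv_cl)

lemma mult_rep: "\<lbrakk>v \<in> carrier Weyl; w \<in> carrier Weyl; m \<in> v; n \<in> w\<rbrakk> \<Longrightarrow> m \<otimes> n \<in> v \<otimes>\<^bsub>Weyl\<^esub> w"
  using mem_Weyl[of v m] mem_Weyl[of w n] cl_self[of "m \<otimes> n"] by (simp add: mult_Weyl)

lemma S_rep:
  assumes "s \<in> S" "ns \<in> s"
  shows "ns \<in> N" and "s = cl ns" and "inv ns \<in> s"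
  using mem_Weyl[of s ns] inv_rep[of s ns] S_subset assms W.S_inv[of s] by auto

section \<open>Double cosets of B\<close>

lemma dcoset_iff: "x \<in> dcoset n \<longleftrightarrow> (\<exists>b\<in>B. \<exists>b'\<in>B. x = b \<otimes> n \<otimes> b')"
  by (auto simp: dcoset_def set_mult_def r_coset_def)

lemma dcosetI: "b \<in> B \<Longrightarrow> b' \<in> B \<Longrightarrow> b \<otimes> n \<otimes> b' \<in> dcoset n"
  by (auto simp: dcoset_iff)

lemma dcoset_carrier: "n \<in> carrier G \<Longrightarrow> x \<in> dcoset n \<Longrightarrow> x \<in> carrier G"
  by (auto simp: dcoset_iff)

lemma dcoset_self: "n \<in> carrier G \<Longrightarrow> n \<in> dcoset n"
  using dcosetI[of \<one> \<one> n] by simp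

lemma dcoset_mult:
  assumes "n \<in> carrier G" "x \<in> dcoset n" "b \<in> B" "b' \<in> B"
  shows "b \<otimes> x \<otimes> b' \<in> dcoset n"
proof -
  obtain c c' where c: "c \<in> B" "c' \<in> B" "x = c \<otimes> n \<otimes> c'" using assms(2) by (auto simp: dcoset_iff)
  then have "b \<otimes> x \<otimes> b' = (b \<otimes> c) \<otimes> n \<otimes> (c' \<otimes> b')" using assms by (simp add: m_assoc)
  moreover have "(b \<otimes> c) \<otimes> n \<otimes> (c' \<otimes> b') \<in> dcoset n" using c assms by (intro dcosetI) auto
  ultimately show ?thesis by simp
qed

lemma dcoset_left: "n \<in> carrier G \<Longrightarrow> x \<in> dcoset n \<Longrightarrow> b \<in> B \<Longrightarrow> b \<otimes> x \<in> dcoset n"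
  using dcoset_mult[of n x b \<one>] dcoset_carrier[of n x] by simp

lemma dcoset_right: "n \<in> carrier G \<Longrightarrow> x \<in> dcoset n \<Longrightarrow> b \<in> B \<Longrightarrow> x \<otimes> b \<in> dcoset n"
  using dcoset_mult[of n x \<one> b] dcoset_carrier[of n x] by simp

lemma dcoset_sym:
  assumes "n \<in> carrier G" "x \<in> dcoset n"
  shows "n \<in> dcoset x"
proof -
  obtain c c' where c: "c \<in> B" "c' \<in> B" "x = c \<otimes> n \<otimes> c'" using assms(2) by (auto simp: dcoset_iff)
  then have "inv c \<otimes> x \<otimes> inv c' = n" using assms(1)
    by (simp add: m_assoc) (simp add: m_assoc[symmetric])
  then show ?thesis using c(1,2) dcosetI[of "inv c" "inv c'" x] by simp
qed

lemma dcoset_eq: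
  assumes "n \<in> carrier G" "x \<in> dcoset n"
  shows "dcoset x = dcoset n"
proof -
  have x: "x \<in> carrier G" using assms by (rule dcoset_carrier)
  have "y \<in> dcoset n" if "y \<in> dcoset x" for y
    using that dcoset_mult[OF assms] by (auto simp: dcoset_iff[of y x])
  moreover have "y \<in> dcoset x" if "y \<in> dcoset n" for y
    using that dcoset_mult[OF x dcoset_sym[OF assms]] by (auto simp: dcoset_iff[of y n])
  ultimately show ?thesis by blast
qed

lemma dcoset_inv:
  assumes "n \<in> carrier G" "x \<in> dcoset n"
  shows "inv x \<in> dcoset (inv n)"
proof -
  obtain c c' where c: "c \<in> B" "c' \<in> B" "x = c \<otimes> n \<otimes> c'" using assms(2) by (auto simp: dcoset_iff)
  then have "inv x = inv c' \<otimes> inv n \<otimes> inv c" using assms(1) by (simp add: m_assoc inv_mult_group)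
  then show ?thesis using c(1,2) dcosetI[of "inv c'" "inv c" "inv n"] by simp
qed

lemma dcoset_B: "b \<in> B \<Longrightarrow> dcoset b = B"
proof -
  assume b: "b \<in> B"
  have "x \<in> dcoset b" if "x \<in> B" for x
    using dcosetI[of "x \<otimes> inv b" \<one> b] that b by (simp add: m_assoc)
  then show ?thesis using b by (auto simp: dcoset_iff)
qed

lemma exchange_elem:
  assumes "s \<in> S" "ns \<in> s" "n \<in> N" "b \<in> B"
  shows "ns \<otimes> b \<otimes> n \<in> dcoset (ns \<otimes> n) \<or> ns \<otimes> b \<otimes> n \<in> dcoset n"
proof -
  have "ns \<otimes> n \<in> s \<otimes>\<^bsub>Weyl\<^esub> cl n"
    using assms S_subset by (intro mult_rep cl_self) auto
  from exchange[OF assms(1) _ assms(2) cl_self[OF assms(3)] this]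
  have "(ns <# B) #> n \<subseteq> dcoset (ns \<otimes> n) \<union> dcoset n" using assms(3) by (simp add: dcoset_def)
  moreover have "ns \<otimes> b \<otimes> n \<in> (ns <# B) #> n" using assms(4) by (auto simp: l_coset_def r_coset_def)
  ultimately show ?thesis by blast
qed

lemma exchange_elem_right:
  assumes "s \<in> S" "ns \<in> s" "n \<in> N" "b \<in> B"
  shows "n \<otimes> b \<otimes> ns \<in> dcoset (n \<otimes> ns) \<or> n \<otimes> b \<otimes> ns \<in> dcoset n"
proof -
  have ns: "ns \<in> N" using S_rep assms by auto
  have e: "inv (inv ns \<otimes> inv b \<otimes> inv n) = n \<otimes> b \<otimes> ns" "inv (inv ns \<otimes> inv n) = n \<otimes> ns"
    using assms ns by (simp_all add: inv_mult_group m_assoc)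
  show ?thesis
    using exchange_elem[OF assms(1) S_rep(3)[OF assms(1,2)], of "inv n" "inv b"] assms ns
      dcoset_inv[of "inv ns \<otimes> inv n" "inv ns \<otimes> inv b \<otimes> inv n"]
      dcoset_inv[of "inv n" "inv ns \<otimes> inv b \<otimes> inv n"] by (auto simp: e)
qed

text \<open>Induction on the shorter length l(m). Write m = s m' with m' shorter. From m \<in> BnB
  the exchange axiom puts m' into BsnB or BnB. In the first case the induction hypothesis gives sn =
  sm in W; in the second it gives n = m' in W, which is too short to be at least as long as
  m.\<close>

lemma dcoset_inj_aux:
  assumes "m \<in> N" "n \<in> N" "W.len (cl m) \<le> W.len (cl n)" "dcoset n = dcoset m"
  shows "cl n = cl m"
  using assms
proof (induction "W.len (cl m)" arbitrary: m n)
  case 0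
  then have "cl m = B \<inter> N" using W.len_eq_0[of "cl m"] by (simp add: one_Weyl)
  then have "m \<in> B" using cl_self[of m] 0 by auto
  then have "n \<in> B" using dcoset_B[of m] dcoset_self[of n] 0 by auto
  then have "cl n = B \<inter> N" using coset_join2[OF _ subgroup_H, of n] 0 by auto
  with \<open>cl m = B \<inter> N\<close> show ?case by simp
next
  case (Suc k)
  obtain ws where ws: "set ws \<subseteq> S" "length ws = W.len (cl m)" "W.wprod ws = cl m"
    using W.ex_reduced[of "cl m"] Suc.prems by auto
  then obtain s ss where sss: "ws = s # ss" using Suc.hyps(2) by (cases ws) auto
  with ws have s: "s \<in> S" and ss: "set ss \<subseteq> S" by auto
  obtain ns where ns: "ns \<in> s" using ex_rep s S_subset by blast
  have nsN: "ns \<in> N" and s_eq: "s = cl ns" and ins: "inv ns \<in> s" using S_rep[OF s ns] by auto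
  have s_inv: "s = cl (inv ns)" using S_rep(2)[OF s ins] .
  define m' where "m' = inv ns \<otimes> m"
  have m'N: "m' \<in> N" using nsN Suc.prems by (simp add: m'_def)
  have cl_m': "cl m' = s \<otimes>\<^bsub>Weyl\<^esub> cl m"
    using mult_Weyl[of "inv ns" m] nsN Suc.prems by (simp add: m'_def s_inv[symmetric])
  also have "\<dots> = W.wprod ss" using ws(3) sss s ss by (simp add: ws(3)[symmetric])
  finally have "W.len (cl m') \<le> length ss" using W.len_le[OF ss] by simp
  moreover have "W.len (s \<otimes>\<^bsub>Weyl\<^esub> cl m') \<le> W.len s + W.len (cl m')"
    by (rule W.len_mult_le) (use s m'N in auto)
  moreover have "s \<otimes>\<^bsub>Weyl\<^esub> cl m' = cl m" using cl_m' s Suc.prems by simp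
  ultimately have len_m': "W.len (cl m') = k"
    using Suc.hyps(2) ws(2) sss W.len_S_le[OF s] by simp
  have "m \<in> dcoset n" using dcoset_self[of m] Suc.prems by simp
  then obtain b b' where b: "b \<in> B" "b' \<in> B" "m = b \<otimes> n \<otimes> b'" by (auto simp: dcoset_iff)
  then have m'_eq: "m' = inv ns \<otimes> b \<otimes> n \<otimes> b'" using nsN Suc.prems(2) by (simp add: m'_def m_assoc)
  consider "inv ns \<otimes> b \<otimes> n \<in> dcoset (inv ns \<otimes> n)" | "inv ns \<otimes> b \<otimes> n \<in> dcoset n"
    using exchange_elem[OF s ins Suc.prems(2) b(1)] by blast
  then show ?case
  proof cases
    case 1
    then have "m' \<in> dcoset (inv ns \<otimes> n)" unfolding m'_eq
      by (rule dcoset_right[rotated]) (use b(2) nsN Suc.prems(2) in auto)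
    then have d: "dcoset m' = dcoset (inv ns \<otimes> n)" by (rule dcoset_eq[rotated]) (use nsN Suc.prems in auto)
    have cl_n: "cl (inv ns \<otimes> n) = s \<otimes>\<^bsub>Weyl\<^esub> cl n"
      using mult_Weyl[of "inv ns" n] nsN Suc.prems by (simp add: s_inv[symmetric])
    have "W.len (s \<otimes>\<^bsub>Weyl\<^esub> (s \<otimes>\<^bsub>Weyl\<^esub> cl n)) \<le> W.len s + W.len (s \<otimes>\<^bsub>Weyl\<^esub> cl n)"
      by (rule W.len_mult_le) (use s Suc.prems in auto)
    then have "W.len (cl m') \<le> W.len (cl (inv ns \<otimes> n))"
      using Suc.hyps(2) Suc.prems s W.len_S_le[OF s] by (simp add: cl_n len_m')
    then have "cl (inv ns \<otimes> n) = cl m'"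
      by (intro Suc.hyps(1)) (use len_m' m'N nsN Suc.prems d in auto)
    then have "s \<otimes>\<^bsub>Weyl\<^esub> cl n = s \<otimes>\<^bsub>Weyl\<^esub> cl m" using cl_n cl_m' by simp
    then show ?thesis using s Suc.prems by (metis W.S_cancel cl_carrier)
  next
    case 2
    then have "m' \<in> dcoset n" unfolding m'_eq by (rule dcoset_right[rotated]) (use b(2) Suc.prems(2) in auto)
    then have "dcoset n = dcoset m'" using dcoset_eq[of n m'] Suc.prems by simp
    then have "cl n = cl m'"
      by (intro Suc.hyps(1)) (use len_m' m'N Suc.prems Suc.hyps(2) in auto)
    then show ?thesis using len_m' Suc.prems Suc.hyps(2) by simp
  qed
qed

lemma dcoset_inj: "m \<in> N \<Longrightarrow> n \<in> N \<Longrightarrow> dcoset n = dcoset m \<Longrightarrow> cl n = cl m"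
  using dcoset_inj_aux[of m n] dcoset_inj_aux[of n m] linorder_linear[of "W.len (cl m)" "W.len (cl n)"] by argo

text \<open>This is \<open>BsB \<cdot> BwB = BswB\<close>, which turns out to be equivalent to \<open>l(sw) > l(w)\<close>.\<close>

definition dcoset_mult_single :: "'a set \<Rightarrow> 'a set \<Rightarrow> bool" where
  "dcoset_mult_single s w \<longleftrightarrow> (\<forall>ns\<in>s. \<forall>nw\<in>w. \<forall>b\<in>B. ns \<otimes> b \<otimes> nw \<in> dcoset (ns \<otimes> nw))"

text \<open>The axiom only denies equality of sets. By finiteness the injective map b \<mapsto> ns b
  ns cannot send B properly into itself, so some element must leave B.\<close>

lemma ex_not_normalize:
  assumes "s \<in> S" "ns \<in> s"
  shows "\<exists>b\<in>B. ns \<otimes> b \<otimes> ns \<notin> B"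
proof (rule ccontr)
  assume "\<not> ?thesis"
  then have sub: "(\<lambda>b. ns \<otimes> b \<otimes> ns) ` B \<subseteq> B" by auto
  have ns: "ns \<in> carrier G" using S_rep assms by auto
  have "finite B" using finite_subset[OF subgroup.subset[OF subgroup_B] finite_G] .
  moreover have "inj_on (\<lambda>b. ns \<otimes> b \<otimes> ns) B" using ns by (auto simp: inj_on_def)
  ultimately have "(\<lambda>b. ns \<otimes> b \<otimes> ns) ` B = B" using sub by (simp add: endo_inj_surj)
  moreover have "(ns <# B) #> ns = (\<lambda>b. ns \<otimes> b \<otimes> ns) ` B" by (auto simp: l_coset_def r_coset_def)
  ultimately show False using not_normalize[OF assms] by simp
qed

end

text \<open>Each half-space axiom compares two double cosets that contain the same element;
  \<open>dcoset_inj\<close> then turns the comparison into an equation in W.\<close>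

sublocale split_BN_pair \<subseteq> W: exchange_system Weyl S dcoset_mult_single
proof
  fix s assume s: "s \<in> S"
  show "dcoset_mult_single s \<one>\<^bsub>Weyl\<^esub>"
    unfolding dcoset_mult_single_def one_Weyl
  proof (intro ballI)
    fix ns h b assume ns: "ns \<in> s" and h: "h \<in> B \<inter> N" and b: "b \<in> B"
    have nsN: "ns \<in> carrier G" using S_rep[OF s ns] by simp
    have "ns \<otimes> b \<otimes> h = \<one> \<otimes> (ns \<otimes> h) \<otimes> (inv h \<otimes> b \<otimes> h)"
      using nsN h b by (simp add: m_assoc) (simp add: m_assoc[symmetric])
    then show "ns \<otimes> b \<otimes> h \<in> dcoset (ns \<otimes> h)" using dcosetI[of \<one> "inv h \<otimes> b \<otimes> h" "ns \<otimes> h"] h b by simp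
  qed
next
  fix s w assume s: "s \<in> S" and w: "w \<in> carrier Weyl" and P: "dcoset_mult_single s w"
  show "\<not> dcoset_mult_single s (s \<otimes>\<^bsub>Weyl\<^esub> w)"
  proof
    assume P': "dcoset_mult_single s (s \<otimes>\<^bsub>Weyl\<^esub> w)"
    obtain ns where ns: "ns \<in> s" using ex_rep s S_subset by blast
    obtain nw where nw: "nw \<in> w" using ex_rep w by blast
    note nsN = S_rep[OF s ns] and nwN = mem_Weyl[OF w nw]
    \<comment> \<open>By the exchange axiom this element lies in BsB. Its product with
      \<open>nw\<close> lies in BwB by the assumption at sw and in BswB by the assumption at w, so w
      = sw, which is impossible.\<close>
    obtain b where b: "b \<in> B" "ns \<otimes> b \<otimes> ns \<notin> B" using ex_not_normalize[OF s ns] by blast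
    have "ns \<otimes> ns \<in> s \<otimes>\<^bsub>Weyl\<^esub> s" using s ns by (intro mult_rep) auto
    then have "ns \<otimes> ns \<in> B" using s by (simp add: W.S_square one_Weyl)
    then have "ns \<otimes> b \<otimes> ns \<in> dcoset ns"
      using exchange_elem[OF s ns nsN(1) b(1)] b(2) dcoset_B by auto
    then obtain b1 b2 where b12: "b1 \<in> B" "b2 \<in> B" "ns \<otimes> b \<otimes> ns = b1 \<otimes> ns \<otimes> b2"
      by (auto simp: dcoset_iff)
    have "ns \<otimes> nw \<in> s \<otimes>\<^bsub>Weyl\<^esub> w" using s w ns nw by (intro mult_rep) auto
    then have "ns \<otimes> b \<otimes> (ns \<otimes> nw) \<in> dcoset (ns \<otimes> (ns \<otimes> nw))"
      using P' ns b(1) unfolding dcoset_mult_single_def by blast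
    also have "ns \<otimes> (ns \<otimes> nw) = (ns \<otimes> ns) \<otimes> nw \<otimes> \<one>" using nsN nwN by (simp add: m_assoc)
    then have "ns \<otimes> (ns \<otimes> nw) \<in> dcoset nw" using dcosetI[of "ns \<otimes> ns" \<one> nw] \<open>ns \<otimes> ns \<in> B\<close> by simp
    then have "dcoset (ns \<otimes> (ns \<otimes> nw)) = dcoset nw" by (rule dcoset_eq[rotated]) (use nwN in simp)
    also have "ns \<otimes> b \<otimes> (ns \<otimes> nw) = ns \<otimes> b \<otimes> ns \<otimes> nw" using nsN nwN b by (simp add: m_assoc)
    also have "\<dots> = b1 \<otimes> (ns \<otimes> b2 \<otimes> nw)" unfolding b12(3) using nsN nwN b12 by (simp add: m_assoc)
    finally have 1: "b1 \<otimes> (ns \<otimes> b2 \<otimes> nw) \<in> dcoset nw" .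
    have "ns \<otimes> b2 \<otimes> nw \<in> dcoset (ns \<otimes> nw)"
      using P ns nw b12(2) unfolding dcoset_mult_single_def by blast
    then have "b1 \<otimes> (ns \<otimes> b2 \<otimes> nw) \<in> dcoset (ns \<otimes> nw)"
      by (rule dcoset_left[rotated]) (use nsN nwN b12 in auto)
    from dcoset_eq[OF _ this] dcoset_eq[OF _ 1] have "dcoset (ns \<otimes> nw) = dcoset nw"
      using nsN nwN by simp
    then have "cl nw = cl (ns \<otimes> nw)" using dcoset_inj[of "ns \<otimes> nw" nw] nsN nwN by simp
    then have "w = s \<otimes>\<^bsub>Weyl\<^esub> w" using nsN nwN mult_Weyl[of ns nw] by metis
    then show False using S_ne_one[OF s] s w by (metis W.S_carrier W.r_cancel_one')
  qed
next
  fix s t w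
  assume s: "s \<in> S" and t: "t \<in> S" and w: "w \<in> carrier Weyl"
    and P: "dcoset_mult_single s w" and nP: "\<not> dcoset_mult_single s (w \<otimes>\<^bsub>Weyl\<^esub> t)"
  obtain ns m b where ns: "ns \<in> s" and m: "m \<in> w \<otimes>\<^bsub>Weyl\<^esub> t" and b: "b \<in> B"
    and nin: "ns \<otimes> b \<otimes> m \<notin> dcoset (ns \<otimes> m)"
    using nP unfolding dcoset_mult_single_def by blast
  obtain nt where nt: "nt \<in> t" using ex_rep t S_subset by blast
  note nsN = S_rep[OF s ns] and ntN = S_rep[OF t nt]
  have wt: "w \<otimes>\<^bsub>Weyl\<^esub> t \<in> carrier Weyl" using w t by simp
  note mN = mem_Weyl[OF wt m]
  define nw where "nw = m \<otimes> inv nt"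
  have "nw \<in> w \<otimes>\<^bsub>Weyl\<^esub> t \<otimes>\<^bsub>Weyl\<^esub> t"
    unfolding nw_def using t w m ntN by (intro mult_rep) auto
  then have nw: "nw \<in> w" using w t by simp
  note nwN = mem_Weyl[OF w nw]
  have m_eq: "m = nw \<otimes> nt" using mN ntN by (simp add: nw_def m_assoc)
  have x_m: "ns \<otimes> b \<otimes> m \<in> dcoset m" using exchange_elem[OF s ns mN(1) b] nin by blast
  \<comment> \<open>Multiplying BswB on the right by \<open>nt\<close> lands in BswtB or BswB. The
    choice of b excludes the former, so BswB and BwtB share the element
    \<open>ns \<otimes> b \<otimes> m\<close>.\<close>
  have "ns \<otimes> b \<otimes> nw \<in> dcoset (ns \<otimes> nw)"
    using P ns nw b unfolding dcoset_mult_single_def by blast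
  then obtain b1 b2 where b12: "b1 \<in> B" "b2 \<in> B" "ns \<otimes> b \<otimes> nw = b1 \<otimes> (ns \<otimes> nw) \<otimes> b2"
    by (auto simp: dcoset_iff)
  have "ns \<otimes> b \<otimes> m = ns \<otimes> b \<otimes> nw \<otimes> nt" unfolding m_eq using nsN nwN ntN b by (simp add: m_assoc)
  also have "\<dots> = b1 \<otimes> (ns \<otimes> nw \<otimes> b2 \<otimes> nt)" unfolding b12(3) using nsN nwN ntN b12 by (simp add: m_assoc)
  finally have x_eq: "ns \<otimes> b \<otimes> m = b1 \<otimes> (ns \<otimes> nw \<otimes> b2 \<otimes> nt)" .
  consider "ns \<otimes> nw \<otimes> b2 \<otimes> nt \<in> dcoset (ns \<otimes> nw \<otimes> nt)" | "ns \<otimes> nw \<otimes> b2 \<otimes> nt \<in> dcoset (ns \<otimes> nw)"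
    using exchange_elem_right[OF t nt, of "ns \<otimes> nw" b2] nsN nwN b12 by auto
  then show "s \<otimes>\<^bsub>Weyl\<^esub> w = w \<otimes>\<^bsub>Weyl\<^esub> t"
  proof cases
    case 1
    then have "ns \<otimes> b \<otimes> m \<in> dcoset (ns \<otimes> nw \<otimes> nt)"
      unfolding x_eq by (rule dcoset_left[rotated]) (use nsN nwN ntN b12 in auto)
    also have "ns \<otimes> nw \<otimes> nt = ns \<otimes> m" unfolding m_eq using nsN nwN ntN by (simp add: m_assoc)
    finally show ?thesis using nin by simp
  next
    case 2
    then have "ns \<otimes> b \<otimes> m \<in> dcoset (ns \<otimes> nw)"
      unfolding x_eq by (rule dcoset_left[rotated]) (use nsN nwN b12 in auto)
    with x_m have "dcoset (ns \<otimes> nw) = dcoset m" using dcoset_eq nsN nwN mN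
      by (metis N_carrier N_mult)
    then have "cl (ns \<otimes> nw) = cl m" using dcoset_inj[of m "ns \<otimes> nw"] nsN nwN mN by simp
    then show ?thesis using nsN nwN mN mult_Weyl[of ns nw] by metis
  qed
qed

context split_BN_pair
begin

section \<open>Conjugation into B along length-additive products\<close>

lemma conjg_mult: "\<lbrakk>m \<in> carrier G; n \<in> carrier G; x \<in> carrier G\<rbrakk> \<Longrightarrow> conjg (m \<otimes> n) x = conjg m (conjg n x)"
  by (simp add: inv_mult_group m_assoc)

text \<open>The assumption on \<open>dcoset_mult_single\<close> means l(zt) > l(z). If the conjugate
  of b by \<open>nt\<close> left B, it would lie in BtB, and multiplying it by \<open>nz\<close>
  would give an element of BztB. But that product is also an element of B times \<open>nz\<close>,
  hence in BzB, which forces zt = z.\<close>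

lemma conj_step:
  assumes t: "t \<in> S" and z: "z \<in> carrier Weyl" and P: "dcoset_mult_single t (inv\<^bsub>Weyl\<^esub> z)"
    and nz: "nz \<in> z" and nt: "nt \<in> t" and b: "b \<in> B" and in_B: "conjg nz (conjg nt b) \<in> B"
  shows "conjg nt b \<in> B"
proof (rule ccontr)
  assume nB: "conjg nt b \<notin> B"
  note ntN = S_rep[OF t nt] and nzN = mem_Weyl[OF z nz]
  have "conjg nt b \<in> dcoset (nt \<otimes> inv nt) \<or> conjg nt b \<in> dcoset (inv nt)"
    using ntN b by (intro exchange_elem[OF t nt]) auto
  moreover have "dcoset (nt \<otimes> inv nt) = B" using ntN dcoset_B[of \<one>] by simp
  ultimately obtain b1 b2 where b12: "b1 \<in> B" "b2 \<in> B" "conjg nt b = b1 \<otimes> inv nt \<otimes> b2"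
    using nB by (auto simp: dcoset_iff)
  have "nt \<otimes> inv b1 \<otimes> inv nz \<in> dcoset (nt \<otimes> inv nz)"
    using P nt inv_rep[OF z nz] B_inv[OF b12(1)] unfolding dcoset_mult_single_def by blast
  then have "inv (nt \<otimes> inv b1 \<otimes> inv nz) \<in> dcoset (inv (nt \<otimes> inv nz))"
    by (rule dcoset_inv[rotated]) (use ntN nzN in auto)
  then have "nz \<otimes> b1 \<otimes> inv nt \<in> dcoset (nz \<otimes> inv nt)"
    using ntN nzN b12 by (simp add: inv_mult_group m_assoc)
  then have "nz \<otimes> b1 \<otimes> inv nt \<otimes> b2 \<in> dcoset (nz \<otimes> inv nt)"
    by (rule dcoset_right[rotated]) (use ntN nzN b12 in auto)
  also have "nz \<otimes> b1 \<otimes> inv nt \<otimes> b2 = nz \<otimes> conjg nt b" unfolding b12(3) using ntN nzN b12 by (simp add: m_assoc)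
  also have "nz \<otimes> conjg nt b = conjg nz (conjg nt b) \<otimes> nz \<otimes> \<one>" using ntN nzN b by (simp add: m_assoc)
  finally have "conjg nz (conjg nt b) \<otimes> nz \<otimes> \<one> \<in> dcoset (nz \<otimes> inv nt)" .
  moreover have "conjg nz (conjg nt b) \<otimes> nz \<otimes> \<one> \<in> dcoset nz" using in_B by (intro dcosetI) auto
  ultimately have "dcoset (nz \<otimes> inv nt) = dcoset nz" using dcoset_eq ntN nzN
    by (metis N_carrier N_mult N_inv)
  then have "cl nz = cl (nz \<otimes> inv nt)" using dcoset_inj[of "nz \<otimes> inv nt" nz] ntN nzN by simp
  then have "z = z \<otimes>\<^bsub>Weyl\<^esub> t"
    using mult_Weyl[of nz "inv nt"] ntN(1) nzN S_rep(2)[OF t ntN(3)] by simp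
  then show False using S_ne_one[OF t] t z by (metis W.S_carrier W.l_cancel_one')
qed

text \<open>Write y = zt with t the last letter of a reduced word. As l(xzt) = l(xz) + 1,
  \<open>conj_step\<close> for xz keeps the conjugate of b by \<open>nt\<close> inside B, and the
  induction hypothesis for z applies to that conjugate. Hence b varies in the induction.\<close>

lemma conj_suffix:
  assumes "x \<in> carrier Weyl" "y \<in> carrier Weyl" "W.len (x \<otimes>\<^bsub>Weyl\<^esub> y) = W.len x + W.len y"
    and "nx \<in> x" "ny \<in> y" "b \<in> B" "conjg (nx \<otimes> ny) b \<in> B"
  shows "conjg ny b \<in> B"
proof -
  obtain ss where "set ss \<subseteq> S" "length ss = W.len y" "W.wprod ss = y"
    using W.ex_reduced[OF assms(2)] by auto
  then show ?thesis using assms(2,3,5,6,7)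
  proof (induction ss arbitrary: y ny b rule: rev_induct)
    case Nil
    then have "ny \<in> B" by (auto simp: one_Weyl)
    then show ?case using Nil by simp
  next
    case (snoc t ss)
    define z where "z = W.wprod ss"
    have t: "t \<in> S" and ss: "set ss \<subseteq> S" using snoc.prems by auto
    have z: "z \<in> carrier Weyl" and y: "y = z \<otimes>\<^bsub>Weyl\<^esub> t"
      using snoc.prems ss t by (auto simp: z_def W.wprod_append)
    have xz: "x \<otimes>\<^bsub>Weyl\<^esub> z \<in> carrier Weyl" using assms(1) z by simp
    have "W.len z \<le> length ss" unfolding z_def by (rule W.len_le[OF ss])
    moreover have "W.len y \<le> W.len z + W.len t" unfolding y by (rule W.len_mult_le) (use z t in auto)
    ultimately have len_z: "length ss = W.len z" and len_y: "W.len y = W.len z + 1"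
      using snoc.prems(2) W.len_S_le[OF t] by auto
    have xy: "x \<otimes>\<^bsub>Weyl\<^esub> y = (x \<otimes>\<^bsub>Weyl\<^esub> z) \<otimes>\<^bsub>Weyl\<^esub> t"
      unfolding y using assms(1) z t by (simp add: W.m_assoc)
    have "W.len (x \<otimes>\<^bsub>Weyl\<^esub> z) \<le> W.len x + W.len z" by (rule W.len_mult_le) (use assms(1) z in auto)
    moreover have "W.len (x \<otimes>\<^bsub>Weyl\<^esub> y) \<le> W.len (x \<otimes>\<^bsub>Weyl\<^esub> z) + W.len t"
      unfolding xy by (rule W.len_mult_le) (use xz t in auto)
    ultimately have len_xz: "W.len (x \<otimes>\<^bsub>Weyl\<^esub> z) = W.len x + W.len z"
      using len_y snoc.prems(5) W.len_S_le[OF t] by auto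
    have "W.len (t \<otimes>\<^bsub>Weyl\<^esub> inv\<^bsub>Weyl\<^esub> (x \<otimes>\<^bsub>Weyl\<^esub> z)) = W.len (inv\<^bsub>Weyl\<^esub> (x \<otimes>\<^bsub>Weyl\<^esub> y))"
      unfolding xy using xz t by (simp add: W.inv_mult_group W.S_inv)
    then have P: "dcoset_mult_single t (inv\<^bsub>Weyl\<^esub> (x \<otimes>\<^bsub>Weyl\<^esub> z))"
      using t xz snoc.prems(4,5) assms(1) len_y len_xz
      by (subst W.ascent_iff) (auto simp: W.len_inv)
    obtain nt where nt: "nt \<in> t" using ex_rep t S_subset by blast
    note ntN = S_rep[OF t nt] and nyN = mem_Weyl[OF snoc.prems(4,6)] and nxN = mem_Weyl[OF assms(1,4)]
    define nz where "nz = ny \<otimes> inv nt"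
    have "nz \<in> z \<otimes>\<^bsub>Weyl\<^esub> t \<otimes>\<^bsub>Weyl\<^esub> t"
      unfolding nz_def y[symmetric] using t snoc.prems(4,6) ntN by (intro mult_rep) auto
    then have nz: "nz \<in> z" using z t by simp
    note nzN = mem_Weyl[OF z nz]
    have ny_eq: "ny = nz \<otimes> nt" using nyN ntN by (simp add: nz_def m_assoc)
    have c: "conjg (nx \<otimes> ny) b = conjg (nx \<otimes> nz) (conjg nt b)"
      unfolding ny_eq using nxN nzN ntN snoc.prems(7)
      by (simp add: inv_mult_group m_assoc)
    have "conjg nt b \<in> B"
      using conj_step[OF t xz P _ nt snoc.prems(7)] mult_rep[OF assms(1) z assms(4) nz] snoc.prems(8) c by simp
    then have "conjg nz (conjg nt b) \<in> B"
      using snoc.IH[OF ss len_z z_def[symmetric] z len_xz nz] snoc.prems(8) unfolding c by blast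
    then show ?case unfolding ny_eq using nzN ntN snoc.prems(7) by (simp add: conjg_mult)
  qed
qed

text \<open>Every n represents a length-additive suffix of w0, so \<open>conj_suffix\<close> keeps b
  in B under conjugation by all of N, and saturation puts it into H.\<close>

lemma longest_Int:
  assumes w0: "longest_element Weyl S w0" and n0: "n0 \<in> w0" and b: "b \<in> B" and cB: "conjg n0 b \<in> B"
  shows "b \<in> B \<inter> N"
proof -
  have w0c: "w0 \<in> carrier Weyl" using w0 by (simp add: longest_element_def)
  note n0N = mem_Weyl[OF w0c n0]
  have all: "conjg n b \<in> B" if n: "n \<in> N" for n
  proof -
    obtain x where x: "x \<in> carrier Weyl" "w0 = x \<otimes>\<^bsub>Weyl\<^esub> cl n" "W.len w0 = W.len x + W.len (cl n)"
      using W.longest_suffix[OF w0, of "cl n"] n by auto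
    have "n0 \<otimes> inv n \<in> w0 \<otimes>\<^bsub>Weyl\<^esub> inv\<^bsub>Weyl\<^esub> (cl n)"
      using w0c n0 n by (intro mult_rep inv_rep cl_self) auto
    also have "w0 \<otimes>\<^bsub>Weyl\<^esub> inv\<^bsub>Weyl\<^esub> (cl n) = x" using x n by (simp add: W.m_assoc)
    finally have nx: "n0 \<otimes> inv n \<in> x" .
    have "n0 \<otimes> inv n \<otimes> n = n0" using n n0N by (simp add: m_assoc)
    then show ?thesis
      using conj_suffix[OF x(1) _ _ nx cl_self[OF n] b] x n cB by simp
  qed
  have "b \<in> (n <# B) #> inv n" if n: "n \<in> N" for n
  proof -
    have "b = n \<otimes> conjg (inv n) b \<otimes> inv n" using n b by (simp add: m_assoc) (simp add: m_assoc[symmetric])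
    then show ?thesis using all[of "inv n"] n by (force simp: l_coset_def r_coset_def)
  qed
  then show ?thesis using saturated by blast
qed

lemma longest_U_Int:
  assumes w0: "longest_element Weyl S w0" and n0: "n0 \<in> w0" and u: "u \<in> U" and c: "inv n0 \<otimes> u \<otimes> n0 \<in> B"
  shows "u = \<one>"
proof -
  have w0c: "w0 \<in> carrier Weyl" using w0 by (simp add: longest_element_def)
  have "u \<in> B \<inter> N"
    using longest_Int[OF W.longest_inv[OF w0] inv_rep[OF w0c n0], of u] c u U_subset_B mem_Weyl[OF w0c n0]
    by auto
  then show ?thesis using u U_Int_H by auto
qed

text \<open>Take s with l(sw) > l(w), where w is the class of n. Splitting off the suffix w^{-1} s
  of w0 gives w0 s = x w^{-1} with additive lengths. An element of U_s is conjugated into U by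
  \<open>n0 \<otimes> ns\<close>, a representative of w0 s, so \<open>conj_suffix\<close> shows that
  the suffix w^{-1} already conjugates it into B.\<close>

lemma ex_root_part_conj:
  assumes w0: "longest_element Weyl S w0" and n0: "n0 \<in> w0" and n: "n \<in> N" "n \<notin> w0"
  shows "\<exists>s\<in>S. \<forall>ns\<in>s. \<forall>u\<in>root_part G U n0 ns. inv n \<otimes> u \<otimes> n \<in> B"
proof -
  have w0c: "w0 \<in> carrier Weyl" using w0 by (simp add: longest_element_def)
  note n0N = mem_Weyl[OF w0c n0]
  have nw: "cl n \<in> carrier Weyl" "n \<in> cl n" using n cl_self by auto
  obtain s where s: "s \<in> S" and P: "dcoset_mult_single s (cl n)"
    using W.ex_ascent[OF w0 nw(1)] n nw by auto
  have sc: "s \<in> carrier Weyl" using s by simp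
  let ?w = "inv\<^bsub>Weyl\<^esub> (cl n)"
  have wc: "?w \<in> carrier Weyl" using nw by simp
  obtain x where x: "x \<in> carrier Weyl" "w0 = x \<otimes>\<^bsub>Weyl\<^esub> (?w \<otimes>\<^bsub>Weyl\<^esub> s)"
    "W.len w0 = W.len x + W.len (?w \<otimes>\<^bsub>Weyl\<^esub> s)"
    using W.longest_suffix[OF w0, of "?w \<otimes>\<^bsub>Weyl\<^esub> s"] wc sc by auto
  have "W.len (?w \<otimes>\<^bsub>Weyl\<^esub> s) = W.len (inv\<^bsub>Weyl\<^esub> (s \<otimes>\<^bsub>Weyl\<^esub> cl n))"
    using nw s by (simp add: W.inv_mult_group W.S_inv)
  also have "\<dots> = W.len ?w + 1" using W.len_ascent[OF s nw(1) P] nw sc by (simp add: W.len_inv)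
  finally have len_ws: "W.len (?w \<otimes>\<^bsub>Weyl\<^esub> s) = W.len ?w + 1" .
  have w0_eq: "w0 = x \<otimes>\<^bsub>Weyl\<^esub> ?w \<otimes>\<^bsub>Weyl\<^esub> s" using x wc sc by (simp add: W.m_assoc)
  have xw: "x \<otimes>\<^bsub>Weyl\<^esub> ?w \<in> carrier Weyl" using x wc by simp
  have "W.len (x \<otimes>\<^bsub>Weyl\<^esub> ?w) \<le> W.len x + W.len ?w" by (rule W.len_mult_le) (use x wc in auto)
  moreover have "W.len w0 \<le> W.len (x \<otimes>\<^bsub>Weyl\<^esub> ?w) + W.len s"
    unfolding w0_eq by (rule W.len_mult_le) (use xw sc in auto)
  ultimately have len_xw: "W.len (x \<otimes>\<^bsub>Weyl\<^esub> ?w) = W.len x + W.len ?w"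
    using x(3) len_ws W.len_S_le[OF s] by simp
  show ?thesis
  proof (intro bexI[OF _ s] ballI)
    fix ns u assume ns: "ns \<in> s" and u: "u \<in> root_part G U n0 ns"
    note nsN = S_rep[OF s ns]
    from u obtain v where v: "v \<in> U" "u = inv ns \<otimes> (inv n0 \<otimes> v \<otimes> n0) \<otimes> ns" and uU: "u \<in> U"
      by (auto simp: root_part_def conj_set_def l_coset_def r_coset_def)
    have uB: "u \<in> B" "v \<in> B" using uU v U_subset_B by auto
    have "n0 \<otimes> ns \<in> w0 \<otimes>\<^bsub>Weyl\<^esub> s" using w0c sc n0 ns by (intro mult_rep) auto
    also have "w0 \<otimes>\<^bsub>Weyl\<^esub> s = x \<otimes>\<^bsub>Weyl\<^esub> ?w" unfolding w0_eq using xw s by simp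
    finally have "n0 \<otimes> ns \<in> x \<otimes>\<^bsub>Weyl\<^esub> ?w" .
    then have "n0 \<otimes> ns \<otimes> n \<in> x \<otimes>\<^bsub>Weyl\<^esub> ?w \<otimes>\<^bsub>Weyl\<^esub> cl n"
      by (rule mult_rep[OF xw nw(1) _ nw(2)])
    then have nx: "n0 \<otimes> ns \<otimes> n \<in> x" using x nw by (simp add: W.m_assoc)
    have ninv: "inv n \<in> ?w" using nw by (intro inv_rep) auto
    have e: "n0 \<otimes> ns \<otimes> n \<otimes> inv n = n0 \<otimes> ns" using n n0N nsN by (simp add: m_assoc)
    have "conjg (n0 \<otimes> ns) u = v"
      unfolding v(2) using n0N nsN uB
      by (simp add: m_assoc inv_mult_group) (simp add: m_assoc[symmetric])
    then have "conjg (inv n) u \<in> B"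
      using conj_suffix[OF x(1) wc len_xw nx ninv uB(1)] uB(2) e by simp
    then show "inv n \<otimes> u \<otimes> n \<in> B" using n by simp
  qed
qed

section \<open>Exhaustion of G by the double cosets\<close>

lemma ex_dcoset_mult:
  assumes "n \<in> N" "m \<in> N" "b \<in> B"
  shows "\<exists>k\<in>N. n \<otimes> b \<otimes> m \<in> dcoset k"
proof -
  obtain ss where "set ss \<subseteq> S" "W.wprod ss = cl n"
    using W.ex_word[of "cl n"] assms(1) by auto
  then show ?thesis using assms(1)
  \<comment> \<open>The word of n is peeled from the left: after the induction hypothesis places the
    remaining product in some BkB, one use of the exchange axiom absorbs the first letter.\<close>
  proof (induction ss arbitrary: n)
    case Nil
    then have "n \<in> B" using cl_self[of n] by (simp add: one_Weyl)
    then have "n \<otimes> b \<in> B" using assms by simp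
    then show ?case using dcosetI[of "n \<otimes> b" \<one> m] assms by auto
  next
    case (Cons s ss)
    then have s: "s \<in> S" and ss: "set ss \<subseteq> S" by auto
    obtain ns where ns: "ns \<in> s" using ex_rep s S_subset by blast
    note nsN = S_rep[OF s ns]
    have "cl (inv ns \<otimes> n) = s \<otimes>\<^bsub>Weyl\<^esub> cl n"
      using mult_Weyl[of "inv ns" n] nsN(1) Cons.prems S_rep(2)[OF s nsN(3)] by simp
    also have "\<dots> = W.wprod ss" using Cons.prems(2)[symmetric] s ss by simp
    finally obtain k where k: "k \<in> N" "inv ns \<otimes> n \<otimes> b \<otimes> m \<in> dcoset k"
      using Cons.IH[of "inv ns \<otimes> n"] ss nsN Cons.prems by auto
    then obtain b1 b2 where b12: "b1 \<in> B" "b2 \<in> B" "inv ns \<otimes> n \<otimes> b \<otimes> m = b1 \<otimes> k \<otimes> b2"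
      by (auto simp: dcoset_iff)
    have "n \<otimes> b \<otimes> m = ns \<otimes> (inv ns \<otimes> n \<otimes> b \<otimes> m)"
      using nsN Cons.prems assms by (simp add: m_assoc) (simp add: m_assoc[symmetric])
    also have "\<dots> = ns \<otimes> b1 \<otimes> k \<otimes> b2" unfolding b12(3) using nsN b12 k by (simp add: m_assoc)
    finally have eq: "n \<otimes> b \<otimes> m = ns \<otimes> b1 \<otimes> k \<otimes> b2" .
    show ?case unfolding eq
      using exchange_elem[OF s ns k(1) b12(1)] dcoset_right[of "ns \<otimes> k"] dcoset_right[of k] b12 nsN k
      by (metis N_carrier N_mult)
  qed
qed

text \<open>The union of the double cosets BkB is stable under left multiplication by B and by N,
  hence by the group they generate, and it contains 1.\<close>

lemma ex_dcoset:
  assumes "g \<in> carrier G"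
  shows "\<exists>n\<in>N. g \<in> dcoset n"
proof -
  have B: "\<exists>k\<in>N. b \<otimes> t \<in> dcoset k" if "b \<in> B" "m \<in> N" "t \<in> dcoset m" for b m t
    using that dcoset_left[of m t b] by auto
  have N: "\<exists>k\<in>N. n \<otimes> t \<in> dcoset k" if n: "n \<in> N" "m \<in> N" "t \<in> dcoset m" for n m t
  proof -
    obtain b1 b2 where b12: "b1 \<in> B" "b2 \<in> B" "t = b1 \<otimes> m \<otimes> b2" using n by (auto simp: dcoset_iff)
    obtain k where k: "k \<in> N" "n \<otimes> b1 \<otimes> m \<in> dcoset k" using ex_dcoset_mult[OF n(1,2) b12(1)] by blast
    have "n \<otimes> t = n \<otimes> b1 \<otimes> m \<otimes> b2" unfolding b12(3) using n b12 by (simp add: m_assoc)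
    then show ?thesis using k dcoset_right[of k "n \<otimes> b1 \<otimes> m" b2] b12 by auto
  qed
  have gen: "\<exists>k\<in>N. x \<otimes> t \<in> dcoset k" if "x \<in> generate G (B \<union> N)" "m \<in> N" "t \<in> dcoset m" for x m t
    using that
  proof (induction arbitrary: m t rule: generate.induct)
    case one
    then show ?case using dcoset_carrier[of m t] by auto
  next
    case (incl h)
    then show ?case using B N by blast
  next
    case (inv h)
    then show ?case using B N B_inv N_inv by blast
  next
    case (eng h1 h2)
    then obtain k where k: "k \<in> N" "h2 \<otimes> t \<in> dcoset k" by blast
    then obtain l where "l \<in> N" "h1 \<otimes> (h2 \<otimes> t) \<in> dcoset l" using eng.IH(1) by blast
    moreover have "h1 \<in> carrier G" "h2 \<in> carrier G" "t \<in> carrier G"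
      using eng generate_BN dcoset_carrier[of m t] by auto
    ultimately show ?case by (auto simp: m_assoc)
  qed
  have "\<one> \<in> dcoset \<one>" using dcoset_self by simp
  then show ?thesis using gen[of g \<one> \<one>] assms generate_BN by simp
qed

text \<open>Since B = UH, the factor from H can be absorbed into N. This form suits functions with
  prescribed behaviour under U on the left and B on the right.\<close>

lemma ex_UNB:
  assumes "g \<in> carrier G"
  shows "\<exists>u\<in>U. \<exists>n\<in>N. \<exists>b\<in>B. g = u \<otimes> n \<otimes> b"
proof -
  obtain n b b' where n: "n \<in> N" "b \<in> B" "b' \<in> B" "g = b \<otimes> n \<otimes> b'"
    using ex_dcoset[OF assms] by (auto simp: dcoset_iff)
  have "b \<in> U <#> (B \<inter> N)" using n B_eq_UH by simp
  then obtain u h where uh: "u \<in> U" "h \<in> B" "h \<in> N" "b = u \<otimes> h" by (auto simp: set_mult_def)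
  have "g = u \<otimes> (h \<otimes> n) \<otimes> b'" using n uh U_subset_B by (auto simp: m_assoc)
  moreover have "h \<otimes> n \<in> N" using uh n by simp
  ultimately show ?thesis using uh n by blast
qed

end

section \<open>Left modules\<close>

context left_module
begin

lemma smult_zero [simp]: "a \<in> carrier R \<Longrightarrow> a \<odot>\<^bsub>M\<^esub> \<zero>\<^bsub>M\<^esub> = \<zero>\<^bsub>M\<^esub>"
  by (metis M.add.l_cancel_one' M.zero_closed M.r_zero l_smult_closed l_smult_r_distr)

lemma zero_smult [simp]: "x \<in> carrier M \<Longrightarrow> \<zero>\<^bsub>R\<^esub> \<odot>\<^bsub>M\<^esub> x = \<zero>\<^bsub>M\<^esub>"
  by (metis M.add.l_cancel_one' R.zero_closed R.r_zero l_smult_closed l_smult_l_distr)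

lemma minus_one_smult: "x \<in> carrier M \<Longrightarrow> (\<ominus>\<^bsub>R\<^esub> \<one>\<^bsub>R\<^esub>) \<odot>\<^bsub>M\<^esub> x = \<ominus>\<^bsub>M\<^esub> x"
  by (rule M.minus_equality[symmetric])
    (metis R.a_inv_closed R.l_neg R.one_closed l_smult_l_distr l_smult_one zero_smult, simp_all add: l_smult_closed)

text \<open>Closure under negatives, which \<open>Module.submodule\<close> demands through its
  additive subgroup, comes from multiplication by -1.\<close>

lemma submodule_iff:
  "Module.submodule X R M \<longleftrightarrow> X \<subseteq> carrier M \<and> \<zero>\<^bsub>M\<^esub> \<in> X \<and> (\<forall>x\<in>X. \<forall>y\<in>X. x \<oplus>\<^bsub>M\<^esub> y \<in> X) \<and>
    (\<forall>a\<in>carrier R. \<forall>x\<in>X. a \<odot>\<^bsub>M\<^esub> x \<in> X)" (is "?l \<longleftrightarrow> ?r")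
proof
  assume ?l
  then have "subgroup X (add_monoid M)" "submodule_axioms X R M" by (auto simp: Module.submodule_def)
  then show ?r by (auto simp: subgroup_def submodule_axioms_def)
next
  assume r: ?r
  have "inv\<^bsub>add_monoid M\<^esub> x \<in> X" if "x \<in> X" for x
  proof -
    have "(\<ominus>\<^bsub>R\<^esub> \<one>\<^bsub>R\<^esub>) \<odot>\<^bsub>M\<^esub> x \<in> X" using r that by blast
    moreover have "x \<in> carrier M" using r that by auto
    ultimately show ?thesis using minus_one_smult[of x] by (simp add: a_inv_def[of M])
  qed
  then show ?l using r
    by (auto simp: Module.submodule_def subgroup_def submodule_axioms_def)
qed

lemma submodule_abelian_subgroup: "Module.submodule X R M \<Longrightarrow> abelian_subgroup X M"
  by (intro abelian_subgroupI3 additive_subgroupI)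
    (auto simp: Module.submodule_def M.abelian_group_axioms)

section \<open>Quotient modules\<close>

lemma coset_eq_iff:
  assumes X: "Module.submodule X R M" and x: "x \<in> carrier M" and y: "y \<in> carrier M"
  shows "X +>\<^bsub>M\<^esub> x = X +>\<^bsub>M\<^esub> y \<longleftrightarrow> x \<ominus>\<^bsub>M\<^esub> y \<in> X"
proof -
  interpret X: abelian_subgroup X M by (rule submodule_abelian_subgroup[OF X])
  have "x \<in> X +>\<^bsub>M\<^esub> y \<longleftrightarrow> x \<ominus>\<^bsub>M\<^esub> y \<in> X"
  proof
    assume "x \<in> X +>\<^bsub>M\<^esub> y"
    then obtain z where z: "z \<in> X" "x = z \<oplus>\<^bsub>M\<^esub> y" by (auto simp: a_r_coset_def')
    then have "x \<ominus>\<^bsub>M\<^esub> y = z" using y X.a_subset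
      by (auto simp: M.minus_eq M.a_assoc M.r_neg)
    with z show "x \<ominus>\<^bsub>M\<^esub> y \<in> X" by simp
  next
    assume z: "x \<ominus>\<^bsub>M\<^esub> y \<in> X"
    have "x = (x \<ominus>\<^bsub>M\<^esub> y) \<oplus>\<^bsub>M\<^esub> y" using x y by (simp add: M.minus_eq M.a_assoc M.l_neg)
    with z show "x \<in> X +>\<^bsub>M\<^esub> y" unfolding a_r_coset_def' by blast
  qed
  moreover have "X +>\<^bsub>M\<^esub> x = X +>\<^bsub>M\<^esub> y \<longleftrightarrow> x \<in> X +>\<^bsub>M\<^esub> y"
    using X.a_rcos_self[OF x] M.a_repr_independence[OF _ y X.a_subgroup, of x] by auto
  ultimately show ?thesis by simp
qed

lemma carrier_quotient: "carrier (quotient_module M X) = (\<lambda>x. X +>\<^bsub>M\<^esub> x) ` carrier M"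
  by (auto simp: quotient_module_def A_RCOSETS_def')

lemma zero_quotient: "\<zero>\<^bsub>quotient_module M X\<^esub> = X"
  by (simp add: quotient_module_def)

lemma add_quotient:
  assumes "Module.submodule X R M" "x \<in> carrier M" "y \<in> carrier M"
  shows "(X +>\<^bsub>M\<^esub> x) \<oplus>\<^bsub>quotient_module M X\<^esub> (X +>\<^bsub>M\<^esub> y) = X +>\<^bsub>M\<^esub> (x \<oplus>\<^bsub>M\<^esub> y)"
  using abelian_subgroup.a_rcos_sum[OF submodule_abelian_subgroup[OF assms(1)] assms(2,3)]
  by (simp add: quotient_module_def)

lemma coset_zero: "Module.submodule X R M \<Longrightarrow> X +>\<^bsub>M\<^esub> \<zero>\<^bsub>M\<^esub> = X"
  by (simp add: submodule_iff)

lemma coset_eq_zero_iff: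
  assumes "Module.submodule X R M" "x \<in> carrier M"
  shows "X +>\<^bsub>M\<^esub> x = X \<longleftrightarrow> x \<in> X"
  using coset_eq_iff[OF assms M.zero_closed] assms
  by (simp add: coset_zero M.minus_eq M.minus_equality[of "\<zero>\<^bsub>M\<^esub>" "\<zero>\<^bsub>M\<^esub>"])

text \<open>Maps out of a quotient are encoded as unions over a coset, which avoids choosing
  representatives. If F is constant on the coset, the union collapses to the common value. Scalar
  multiplication on the quotient and the induced map in \<open>module_iso_quotient\<close> are both
  of this kind.\<close>

lemma coset_union:
  assumes X: "Module.submodule X R M" and x: "x \<in> carrier M"
    and F: "\<And>y. y \<in> carrier M \<Longrightarrow> y \<ominus>\<^bsub>M\<^esub> x \<in> X \<Longrightarrow> F y = F x"
  shows "(\<Union>y\<in>X +>\<^bsub>M\<^esub> x. F y) = F x"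
proof -
  interpret X: abelian_subgroup X M by (rule submodule_abelian_subgroup[OF X])
  have "F y = F x" if y: "y \<in> X +>\<^bsub>M\<^esub> x" for y
  proof -
    have yc: "y \<in> carrier M" using y x M.a_r_coset_subset_G[OF X.a_subset x] by auto
    have "X +>\<^bsub>M\<^esub> y = X +>\<^bsub>M\<^esub> x" using M.a_repr_independence[OF y x X.a_subgroup] by simp
    then have "y \<ominus>\<^bsub>M\<^esub> x \<in> X" using coset_eq_iff[OF X yc x] by blast
    then show ?thesis by (rule F[OF yc])
  qed
  then have "(\<Union>y\<in>X +>\<^bsub>M\<^esub> x. F y) = (\<Union>y\<in>X +>\<^bsub>M\<^esub> x. F x)" by (intro SUP_cong) auto
  also have "\<dots> = F x" using X.a_rcos_self[OF x] by auto
  finally show ?thesis .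
qed

lemma smult_diff:
  "\<lbrakk>a \<in> carrier R; x \<in> carrier M; y \<in> carrier M\<rbrakk>
    \<Longrightarrow> a \<odot>\<^bsub>M\<^esub> x \<ominus>\<^bsub>M\<^esub> a \<odot>\<^bsub>M\<^esub> y = a \<odot>\<^bsub>M\<^esub> (x \<ominus>\<^bsub>M\<^esub> y)"
proof -
  assume a: "a \<in> carrier R" and x: "x \<in> carrier M" and y: "y \<in> carrier M"
  have "a \<odot>\<^bsub>M\<^esub> (\<ominus>\<^bsub>M\<^esub> y) \<oplus>\<^bsub>M\<^esub> a \<odot>\<^bsub>M\<^esub> y = \<zero>\<^bsub>M\<^esub>"
    using a y by (simp add: l_smult_r_distr[symmetric] M.l_neg)
  then have "\<ominus>\<^bsub>M\<^esub> (a \<odot>\<^bsub>M\<^esub> y) = a \<odot>\<^bsub>M\<^esub> (\<ominus>\<^bsub>M\<^esub> y)"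
    using a y by (intro M.minus_equality) (auto simp: l_smult_closed)
  then show ?thesis using a x y by (simp add: M.minus_eq l_smult_r_distr)
qed

lemma smult_quotient:
  assumes X: "Module.submodule X R M" and a: "a \<in> carrier R" and x: "x \<in> carrier M"
  shows "a \<odot>\<^bsub>quotient_module M X\<^esub> (X +>\<^bsub>M\<^esub> x) = X +>\<^bsub>M\<^esub> (a \<odot>\<^bsub>M\<^esub> x)"
proof -
  have "X +>\<^bsub>M\<^esub> (a \<odot>\<^bsub>M\<^esub> y) = X +>\<^bsub>M\<^esub> (a \<odot>\<^bsub>M\<^esub> x)" if "y \<in> carrier M" "y \<ominus>\<^bsub>M\<^esub> x \<in> X" for y
    using that a x X
    by (subst coset_eq_iff[OF X]) (auto simp: smult_diff l_smult_closed submodule_iff)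
  then have "(\<Union>y\<in>X +>\<^bsub>M\<^esub> x. X +>\<^bsub>M\<^esub> (a \<odot>\<^bsub>M\<^esub> y)) = X +>\<^bsub>M\<^esub> (a \<odot>\<^bsub>M\<^esub> x)"
    by (intro coset_union[OF X x]) auto
  then show ?thesis by (simp add: quotient_module_def)
qed

lemma left_module_quotient:
  assumes X: "Module.submodule X R M"
  shows "left_module R (quotient_module M X)"
proof -
  let ?Q = "quotient_module M X"
  note [simp] = add_quotient[OF X] smult_quotient[OF X] M.a_ac l_smult_closed
  have zero: "\<zero>\<^bsub>?Q\<^esub> = X +>\<^bsub>M\<^esub> \<zero>\<^bsub>M\<^esub>" using coset_zero[OF X] by (simp add: zero_quotient)
  have "abelian_group ?Q"
  proof (rule abelian_groupI)
    fix x assume "x \<in> carrier ?Q"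
    then obtain z where "z \<in> carrier M" "x = X +>\<^bsub>M\<^esub> z" by (auto simp: carrier_quotient)
    then show "\<exists>y\<in>carrier ?Q. y \<oplus>\<^bsub>?Q\<^esub> x = \<zero>\<^bsub>?Q\<^esub>"
      by (intro bexI[of _ "X +>\<^bsub>M\<^esub> (\<ominus>\<^bsub>M\<^esub> z)"]) (auto simp: carrier_quotient zero M.l_neg M.r_neg)
  qed (auto simp: carrier_quotient zero)
  moreover have "left_module_axioms R ?Q"
    by unfold_locales
      (auto simp: carrier_quotient l_smult_l_distr l_smult_r_distr l_smult_assoc l_smult_one)
  ultimately show ?thesis using R.ring_axioms by (simp add: left_module_def)
qed

text \<open>The correspondence between submodules of the quotient and submodules containing Q:
  images in one direction, preimages under x \<mapsto> Q + x in the other.\<close>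

lemma simple_quotient_iff:
  assumes Q: "Module.submodule Q R M"
  shows "simple_module R (quotient_module M Q) \<longleftrightarrow> Q \<noteq> carrier M \<and>
    (\<forall>X. Module.submodule X R M \<longrightarrow> Q \<subseteq> X \<longrightarrow> X = Q \<or> X = carrier M)" (is "?l \<longleftrightarrow> ?r")
proof -
  let ?Q = "quotient_module M Q" and ?c = "\<lambda>x. Q +>\<^bsub>M\<^esub> x"
  interpret Q: left_module R ?Q by (rule left_module_quotient[OF Q])
  note [simp] = add_quotient[OF Q] smult_quotient[OF Q]
  have mem: "x \<in> carrier M" if "x \<in> Q" for x using that Q by (auto simp: submodule_iff)
  have triv: "carrier ?Q = {Q} \<longleftrightarrow> Q = carrier M"
  proof
    assume "carrier ?Q = {Q}"
    then have "x \<in> Q" if "x \<in> carrier M" for x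
      using that coset_eq_zero_iff[OF Q that] by (auto simp: carrier_quotient)
    then show "Q = carrier M" using mem by auto
  next
    assume "Q = carrier M"
    then show "carrier ?Q = {Q}"
      using coset_eq_zero_iff[OF Q] M.zero_closed by (auto simp: carrier_quotient image_iff)
  qed
  show ?thesis
  proof
    assume l: ?l
    show ?r
    proof (intro conjI allI impI)
      show "Q \<noteq> carrier M" using l triv by (simp add: simple_module_def zero_quotient)
    next
      fix X assume X: "Module.submodule X R M" and QX: "Q \<subseteq> X"
      have Xc: "\<And>x. x \<in> X \<Longrightarrow> x \<in> carrier M" using X by (auto simp: submodule_iff)
      have "Module.submodule (?c ` X) R ?Q"
        unfolding Q.submodule_iff
      proof (intro conjI ballI)
        show "?c ` X \<subseteq> carrier ?Q" using Xc by (auto simp: carrier_quotient)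
        show "\<zero>\<^bsub>?Q\<^esub> \<in> ?c ` X" using X coset_zero[OF Q]
          by (auto simp: zero_quotient submodule_iff intro!: image_eqI[of _ _ "\<zero>\<^bsub>M\<^esub>"])
      qed (use X Xc in \<open>auto simp: submodule_iff\<close>)
      then consider "?c ` X = {Q}" | "?c ` X = carrier ?Q" using l by (auto simp: simple_module_def zero_quotient)
      then show "X = Q \<or> X = carrier M"
      proof cases
        case 1
        then have "?c x = Q" if "x \<in> X" for x using that by blast
        then have "X \<subseteq> Q" using coset_eq_zero_iff[OF Q] Xc by blast
        then show ?thesis using QX by auto
      next
        case 2
        have "y \<in> X" if y: "y \<in> carrier M" for y
        proof -
          have "?c y \<in> ?c ` X" unfolding 2 using y by (auto simp: carrier_quotient)
          then obtain x where x: "x \<in> X" "?c y = ?c x" by blast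
          then have "y \<ominus>\<^bsub>M\<^esub> x \<in> X" using coset_eq_iff[OF Q y Xc] QX by auto
          then have "(y \<ominus>\<^bsub>M\<^esub> x) \<oplus>\<^bsub>M\<^esub> x \<in> X" using X x by (auto simp: submodule_iff)
          then show ?thesis using y Xc[OF x(1)] by (simp add: M.minus_eq M.a_assoc M.l_neg)
        qed
        then show ?thesis using Xc by auto
      qed
    qed
  next
    assume r: ?r
    show ?l unfolding simple_module_def zero_quotient
    proof (intro conjI allI impI)
      show "carrier ?Q \<noteq> {Q}" using r triv by simp
    next
      fix Y assume "Module.submodule Y R ?Q"
      then have Y: "Y \<subseteq> carrier ?Q" "Q \<in> Y" "\<And>x y. x \<in> Y \<Longrightarrow> y \<in> Y \<Longrightarrow> x \<oplus>\<^bsub>?Q\<^esub> y \<in> Y"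
        "\<And>a x. a \<in> carrier R \<Longrightarrow> x \<in> Y \<Longrightarrow> a \<odot>\<^bsub>?Q\<^esub> x \<in> Y"
        by (auto simp: Q.submodule_iff zero_quotient)
      define X where "X = {x \<in> carrier M. ?c x \<in> Y}"
      have "Module.submodule X R M" unfolding submodule_iff
      proof (intro conjI ballI)
        fix x y assume "x \<in> X" "y \<in> X"
        then show "x \<oplus>\<^bsub>M\<^esub> y \<in> X" using Y(3)[of "?c x" "?c y"] by (auto simp: X_def)
      next
        fix a x assume "a \<in> carrier R" "x \<in> X"
        then show "a \<odot>\<^bsub>M\<^esub> x \<in> X" using Y(4)[of a "?c x"] by (auto simp: X_def l_smult_closed)
      qed (use Y(2) coset_zero[OF Q] in \<open>auto simp: X_def\<close>)
      moreover have "x \<in> X" if x: "x \<in> Q" for x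
        using mem[OF x] coset_eq_zero_iff[OF Q mem[OF x]] Y(2) x unfolding X_def by simp
      ultimately consider "X = Q" | "X = carrier M" using r by auto
      then show "Y = {Q} \<or> Y = carrier ?Q"
      proof cases
        case 1
        have "C = Q" if C: "C \<in> Y" for C
        proof -
          obtain x where x: "x \<in> carrier M" "C = ?c x" using Y(1) C by (auto simp: carrier_quotient)
          then have "x \<in> Q" using C 1 by (auto simp: X_def)
          then show ?thesis using coset_eq_zero_iff[OF Q x(1)] x(2) by simp
        qed
        then show ?thesis using Y(2) by blast
      next
        case 2
        then show ?thesis using Y(1) by (auto simp: carrier_quotient X_def)
      qed
    qed
  qed
qed

end

text \<open>The induced map F is well defined and injective because Q is the full preimage of Q'; it
  is surjective because f is.\<close>

lemma module_iso_quotient: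
  assumes M: "left_module R M" and M': "left_module R M'"
    and f: "f \<in> LinearCombinations.module_hom R M M'" and surj: "f ` carrier M = carrier M'"
    and Q': "Module.submodule Q' R M'" and Q: "Q = {x \<in> carrier M. f x \<in> Q'}"
  shows "module_iso R (quotient_module M Q) (quotient_module M' Q')"
proof -
  interpret M: left_module R M by fact
  interpret N: left_module R M' by fact
  have f_cl: "\<And>x. x \<in> carrier M \<Longrightarrow> f x \<in> carrier M'"
    and f_add: "\<And>x y. x \<in> carrier M \<Longrightarrow> y \<in> carrier M \<Longrightarrow> f (x \<oplus>\<^bsub>M\<^esub> y) = f x \<oplus>\<^bsub>M'\<^esub> f y"
    and f_smult: "\<And>a x. a \<in> carrier R \<Longrightarrow> x \<in> carrier M \<Longrightarrow> f (a \<odot>\<^bsub>M\<^esub> x) = a \<odot>\<^bsub>M'\<^esub> f x"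
    using f by (auto simp: LinearCombinations.module_hom_def)
  have f_zero: "f \<zero>\<^bsub>M\<^esub> = \<zero>\<^bsub>M'\<^esub>"
    using f_smult[of "\<zero>\<^bsub>R\<^esub>" "\<zero>\<^bsub>M\<^esub>"] f_cl by simp
  have f_neg: "f (\<ominus>\<^bsub>M\<^esub> x) = \<ominus>\<^bsub>M'\<^esub> f x" if "x \<in> carrier M" for x
    using f_smult[of "\<ominus>\<^bsub>R\<^esub> \<one>\<^bsub>R\<^esub>" x] that f_cl by (simp add: M.minus_one_smult N.minus_one_smult)
  have f_diff: "f (x \<ominus>\<^bsub>M\<^esub> y) = f x \<ominus>\<^bsub>M'\<^esub> f y" if "x \<in> carrier M" "y \<in> carrier M" for x y
    using that by (simp add: M.M.minus_eq N.M.minus_eq f_add f_neg)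
  have Qs: "Module.submodule Q R M"
    using Q' unfolding M.submodule_iff N.submodule_iff Q
    by (auto simp: f_zero f_add f_smult M.l_smult_closed)
  define F where "F C = (\<Union>x\<in>C. Q' +>\<^bsub>M'\<^esub> f x)" for C
  have F: "F (Q +>\<^bsub>M\<^esub> x) = Q' +>\<^bsub>M'\<^esub> f x" if x: "x \<in> carrier M" for x
    unfolding F_def using x
    by (intro M.coset_union[OF Qs]) (auto simp: N.coset_eq_iff[OF Q'] f_cl Q f_diff)
  show ?thesis unfolding module_iso_def
  proof (intro bexI)
    show "F \<in> LinearCombinations.module_hom R (quotient_module M Q) (quotient_module M' Q')"
      unfolding LinearCombinations.module_hom_def
      by (auto simp: M.carrier_quotient N.carrier_quotient F f_cl M.add_quotient[OF Qs] N.add_quotient[OF Q']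
          M.smult_quotient[OF Qs] N.smult_quotient[OF Q'] f_add f_smult M.l_smult_closed)
    have "Q +>\<^bsub>M\<^esub> x = Q +>\<^bsub>M\<^esub> y" if "x \<in> carrier M" "y \<in> carrier M" "Q' +>\<^bsub>M'\<^esub> f x = Q' +>\<^bsub>M'\<^esub> f y" for x y
      using that by (simp add: f_cl N.coset_eq_iff[OF Q'] M.coset_eq_iff[OF Qs] f_diff[symmetric]) (simp add: Q)
    moreover have "Q' +>\<^bsub>M'\<^esub> f x = Q' +>\<^bsub>M'\<^esub> f y"
      if "x \<in> carrier M" "y \<in> carrier M" "F (Q +>\<^bsub>M\<^esub> x) = F (Q +>\<^bsub>M\<^esub> y)" for x y
      using that by (simp add: F)
    ultimately have "inj_on F (carrier (quotient_module M Q))"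
      unfolding inj_on_def M.carrier_quotient by blast
    moreover have "F ` carrier (quotient_module M Q) = carrier (quotient_module M' Q')"
      unfolding M.carrier_quotient N.carrier_quotient surj[symmetric] image_image
      by (rule image_cong) (auto simp: F)
    ultimately show "bij_betw F (carrier (quotient_module M Q)) (carrier (quotient_module M' Q'))"
      by (simp add: bij_betw_def)
  qed
qed

section \<open>Left ideals and idempotents\<close>

text \<open>In \<open>right_unit X f\<close>, the element \<open>f\<close> is an idempotent with \<open>X = R f\<close>.\<close>

context ring
begin

abbreviation lmod :: "'a set \<Rightarrow> ('a, 'a) module" where
  "lmod X \<equiv> (regular_module R)\<lparr>carrier := X\<rparr>"

text \<open>The clauses mirror \<open>submodule_iff\<close>, so that left ideals contained in P are
  the submodules of \<open>lmod P\<close>; negatives are recovered in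
  \<open>left_ideal_neg\<close>.\<close>

definition left_ideal :: "'a set \<Rightarrow> bool" where
  "left_ideal X \<longleftrightarrow> X \<subseteq> carrier R \<and> \<zero> \<in> X \<and> (\<forall>x\<in>X. \<forall>y\<in>X. x \<oplus> y \<in> X) \<and>
    (\<forall>a\<in>carrier R. \<forall>x\<in>X. a \<otimes> x \<in> X)"

definition right_unit :: "'a set \<Rightarrow> 'a \<Rightarrow> bool" where
  "right_unit X f \<longleftrightarrow> left_ideal X \<and> f \<in> X \<and> (\<forall>x\<in>X. x \<otimes> f = x)"

lemma regular_module_simps [simp]:
  "carrier (regular_module R) = carrier R" "zero (regular_module R) = \<zero>"
  "add (regular_module R) = add R" "smult (regular_module R) = mult R"
  by (simp_all add: regular_module_def)

lemma left_idealD: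
  assumes "left_ideal X"
  shows "X \<subseteq> carrier R" "x \<in> X \<Longrightarrow> x \<in> carrier R" "\<zero> \<in> X" "x \<in> X \<Longrightarrow> y \<in> X \<Longrightarrow> x \<oplus> y \<in> X"
    "a \<in> carrier R \<Longrightarrow> x \<in> X \<Longrightarrow> a \<otimes> x \<in> X"
  using assms by (auto simp: left_ideal_def)

lemma left_ideal_neg:
  assumes "left_ideal X" "x \<in> X"
  shows "\<ominus> x \<in> X"
proof -
  have "x \<in> carrier R" using assms left_idealD by blast
  then have "\<ominus> x = (\<ominus> \<one>) \<otimes> x" by (simp add: l_minus)
  with assms show ?thesis using left_idealD(5)[OF assms(1)] by simp
qed

lemma left_ideal_minus: "left_ideal X \<Longrightarrow> x \<in> X \<Longrightarrow> y \<in> X \<Longrightarrow> x \<ominus> y \<in> X"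
  by (simp add: minus_eq left_ideal_neg left_idealD)

lemma add_minus_cancel: "a \<in> carrier R \<Longrightarrow> b \<in> carrier R \<Longrightarrow> (a \<oplus> b) \<ominus> a = b"
  by (subst a_comm) (simp_all add: minus_eq a_assoc r_neg)

lemma left_module_lmod:
  assumes "left_ideal X"
  shows "left_module R (lmod X)"
proof -
  note D [simp] = left_idealD(2-5)[OF assms]
  have "abelian_group (lmod X)"
  proof (rule abelian_groupI)
    fix x assume "x \<in> carrier (lmod X)"
    then have x: "x \<in> X" by simp
    then show "\<exists>y\<in>carrier (lmod X). y \<oplus>\<^bsub>lmod X\<^esub> x = \<zero>\<^bsub>lmod X\<^esub>"
      using left_ideal_neg[OF assms x] by (intro bexI[of _ "\<ominus> x"]) (auto simp: l_neg)
  qed (auto simp: a_ac)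
  moreover have "left_module_axioms R (lmod X)"
    by unfold_locales (auto simp: l_distr r_distr m_assoc)
  ultimately show ?thesis using ring_axioms by (simp add: left_module_def)
qed

lemma submodule_lmod: "left_ideal P \<Longrightarrow> Module.submodule X R (lmod P) \<longleftrightarrow> left_ideal X \<and> X \<subseteq> P"
  using left_module.submodule_iff[OF left_module_lmod, of P X] by (auto simp: left_ideal_def)

lemma left_ideal_PIdl:
  assumes "a \<in> carrier R"
  shows "left_ideal (PIdl a)"
  unfolding left_ideal_def cgenideal_def
proof (intro conjI ballI)
  show "\<zero> \<in> {x \<otimes> a |x. x \<in> carrier R}" using assms by (auto intro!: exI[of _ \<zero>])
next
  fix x y assume "x \<in> {x \<otimes> a |x. x \<in> carrier R}" "y \<in> {x \<otimes> a |x. x \<in> carrier R}"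
  then obtain u v where "u \<in> carrier R" "v \<in> carrier R" "x = u \<otimes> a" "y = v \<otimes> a" by auto
  then show "x \<oplus> y \<in> {x \<otimes> a |x. x \<in> carrier R}"
    using assms by (auto intro!: exI[of _ "u \<oplus> v"] simp: l_distr)
next
  fix r x assume r: "r \<in> carrier R" and "x \<in> {x \<otimes> a |x. x \<in> carrier R}"
  then obtain u where "u \<in> carrier R" "x = u \<otimes> a" by auto
  then show "r \<otimes> x \<in> {x \<otimes> a |x. x \<in> carrier R}"
    using assms r by (auto intro!: exI[of _ "r \<otimes> u"] simp: m_assoc)
qed (use assms in auto)

lemma PIdl_memI: "x \<in> carrier R \<Longrightarrow> x \<otimes> a \<in> PIdl a"
  by (auto simp: cgenideal_def)

lemma PIdl_self: "a \<in> carrier R \<Longrightarrow> a \<in> PIdl a"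
  using PIdl_memI[of \<one> a] by simp

lemma PIdl_subset: "left_ideal X \<Longrightarrow> a \<in> X \<Longrightarrow> PIdl a \<subseteq> X"
  by (auto simp: cgenideal_def left_ideal_def)

lemma right_unit_PIdl:
  assumes "f \<in> carrier R" "f \<otimes> f = f"
  shows "right_unit (PIdl f) f"
  unfolding right_unit_def using assms left_ideal_PIdl PIdl_self
  by (auto simp: cgenideal_def m_assoc)

lemma right_unitD:
  assumes "right_unit X f"
  shows "left_ideal X" "f \<in> X" "f \<in> carrier R" "x \<in> X \<Longrightarrow> x \<otimes> f = x" "f \<otimes> f = f" "X = PIdl f"
proof -
  show X: "left_ideal X" and f: "f \<in> X" using assms by (auto simp: right_unit_def)
  show fc: "f \<in> carrier R" using X f left_idealD by blast
  show u: "x \<in> X \<Longrightarrow> x \<otimes> f = x" for x using assms by (auto simp: right_unit_def)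
  show "f \<otimes> f = f" using f u by simp
  have "X \<subseteq> PIdl f" using u left_idealD(2)[OF X] by (force simp: cgenideal_def)
  then show "X = PIdl f" using PIdl_subset[OF X f] by auto
qed

lemma internal_sum2_lmod:
  assumes "left_ideal P"
  shows "internal_sum2 R (lmod P) X Y \<longleftrightarrow> left_ideal X \<and> left_ideal Y \<and> X \<subseteq> P \<and> Y \<subseteq> P \<and>
    (\<forall>z\<in>P. \<exists>x\<in>X. \<exists>y\<in>Y. z = x \<oplus> y) \<and> X \<inter> Y = {\<zero>}"
proof -
  have "X <+>\<^bsub>lmod P\<^esub> Y = {x \<oplus> y |x y. x \<in> X \<and> y \<in> Y}" by (auto simp: set_add_def')
  moreover have "{x \<oplus> y |x y. x \<in> X \<and> y \<in> Y} \<subseteq> P" if "X \<subseteq> P" "Y \<subseteq> P"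
    using that left_idealD(4)[OF assms] by auto
  ultimately show ?thesis
    unfolding internal_sum2_def submodule_lmod[OF assms] by auto blast+
qed

text \<open>f and g are the components of e. For x in X, x = xe = xf + xg, so xg = x - xf lies in X
  and in Y and vanishes; likewise for Y. Thus f and g are right units of their summands and
  orthogonal to each other.\<close>

lemma summand_idempotents:
  assumes P: "right_unit P e" and XY: "internal_sum2 R (lmod P) X Y"
  shows "\<exists>f g. right_unit X f \<and> right_unit Y g \<and> e = f \<oplus> g \<and> e \<otimes> f = f \<and> e \<otimes> g = g \<and> f \<otimes> g = \<zero> \<and> g \<otimes> f = \<zero>"
proof -
  note P' = right_unitD[OF P]
  from XY have X: "left_ideal X" "X \<subseteq> P" and Y: "left_ideal Y" "Y \<subseteq> P" and I: "X \<inter> Y = {\<zero>}"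
    and dec: "\<forall>z\<in>P. \<exists>x\<in>X. \<exists>y\<in>Y. z = x \<oplus> y"
    using internal_sum2_lmod[OF P'(1)] by auto
  obtain f g where fg: "f \<in> X" "g \<in> Y" "e = f \<oplus> g" using dec P'(2) by blast
  have c: "f \<in> carrier R" "g \<in> carrier R" using fg X Y left_idealD by blast+
  have x: "x \<otimes> g = \<zero> \<and> x \<otimes> f = x" if xX: "x \<in> X" for x
  proof -
    have xc: "x \<in> carrier R" using xX X left_idealD by blast
    have s: "x = x \<otimes> f \<oplus> x \<otimes> g" using P'(4)[of x] xX X xc c fg by (auto simp: r_distr)
    have "x \<otimes> g = x \<ominus> x \<otimes> f"
      using add_minus_cancel[of "x \<otimes> f" "x \<otimes> g"] s xc c by (simp add: a_comm)
    then have "x \<otimes> g \<in> X \<inter> Y"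
      using left_ideal_minus[OF X(1) xX] left_idealD(5)[OF X(1) xc fg(1)] left_idealD(5)[OF Y(1) xc fg(2)] by simp
    then have "x \<otimes> g = \<zero>" using I by simp
    then show ?thesis using s xc c by simp
  qed
  have y: "y \<otimes> f = \<zero> \<and> y \<otimes> g = y" if yY: "y \<in> Y" for y
  proof -
    have yc: "y \<in> carrier R" using yY Y left_idealD by blast
    have s: "y = y \<otimes> f \<oplus> y \<otimes> g" using P'(4)[of y] yY Y yc c fg by (auto simp: r_distr)
    have "y \<otimes> f = y \<ominus> y \<otimes> g"
      using add_minus_cancel[of "y \<otimes> g" "y \<otimes> f"] s yc c by (simp add: a_comm)
    then have "y \<otimes> f \<in> X \<inter> Y"
      using left_ideal_minus[OF Y(1) yY] left_idealD(5)[OF X(1) yc fg(1)] left_idealD(5)[OF Y(1) yc fg(2)] by simp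
    then have "y \<otimes> f = \<zero>" using I by simp
    then show ?thesis using s yc c by simp
  qed
  have "e \<otimes> f = f" "e \<otimes> g = g" using fg c x[OF fg(1)] y[OF fg(2)] by (simp_all add: l_distr)
  moreover have "right_unit X f" "right_unit Y g" using X Y fg x y by (auto simp: right_unit_def)
  ultimately show ?thesis using fg x y by blast
qed

text \<open>The Peirce decomposition x = xf + x(e - f). The sum is direct because (e - f)f = 0,
  which is where ef = f enters.\<close>

lemma internal_sum2_idempotent:
  assumes P: "right_unit P e" and X: "right_unit X f" "X \<subseteq> P" and ef: "e \<otimes> f = f"
  shows "internal_sum2 R (lmod P) X (PIdl (e \<ominus> f))"
proof -
  note P' = right_unitD[OF P] and X' = right_unitD[OF X(1)]
  have fP: "f \<in> P" using X X' by auto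
  have fe: "f \<otimes> e = f" using P'(4) fP by simp
  have efP: "e \<ominus> f \<in> P" using left_ideal_minus[OF P'(1)] P'(2) fP by simp
  have z: "(e \<ominus> f) \<otimes> f = \<zero>" using P'(3) X'(3,5) ef by (simp add: minus_eq l_distr l_minus r_neg)
  show ?thesis unfolding internal_sum2_lmod[OF P'(1)]
  proof (intro conjI ballI)
    show "left_ideal X" "X \<subseteq> P" using X X' by auto
    show "left_ideal (PIdl (e \<ominus> f))" using left_ideal_PIdl P'(3) X'(3) by simp
    show "PIdl (e \<ominus> f) \<subseteq> P" by (rule PIdl_subset[OF P'(1) efP])
  next
    fix x assume x: "x \<in> P"
    then have xc: "x \<in> carrier R" using P'(1) left_idealD by blast
    have "x = x \<otimes> f \<oplus> x \<otimes> (e \<ominus> f)"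
      using P'(3,4) X'(3) x xc by (simp add: minus_eq r_distr r_minus a_ac r_neg r_neg1 r_neg2)
    then show "\<exists>a\<in>X. \<exists>b\<in>PIdl (e \<ominus> f). x = a \<oplus> b"
      using left_idealD(5)[OF X'(1) xc X'(2)] PIdl_memI[OF xc, of "e \<ominus> f"] by blast
  next
    have "x = \<zero>" if "x \<in> X" "x \<in> PIdl (e \<ominus> f)" for x
    proof -
      obtain r where r: "r \<in> carrier R" "x = r \<otimes> (e \<ominus> f)" using \<open>x \<in> PIdl _\<close> by (auto simp: cgenideal_def)
      have "x = x \<otimes> f" using X'(4) that by simp
      also have "\<dots> = r \<otimes> ((e \<ominus> f) \<otimes> f)" using r P'(3) X'(3) by (simp add: m_assoc)
      finally show ?thesis using z r by simp
    qed
    moreover have "left_ideal (PIdl (e \<ominus> f))" using left_ideal_PIdl P'(3) X'(3) by simp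
    ultimately show "X \<inter> PIdl (e \<ominus> f) = {\<zero>}" using left_idealD(3) X'(1) by auto
  qed
qed

text \<open>Direct summands of Re are the left ideals generated by idempotents of eRe: fe = f comes
  from f lying in P, and ef = f is the remaining half of the condition. This lets summands be
  handled through elements.\<close>

lemma direct_summand_iff:
  assumes P: "right_unit P e"
  shows "direct_summand R (lmod P) X \<longleftrightarrow> (\<exists>f. right_unit X f \<and> X \<subseteq> P \<and> e \<otimes> f = f)"
proof
  assume "direct_summand R (lmod P) X"
  then obtain Y where Y: "internal_sum2 R (lmod P) X Y" by (auto simp: direct_summand_def)
  then have "X \<subseteq> P" unfolding internal_sum2_lmod[OF right_unitD(1)[OF P]] by blast
  then show "\<exists>f. right_unit X f \<and> X \<subseteq> P \<and> e \<otimes> f = f" using summand_idempotents[OF P Y] by blast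
next
  assume "\<exists>f. right_unit X f \<and> X \<subseteq> P \<and> e \<otimes> f = f"
  then show "direct_summand R (lmod P) X"
    using internal_sum2_idempotent[OF P] unfolding direct_summand_def by blast
qed

section \<open>Free modules and projectivity\<close>

lemma func_space_simps [simp]:
  "carrier (func_space I) = I \<rightarrow>\<^sub>E carrier R" "\<zero>\<^bsub>func_space I\<^esub> = (\<lambda>i\<in>I. \<zero>)"
  "u \<oplus>\<^bsub>func_space I\<^esub> v = (\<lambda>i\<in>I. u i \<oplus> v i)" "a \<odot>\<^bsub>func_space I\<^esub> u = (\<lambda>i\<in>I. a \<otimes> u i)"
  by (simp_all add: func_space_def)

lemma left_module_func_space: "left_module R (func_space I)"
proof -
  have "abelian_group (func_space I)"
  proof (rule abelian_groupI)
    fix u assume "u \<in> carrier (func_space I)"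
    then have u: "u \<in> I \<rightarrow>\<^sub>E carrier R" by simp
    then have "(\<lambda>i\<in>I. \<ominus> u i) \<in> carrier (func_space I)" by (auto simp: PiE_def Pi_def)
    moreover have "\<ominus> u i \<oplus> u i = \<zero>" if "i \<in> I" for i using PiE_mem[OF u that] by (rule l_neg)
    then have "(\<lambda>i\<in>I. \<ominus> u i) \<oplus>\<^bsub>func_space I\<^esub> u = \<zero>\<^bsub>func_space I\<^esub>"
      by (auto intro!: restrict_ext)
    ultimately show "\<exists>y\<in>carrier (func_space I). y \<oplus>\<^bsub>func_space I\<^esub> u = \<zero>\<^bsub>func_space I\<^esub>" by blast
  next
    fix u v w assume "u \<in> carrier (func_space I)" "v \<in> carrier (func_space I)" "w \<in> carrier (func_space I)"
    then show "u \<oplus>\<^bsub>func_space I\<^esub> v \<oplus>\<^bsub>func_space I\<^esub> w = u \<oplus>\<^bsub>func_space I\<^esub> (v \<oplus>\<^bsub>func_space I\<^esub> w)"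
      by (auto simp: PiE_iff a_assoc intro!: restrict_ext)
  next
    fix u v assume "u \<in> carrier (func_space I)" "v \<in> carrier (func_space I)"
    then show "u \<oplus>\<^bsub>func_space I\<^esub> v = v \<oplus>\<^bsub>func_space I\<^esub> u" "u \<oplus>\<^bsub>func_space I\<^esub> v \<in> carrier (func_space I)"
      by (auto simp: PiE_iff intro!: restrict_ext a_comm)
  next
    fix u assume "u \<in> carrier (func_space I)"
    then show "\<zero>\<^bsub>func_space I\<^esub> \<oplus>\<^bsub>func_space I\<^esub> u = u"
      by (auto simp: PiE_iff extensional_def fun_eq_iff)
  qed simp
  moreover have "left_module_axioms R (func_space I)"
  proof
    fix u assume "u \<in> carrier (func_space I)"
    then show "\<one> \<odot>\<^bsub>func_space I\<^esub> u = u"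
      by (auto simp: PiE_iff extensional_def fun_eq_iff)
  qed (auto simp: PiE_iff l_distr r_distr m_assoc intro!: restrict_ext)
  ultimately show ?thesis using ring_axioms by (simp add: left_module_def)
qed

text \<open>Rf is complemented in R by R(1 - f). The map \<open>?i\<close> identifies R with the
  free module of rank one, whose elements are functions on a one-point set, and transports the
  decomposition there.\<close>

lemma projective_right_unit:
  assumes "right_unit X f"
  shows "projective_module R (lmod X)"
proof -
  note X' = right_unitD[OF assms]
  let ?F = "func_space {..<1::nat}"
  let ?i = "\<lambda>x::'a. \<lambda>i\<in>{..<1::nat}. x"
  interpret F: left_module R ?F by (rule left_module_func_space)
  have "right_unit (PIdl \<one>) \<one>" by (rule right_unit_PIdl) auto
  moreover have "PIdl \<one> = carrier R" by (force simp: cgenideal_def)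
  ultimately have one: "right_unit (carrier R) \<one>" by simp
  have "internal_sum2 R (lmod (carrier R)) X (PIdl (\<one> \<ominus> f))"
    using X' by (intro internal_sum2_idempotent[OF one assms]) (auto dest: left_idealD)
  then obtain Y where Y: "left_ideal Y" "\<forall>z\<in>carrier R. \<exists>x\<in>X. \<exists>y\<in>Y. z = x \<oplus> y" "X \<inter> Y = {\<zero>}"
    unfolding internal_sum2_lmod[OF right_unitD(1)[OF one]] by blast
  have inj: "x = y" if "?i x = ?i y" for x y :: 'a using fun_cong[OF that, of 0] by simp
  have sub: "Module.submodule (?i ` Z) R ?F" if Z: "left_ideal Z" for Z
    unfolding F.submodule_iff
  proof (intro conjI ballI)
    show "?i ` Z \<subseteq> carrier ?F" using left_idealD(2)[OF Z] by (auto simp: PiE_def)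
    show "\<zero>\<^bsub>?F\<^esub> \<in> ?i ` Z" using left_idealD(3)[OF Z] by (auto intro!: restrict_ext)
  next
    fix u v assume "u \<in> ?i ` Z" "v \<in> ?i ` Z"
    then obtain x y where "x \<in> Z" "y \<in> Z" "u = ?i x" "v = ?i y" by blast
    then show "u \<oplus>\<^bsub>?F\<^esub> v \<in> ?i ` Z" using left_idealD(4)[OF Z]
      by (intro image_eqI[of _ _ "x \<oplus> y"]) (auto intro!: restrict_ext)
  next
    fix a u assume a: "a \<in> carrier R" and "u \<in> ?i ` Z"
    then obtain x where "x \<in> Z" "u = ?i x" by blast
    then show "a \<odot>\<^bsub>?F\<^esub> u \<in> ?i ` Z" using left_idealD(5)[OF Z a]
      by (intro image_eqI[of _ _ "a \<otimes> x"]) (auto intro!: restrict_ext)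
  qed
  have surj: "u = ?i (u 0)" "u 0 \<in> carrier R" if "u \<in> carrier ?F" for u
    using that by (auto simp: fun_eq_iff PiE_def extensional_def)
  have add: "?i x \<oplus>\<^bsub>?F\<^esub> ?i y = ?i (x \<oplus> y)" for x y by (auto intro!: restrict_ext)
  have "internal_sum2 R ?F (?i ` X) (?i ` Y)"
    unfolding internal_sum2_def
  proof (intro conjI)
    show "?i ` X <+>\<^bsub>?F\<^esub> ?i ` Y = carrier ?F"
    proof
      show "?i ` X <+>\<^bsub>?F\<^esub> ?i ` Y \<subseteq> carrier ?F"
      proof
        fix u assume "u \<in> ?i ` X <+>\<^bsub>?F\<^esub> ?i ` Y"
        then obtain x y where "x \<in> X" "y \<in> Y" "u = ?i (x \<oplus> y)" unfolding set_add_def' add[symmetric] by blast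
        then show "u \<in> carrier ?F" using left_idealD(2)[OF X'(1)] left_idealD(2)[OF Y(1)]
          by (auto simp: PiE_def)
      qed
    next
      show "carrier ?F \<subseteq> ?i ` X <+>\<^bsub>?F\<^esub> ?i ` Y"
      proof
        fix u assume u: "u \<in> carrier ?F"
        obtain x y where xy: "x \<in> X" "y \<in> Y" "u 0 = x \<oplus> y" using Y(2) surj(2)[OF u] by blast
        have "u = ?i x \<oplus>\<^bsub>?F\<^esub> ?i y" unfolding add using surj(1)[OF u] xy(3) by simp
        then show "u \<in> ?i ` X <+>\<^bsub>?F\<^esub> ?i ` Y" using xy unfolding set_add_def' by blast
      qed
    qed
    have "inj ?i" by (rule injI) (rule inj)
    then have "?i ` X \<inter> ?i ` Y = ?i ` (X \<inter> Y)" by (rule image_Int[symmetric])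
    then show "?i ` X \<inter> ?i ` Y = {\<zero>\<^bsub>?F\<^esub>}" unfolding Y(3) by simp
  qed (use sub X' Y in auto)
  then have "direct_summand R ?F (?i ` X)" by (auto simp: direct_summand_def)
  moreover have "module_iso R (lmod X) (?F\<lparr>carrier := ?i ` X\<rparr>)"
    unfolding module_iso_def
  proof (intro bexI)
    show "bij_betw ?i (carrier (lmod X)) (carrier (?F\<lparr>carrier := ?i ` X\<rparr>))"
      using inj by (auto simp: bij_betw_def inj_on_def)
    show "?i \<in> LinearCombinations.module_hom R (lmod X) (?F\<lparr>carrier := ?i ` X\<rparr>)"
      unfolding LinearCombinations.module_hom_def by (auto intro!: restrict_ext simp: func_space_def)
  qed
  ultimately show ?thesis unfolding projective_module_def by blast
qed

end

section \<open>Fitting's lemma\<close>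

text \<open>\<open>d\<close> abstracts the dimension of a left ideal over a ground field: strict
  monotonicity together with the bound yields both chain conditions.\<close>

locale finite_length_ring = ring R for R (structure) +
  fixes d :: "'a set \<Rightarrow> nat" and bound :: nat
  assumes d_strict_mono: "\<lbrakk>left_ideal X; left_ideal Y; X \<subset> Y\<rbrakk> \<Longrightarrow> d X < d Y"
    and d_bound: "left_ideal X \<Longrightarrow> d X \<le> bound"
begin

lemma descending_chain:
  assumes "\<And>n::nat. left_ideal (A n)" "\<And>m n. m \<le> n \<Longrightarrow> A n \<subseteq> A m"
  shows "\<exists>n. \<forall>m\<ge>n. A m = A n"
proof -
  obtain n where n: "\<And>m. d (A n) \<le> d (A m)" using ex_has_least_nat[of "\<lambda>_. True" 0 "\<lambda>n. d (A n)"] by auto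
  have "A m = A n" if "n \<le> m" for m
    using assms(2)[OF that] d_strict_mono[OF assms(1) assms(1), of m n] n[of m] by auto
  then show ?thesis by blast
qed

lemma ascending_chain:
  assumes "\<And>n::nat. left_ideal (A n)" "\<And>m n. m \<le> n \<Longrightarrow> A m \<subseteq> A n"
  shows "\<exists>n. \<forall>m\<ge>n. A m = A n"
proof -
  have "\<forall>n. d (A n) < Suc bound" using d_bound assms(1) by (simp add: less_Suc_eq_le)
  then obtain n where n: "\<And>m. d (A m) \<le> d (A n)"
    using ex_has_greatest_nat[of "\<lambda>_. True" 0 "\<lambda>n. d (A n)" "Suc bound"] by auto
  have "A m = A n" if "n \<le> m" for m
    using assms(2)[OF that] d_strict_mono[OF assms(1) assms(1), of n m] n[of m] by auto
  then show ?thesis by blast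
qed

text \<open>Right multiplication by x is an endomorphism of P; A and K collect the images and
  kernels of its powers. Once both chains are stationary, P is the direct sum of K and A, so one of
  them is zero. The vector w rules out nilpotence: f x^n w = w is non-zero, hence A is not zero and
  K is.\<close>

lemma fitting:
  assumes P: "right_unit P f" and ind: "indecomposable R (lmod P)" and x: "x \<in> P"
    and w: "w \<in> carrier R" "w \<noteq> \<zero>" "x \<otimes> w = w" "f \<otimes> w = w"
  shows "bij_betw (\<lambda>y. y \<otimes> x) P P"
proof -
  note P' = right_unitD[OF P]
  have Pc: "y \<in> carrier R" if "y \<in> P" for y using that P'(1) left_idealD by blast
  have xc: "x \<in> carrier R" using x Pc by simp
  have Pp: "y \<otimes> x [^] n \<in> P" if "y \<in> P" for y and n :: nat
  proof (cases n)
    case 0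
    then show ?thesis using that Pc by simp
  next
    case (Suc k)
    then have "y \<otimes> x [^] n = (y \<otimes> x [^] k) \<otimes> x" using Pc[OF that] xc by (simp add: m_assoc)
    then show ?thesis using left_idealD(5)[OF P'(1) _ x] Pc[OF that] xc by simp
  qed
  have pow_w: "x [^] n \<otimes> w = w" for n :: nat using xc w by (induction n) (auto simp: m_assoc)
  define A where "A n = (\<lambda>y. y \<otimes> x [^] n) ` P" for n :: nat
  define K where "K n = {y \<in> P. y \<otimes> x [^] n = \<zero>}" for n :: nat
  have A: "left_ideal (A n)" for n
    unfolding left_ideal_def A_def
  proof (intro conjI ballI)
    show "\<zero> \<in> (\<lambda>y. y \<otimes> x [^] n) ` P" using left_idealD(3)[OF P'(1)] xc by (auto intro!: image_eqI[of _ _ \<zero>])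
  next
    fix a b assume "a \<in> (\<lambda>y. y \<otimes> x [^] n) ` P" "b \<in> (\<lambda>y. y \<otimes> x [^] n) ` P"
    then obtain y z where "y \<in> P" "z \<in> P" "a = y \<otimes> x [^] n" "b = z \<otimes> x [^] n" by auto
    then show "a \<oplus> b \<in> (\<lambda>y. y \<otimes> x [^] n) ` P"
      using Pc xc left_idealD(4)[OF P'(1)] by (auto intro!: image_eqI[of _ _ "y \<oplus> z"] simp: l_distr)
  next
    fix r a assume r: "r \<in> carrier R" and "a \<in> (\<lambda>y. y \<otimes> x [^] n) ` P"
    then obtain y where "y \<in> P" "a = y \<otimes> x [^] n" by auto
    then show "r \<otimes> a \<in> (\<lambda>y. y \<otimes> x [^] n) ` P"
      using Pc xc r left_idealD(5)[OF P'(1)] by (auto intro!: image_eqI[of _ _ "r \<otimes> y"] simp: m_assoc)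
  qed (use Pc xc in auto)
  have K: "left_ideal (K n)" for n
    unfolding left_ideal_def K_def using left_idealD[OF P'(1)] Pc xc by (auto simp: l_distr m_assoc)
  have A_mono: "A n \<subseteq> A m" if mn: "m \<le> n" for m n
  proof
    fix a assume "a \<in> A n"
    then obtain y where y: "y \<in> P" "a = y \<otimes> x [^] n" by (auto simp: A_def)
    have "x [^] n = x [^] (n - m) \<otimes> x [^] m" using xc mn by (simp add: nat_pow_mult)
    then have "a = (y \<otimes> x [^] (n - m)) \<otimes> x [^] m" using y Pc xc by (simp add: m_assoc)
    then show "a \<in> A m" using Pp[OF y(1)] by (auto simp: A_def)
  qed
  have K_mono: "K m \<subseteq> K n" if mn: "m \<le> n" for m n
  proof
    fix y assume y: "y \<in> K m"
    have "x [^] n = x [^] m \<otimes> x [^] (n - m)" using xc mn by (simp add: nat_pow_mult)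
    moreover have "y \<in> carrier R" using y Pc by (simp add: K_def)
    ultimately have "y \<otimes> x [^] n = (y \<otimes> x [^] m) \<otimes> x [^] (n - m)" using xc by (simp add: m_assoc)
    then show "y \<in> K n" using y xc by (simp add: K_def)
  qed
  obtain n1 where n1: "\<forall>m\<ge>n1. A m = A n1" using descending_chain[of A] A A_mono by blast
  obtain n2 where n2: "\<forall>m\<ge>n2. K m = K n2" using ascending_chain[of K] K K_mono by blast
  \<comment> \<open>The successor ensures n > 0, so that one factor x can be split off x^n on either
    side to pass from x^n back to x.\<close>
  define n where "n = Suc (max n1 n2)"
  have n: "A (n + n) = A n" "K (n + n) = K n"
  proof -
    have "n1 \<le> n" "n2 \<le> n" "n1 \<le> n + n" "n2 \<le> n + n" by (auto simp: n_def)
    then show "A (n + n) = A n" "K (n + n) = K n" using n1 n2 by metis+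
  qed
  define c where "c = x [^] n"
  have cc: "c \<in> carrier R" using xc by (simp add: c_def)
  have c2: "x [^] (n + n) = c \<otimes> c" using xc by (simp add: c_def nat_pow_mult)
  have "internal_sum2 R (lmod P) (K n) (A n)"
    unfolding internal_sum2_lmod[OF P'(1)]
  proof (intro conjI ballI)
    show "K n \<subseteq> P" "A n \<subseteq> P" using Pp by (auto simp: K_def A_def)
  next
    fix y assume y: "y \<in> P"
    \<comment> \<open>Stationarity of the images: yc = z c^2 for some z in P, so y - zc is killed by
      c.\<close>
    have "y \<otimes> c \<in> A (n + n)" using n y by (simp add: A_def c_def)
    then obtain z where z: "z \<in> P" "y \<otimes> c = z \<otimes> (c \<otimes> c)" by (auto simp: A_def c2)
    have zc: "z \<otimes> c \<in> P" "z \<otimes> c \<in> A n" using Pp z by (auto simp: c_def A_def)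
    have "(y \<ominus> z \<otimes> c) \<otimes> c = \<zero>" using z y Pc cc by (simp add: minus_eq l_distr l_minus m_assoc r_neg)
    then have "y \<ominus> z \<otimes> c \<in> K n" using left_ideal_minus[OF P'(1) y zc(1)] by (simp add: K_def c_def)
    moreover have "y = (y \<ominus> z \<otimes> c) \<oplus> z \<otimes> c" using y z Pc cc by (simp add: minus_eq a_assoc l_neg)
    ultimately show "\<exists>a\<in>K n. \<exists>b\<in>A n. y = a \<oplus> b" using zc by blast
  next
    have "y = \<zero>" if y: "y \<in> K n" "y \<in> A n" for y
    proof -
      obtain z where z: "z \<in> P" "y = z \<otimes> c" using y by (auto simp: A_def c_def)
      then have "z \<in> K (n + n)" using y Pc cc by (simp add: K_def c2 m_assoc c_def[symmetric])
      then have "z \<in> K n" using n by simp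
      then show ?thesis using z by (simp add: K_def c_def)
    qed
    then show "K n \<inter> A n = {\<zero>}" using left_idealD(3)[OF K] left_idealD(3)[OF A] by auto
  qed (use K A in auto)
  then have sum: "K n = {\<zero>} \<or> A n = {\<zero>}" and dec: "\<forall>z\<in>P. \<exists>a\<in>K n. \<exists>b\<in>A n. z = a \<oplus> b" and AP: "A n \<subseteq> P"
    using ind internal_sum2_lmod[OF P'(1)] by (auto simp: indecomposable_def)
  have "f \<otimes> c \<noteq> \<zero>"
  proof
    assume "f \<otimes> c = \<zero>"
    then have "f \<otimes> (c \<otimes> w) = \<zero>" using P'(3) cc w by (simp add: m_assoc[symmetric])
    then show False using pow_w w by (simp add: c_def)
  qed
  moreover have "f \<otimes> c \<in> A n" using P'(2) by (simp add: A_def c_def)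
  ultimately have K0: "K n = {\<zero>}" using sum by auto
  have AP': "P \<subseteq> A n"
  proof
    fix z assume "z \<in> P"
    then obtain b where "b \<in> A n" "z = \<zero> \<oplus> b" using dec K0 by auto
    then show "z \<in> A n" using left_idealD(2)[OF A] by simp
  qed
  have n_Suc: "n = Suc (n - 1)" by (simp add: n_def)
  have inj: "y = \<zero>" if y: "y \<in> P" "y \<otimes> x = \<zero>" for y
  proof -
    have "x [^] n = x \<otimes> x [^] (n - 1)" using xc by (subst n_Suc) (simp only: nat_pow_Suc2)
    then have "y \<otimes> c = (y \<otimes> x) \<otimes> x [^] (n - 1)" using Pc[OF y(1)] xc by (simp add: c_def m_assoc)
    also have "\<dots> = \<zero>" using y xc by simp
    finally have "y \<in> K n" using y by (simp add: K_def c_def)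
    then show ?thesis using K0 by simp
  qed
  have "inj_on (\<lambda>y. y \<otimes> x) P"
  proof (rule inj_onI)
    fix y z assume yz: "y \<in> P" "z \<in> P" "y \<otimes> x = z \<otimes> x"
    have "(y \<ominus> z) \<otimes> x = \<zero>" using yz Pc xc by (simp add: minus_eq l_distr l_minus r_neg)
    then have "y \<ominus> z = \<zero>" using inj left_ideal_minus[OF P'(1)] yz by blast
    then show "y = z" using yz Pc by simp
  qed
  moreover have "(\<lambda>y. y \<otimes> x) ` P = P"
  proof
    show "(\<lambda>y. y \<otimes> x) ` P \<subseteq> P" using left_idealD(5)[OF P'(1) _ x] Pc by auto
    show "P \<subseteq> (\<lambda>y. y \<otimes> x) ` P"
    proof
      fix y assume "y \<in> P"
      then obtain z where z: "z \<in> P" "y = z \<otimes> x [^] n" using AP' by (auto simp: A_def)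
      have "x [^] n = x [^] (n - 1) \<otimes> x" by (subst n_Suc) simp
      then have "y = (z \<otimes> x [^] (n - 1)) \<otimes> x" using z Pc xc by (simp add: m_assoc)
      then show "y \<in> (\<lambda>y. y \<otimes> x) ` P" using Pp[OF z(1)] by blast
    qed
  qed
  ultimately show ?thesis by (simp add: bij_betw_def)
qed

end

section \<open>Modules with one-dimensional homomorphism space\<close>

text \<open>In the application, \<open>\<Gamma>\<close> is the Gelfand--Graev module, \<open>T\<close> the Steinberg module, \<open>PIdl v\<close> the module
  \<open>S\<^sub>\<sigma>\<close> and \<open>J\<close> its submodule with quotient \<open>D\<^sub>\<sigma>\<close>.\<close>

locale multiplicity_one = finite_length_ring R d bound for R (structure) and d bound +
  fixes \<Gamma> :: "'a set" and e v :: 'a and J T :: "'a set"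
  assumes right_unit_\<Gamma>: "right_unit \<Gamma> e"
    and v_closed: "v \<in> carrier R" and v_nonzero: "v \<noteq> \<zero>" and e_v: "e \<otimes> v = v"
    and idempotent_v: "\<lbrakk>f \<in> \<Gamma>; e \<otimes> f = f; f \<otimes> f = f\<rbrakk> \<Longrightarrow> f \<otimes> v = v \<or> f \<otimes> v = \<zero>"
    and left_ideal_J: "left_ideal J" and J_subset: "J \<subseteq> PIdl v" and v_notin_J: "v \<notin> J"
    and J_maximal: "\<lbrakk>y \<in> PIdl v; y \<notin> J\<rbrakk> \<Longrightarrow> \<exists>r\<in>carrier R. r \<otimes> y = v"
    and left_ideal_T: "left_ideal T" and v_in_T: "v \<in> T"
    and T_invariant: "\<lbrakk>t \<in> T; e \<otimes> t = t\<rbrakk> \<Longrightarrow> \<exists>z\<in>carrier R. t = v \<otimes> z"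
begin

text \<open>By \<open>direct_summand_iff\<close> these X are the direct summands of \<Gamma>, each
  given with its idempotent f in eRe.\<close>

abbreviation component :: "'a set \<Rightarrow> 'a \<Rightarrow> bool" where
  "component X f \<equiv> right_unit X f \<and> X \<subseteq> \<Gamma> \<and> e \<otimes> f = f"

abbreviation hom_nonzero :: "'a set \<Rightarrow> bool" where
  "hom_nonzero X \<equiv> \<exists>h\<in>LinearCombinations.module_hom R (lmod X) (lmod T). \<exists>x\<in>X. h x \<noteq> \<zero>"

lemma component_\<Gamma>: "component \<Gamma> e"
  using right_unit_\<Gamma> right_unitD[OF right_unit_\<Gamma>] by auto

lemma component_v: "component X f \<Longrightarrow> f \<otimes> v = v \<or> f \<otimes> v = \<zero>"
  using idempotent_v[of f] right_unitD[of X f] by auto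

text \<open>A homomorphism h is determined by h(f), which is fixed by e and f and hence has the form
  vz by \<open>T_invariant\<close>. If fv = 0, then h(f) = f h(f) = (fv)z = 0. Conversely x
  \<mapsto> xv is non-zero at f.\<close>

lemma component_hom_iff:
  assumes X: "component X f"
  shows "hom_nonzero X \<longleftrightarrow> f \<otimes> v = v"
proof
  note X' = right_unitD[OF conjunct1[OF X]]
  assume "hom_nonzero X"
  then obtain h x where h: "h \<in> LinearCombinations.module_hom R (lmod X) (lmod T)" and x: "x \<in> X" "h x \<noteq> \<zero>"
    by blast
  have hT: "h y \<in> T" if "y \<in> X" for y using h that by (auto simp: LinearCombinations.module_hom_def)
  have hs: "h (a \<otimes> y) = a \<otimes> h y" if "a \<in> carrier R" "y \<in> X" for a y
    using h that by (auto simp: LinearCombinations.module_hom_def)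
  have ec: "e \<in> carrier R" using right_unitD(3)[OF right_unit_\<Gamma>] .
  have "h f = f \<otimes> h f" "h f = e \<otimes> h f" using hs[of f f] hs[of e f] X X' ec by simp_all
  then obtain z where z: "z \<in> carrier R" "h f = v \<otimes> z" using T_invariant[OF hT[OF X'(2)]] by metis
  have "h x = x \<otimes> h f" using hs[of x f] X'(2,4) x(1) left_idealD(2)[OF X'(1)] by simp
  then have "h f \<noteq> \<zero>" using x left_idealD(2)[OF X'(1)] by auto
  show "f \<otimes> v = v"
  proof (rule ccontr)
    assume "f \<otimes> v \<noteq> v"
    then have "f \<otimes> v = \<zero>" using component_v[OF X] by simp
    have "h f = f \<otimes> h f" by fact
    also have "\<dots> = (f \<otimes> v) \<otimes> z" using z v_closed X'(3) by (simp add: m_assoc)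
    finally show False using \<open>f \<otimes> v = \<zero>\<close> z \<open>h f \<noteq> \<zero>\<close> by simp
  qed
next
  note X' = right_unitD[OF conjunct1[OF X]]
  have Xc: "\<And>x. x \<in> X \<Longrightarrow> x \<in> carrier R" using X'(1) left_idealD by blast
  assume "f \<otimes> v = v"
  moreover have "(\<lambda>x. x \<otimes> v) \<in> LinearCombinations.module_hom R (lmod X) (lmod T)"
    using Xc v_closed left_idealD(5)[OF left_ideal_T _ v_in_T]
    by (auto simp: LinearCombinations.module_hom_def l_distr m_assoc)
  ultimately show "hom_nonzero X"
    using X'(2) v_nonzero by (intro bexI[of _ "\<lambda>x. x \<otimes> v"] bexI[of _ f]) auto
qed

text \<open>Choose a component fixing v with \<open>d\<close> minimal. If it splits with f = a + b,
  then v = av + bv with av and bv in {v, 0}, so one of the two parts still fixes v and by minimality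
  is everything.\<close>

lemma ex_indecomposable_component:
  "\<exists>P f. component P f \<and> f \<otimes> v = v \<and> indecomposable R (lmod P)"
proof -
  let ?C = "\<lambda>X. \<exists>f. component X f \<and> f \<otimes> v = v"
  have "?C \<Gamma>" using component_\<Gamma> e_v by blast
  then obtain P where P: "?C P" and min: "\<And>X. ?C X \<Longrightarrow> d P \<le> d X"
    using ex_has_least_nat[of ?C \<Gamma> d] by auto
  then obtain f where f: "component P f" "f \<otimes> v = v" by blast
  note P' = right_unitD[OF conjunct1[OF f(1)]]
  have sub: "X = P" if X: "X \<subseteq> P" "?C X" for X
    using min[OF X(2)] X d_strict_mono[OF _ P'(1), of X] right_unitD(1) by fastforce
  have "indecomposable R (lmod P)"
    unfolding indecomposable_def
  proof (intro conjI allI impI)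
    have "f \<noteq> \<zero>" using f v_closed v_nonzero by auto
    then show "carrier (lmod P) \<noteq> {\<zero>\<^bsub>lmod P\<^esub>}" using P' by auto
  next
    fix X Y assume XY: "internal_sum2 R (lmod P) X Y"
    then have P_XY: "X \<subseteq> P" "Y \<subseteq> P" "X \<inter> Y = {\<zero>}" unfolding internal_sum2_lmod[OF P'(1)] by auto
    obtain a b where ab: "right_unit X a" "right_unit Y b" "f = a \<oplus> b" "f \<otimes> a = a" "f \<otimes> b = b"
      using summand_idempotents[OF conjunct1[OF f(1)] XY] by blast
    have ec: "e \<in> carrier R" using right_unitD(3)[OF right_unit_\<Gamma>] .
    have abc: "a \<in> carrier R" "b \<in> carrier R" using ab right_unitD(3) by auto
    have "e \<otimes> a = a" "e \<otimes> b = b"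
      using f(1) ab abc ec P'(3) by (metis m_assoc)+
    then have cab: "component X a" "component Y b" using ab P_XY f(1) by auto
    have "v = a \<otimes> v \<oplus> b \<otimes> v" using f(2) ab(3) abc v_closed by (simp add: l_distr[symmetric])
    then consider "a \<otimes> v = v" | "b \<otimes> v = v"
      using component_v[OF cab(1)] component_v[OF cab(2)] v_nonzero by fastforce
    then have "X = P \<or> Y = P" using sub P_XY cab by cases blast+
    then show "X = {\<zero>\<^bsub>lmod P\<^esub>} \<or> Y = {\<zero>\<^bsub>lmod P\<^esub>}" using P_XY by auto
  qed
  with f show ?thesis by blast
qed

lemma fitting_component:
  assumes P: "component P f" "f \<otimes> v = v" "indecomposable R (lmod P)" and x: "x \<in> P" "x \<otimes> v = v"
  shows "bij_betw (\<lambda>y. y \<otimes> x) P P"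
  using fitting[of P f x v] assms v_closed v_nonzero by auto

text \<open>The maps y \<mapsto> yf' and y \<mapsto> yf go back and forth. Their composites are
  right multiplications by f'f in P and ff' in P', which fix v and are therefore bijective by
  Fitting's lemma.\<close>

lemma component_iso:
  assumes P: "component P f" "f \<otimes> v = v" "indecomposable R (lmod P)"
    and P': "component P' f'" "f' \<otimes> v = v" "indecomposable R (lmod P')"
  shows "module_iso R (lmod P) (lmod P')"
proof -
  note D = right_unitD[OF conjunct1[OF P(1)]] and D' = right_unitD[OF conjunct1[OF P'(1)]]
  have c: "\<And>y. y \<in> P \<Longrightarrow> y \<in> carrier R" "\<And>y. y \<in> P' \<Longrightarrow> y \<in> carrier R"
    using D(1) D'(1) left_idealD by blast+
  have b: "bij_betw (\<lambda>y. y \<otimes> (f' \<otimes> f)) P P"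
    by (rule fitting_component[OF P]) (use D D' left_idealD(5)[OF D(1)] P P' v_closed in \<open>auto simp: m_assoc\<close>)
  have b': "bij_betw (\<lambda>y. y \<otimes> (f \<otimes> f')) P' P'"
    by (rule fitting_component[OF P']) (use D D' left_idealD(5)[OF D'(1)] P P' v_closed in \<open>auto simp: m_assoc\<close>)
  have img: "y \<otimes> f' \<in> P'" if "y \<in> P" for y using that c left_idealD(5)[OF D'(1) _ D'(2)] by simp
  have img': "y \<otimes> f \<in> P" if "y \<in> P'" for y using that c left_idealD(5)[OF D(1) _ D(2)] by simp
  have "inj_on (\<lambda>y. y \<otimes> f') P"
  proof (rule inj_onI)
    fix y z assume yz: "y \<in> P" "z \<in> P" "y \<otimes> f' = z \<otimes> f'"
    then have "y \<otimes> (f' \<otimes> f) = z \<otimes> (f' \<otimes> f)" using c D(3) D'(3) by (simp add: m_assoc[symmetric])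
    then show "y = z" using b yz by (auto simp: bij_betw_def inj_on_def)
  qed
  moreover have "(\<lambda>y. y \<otimes> f') ` P = P'"
  proof
    show "P' \<subseteq> (\<lambda>y. y \<otimes> f') ` P"
    proof
      fix z assume "z \<in> P'"
      then obtain y where y: "y \<in> P'" "z = y \<otimes> (f \<otimes> f')" using b' by (auto simp: bij_betw_def)
      then have "z = (y \<otimes> f) \<otimes> f'" using c D(3) D'(3) by (simp add: m_assoc)
      then show "z \<in> (\<lambda>y. y \<otimes> f') ` P" using img'[OF y(1)] by blast
    qed
  qed (use img in auto)
  ultimately have "bij_betw (\<lambda>y. y \<otimes> f') (carrier (lmod P)) (carrier (lmod P'))" by (simp add: bij_betw_def)
  moreover have "(\<lambda>y. y \<otimes> f') \<in> LinearCombinations.module_hom R (lmod P) (lmod P')"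
    using img c D'(3) by (auto simp: LinearCombinations.module_hom_def l_distr m_assoc)
  ultimately show ?thesis unfolding module_iso_def by blast
qed

text \<open>Bridges the sums of \<open>internal_direct_sum\<close>, formed in the record
  \<open>lmod P\<close>, to sums in R, where distributivity can be used.\<close>

lemma finsum_lmod:
  assumes "left_ideal P" "finite I" "f \<in> I \<rightarrow> P"
  shows "finsum (lmod P) f I = finsum R f I"
proof -
  interpret M: left_module R "lmod P" by (rule left_module_lmod[OF assms(1)])
  have P: "P \<subseteq> carrier R" using left_idealD(1)[OF assms(1)] .
  show ?thesis using assms(2,3)
  proof (induction I rule: finite_induct)
    case empty
    then show ?case by simp
  next
    case (insert i I)
    have "finsum (lmod P) f (insert i I) = f i \<oplus>\<^bsub>lmod P\<^esub> finsum (lmod P) f I"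
      by (rule M.finsum_insert) (use insert in auto)
    moreover have "finsum R f (insert i I) = f i \<oplus> finsum R f I"
      by (rule finsum_insert) (use insert P in auto)
    ultimately show ?case using insert by auto
  qed
qed

text \<open>The components f i of e are orthogonal idempotents generating the summands. From v = ev,
  some f i does not kill v and hence fixes it; if f i and f j both fix v, then so does f i f j,
  which is zero unless i = j.\<close>

lemma ex1_component:
  assumes X: "internal_direct_sum R (lmod \<Gamma>) {..<m::nat} X"
  shows "\<exists>!i. i < m \<and> hom_nonzero (X i)"
proof -
  note G = right_unitD[OF right_unit_\<Gamma>]
  have Gc: "\<And>y. y \<in> \<Gamma> \<Longrightarrow> y \<in> carrier R" using G(1) left_idealD by blast
  from X have Xi: "left_ideal (X i)" "X i \<subseteq> \<Gamma>" if "i < m" for i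
    using that by (auto simp: internal_direct_sum_def submodule_lmod[OF G(1)])
  have Xc: "y \<in> carrier R" if "i < m" "y \<in> X i" for i y using Xi[OF that(1)] that(2) Gc by auto
  have rep: "\<exists>!f. f \<in> Pi\<^sub>E {..<m} X \<and> x = (\<Oplus>i\<in>{..<m}. f i)" if x: "x \<in> \<Gamma>" for x
  proof -
    have fs: "f \<in> Pi\<^sub>E {..<m} X \<and> x = finsum (lmod \<Gamma>) f {..<m} \<longleftrightarrow> f \<in> Pi\<^sub>E {..<m} X \<and> x = finsum R f {..<m}" for f
    proof -
      have "f \<in> {..<m} \<rightarrow> \<Gamma>" if "f \<in> Pi\<^sub>E {..<m} X" using that Xi by (fastforce simp: PiE_iff)
      then show ?thesis using finsum_lmod[OF G(1), of "{..<m}" f] by auto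
    qed
    have "\<exists>!f. f \<in> Pi\<^sub>E {..<m} X \<and> x = finsum (lmod \<Gamma>) f {..<m}"
      using X x by (simp add: internal_direct_sum_def)
    then show ?thesis unfolding fs .
  qed
  obtain f where f: "f \<in> Pi\<^sub>E {..<m} X" "e = (\<Oplus>i\<in>{..<m}. f i)" using rep[OF G(2)] by blast
  have fX: "f i \<in> X i" if "i < m" for i using f that by auto
  have fc: "f i \<in> carrier R" if "i < m" for i using Xc fX that by blast
  have act: "x \<otimes> f j = (if j = i then x else \<zero>)" if i: "i < m" "x \<in> X i" and j: "j < m" for i j x
  proof -
    have xc: "x \<in> carrier R" using Xc i by blast
    have xG: "x \<in> \<Gamma>" using Xi i by blast
    \<comment> \<open>Two expansions of x along the summands: xe multiplied out, and x itself in
      place i. Uniqueness of the expansion equates them.\<close>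
    let ?u = "\<lambda>k\<in>{..<m}. x \<otimes> f k" and ?w = "\<lambda>k\<in>{..<m}. if k = i then x else \<zero>"
    have "x = x \<otimes> (\<Oplus>k\<in>{..<m}. f k)" using G(4)[OF xG] f(2) by simp
    also have "\<dots> = (\<Oplus>k\<in>{..<m}. x \<otimes> f k)" using fc xc by (intro finsum_rdistr) auto
    also have "\<dots> = (\<Oplus>k\<in>{..<m}. ?u k)" using fc xc by (intro finsum_cong') auto
    finally have u: "?u \<in> Pi\<^sub>E {..<m} X \<and> x = (\<Oplus>k\<in>{..<m}. ?u k)"
      using fX xc left_idealD(5)[OF Xi(1)] by auto
    have "(\<Oplus>k\<in>{..<m}. ?w k) = (\<Oplus>k\<in>{..<m}. if i = k then x else \<zero>)"
      using xc by (intro finsum_cong') auto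
    also have "\<dots> = x" using finsum_singleton[of i "{..<m}" "\<lambda>_. x"] i xc by simp
    finally have "?w \<in> Pi\<^sub>E {..<m} X \<and> x = (\<Oplus>k\<in>{..<m}. ?w k)"
      using i left_idealD(3)[OF Xi(1)] by auto
    with u have "?u = ?w" using rep[OF xG] by blast
    then show ?thesis using j by (auto dest: fun_cong[of _ _ j])
  qed
  have comp: "component (X i) (f i)" if i: "i < m" for i
  proof -
    have "e \<otimes> f i = (\<Oplus>k\<in>{..<m}. f k \<otimes> f i)"
      unfolding f(2) using fc i by (intro finsum_ldistr) auto
    also have "\<dots> = (\<Oplus>k\<in>{..<m}. if i = k then f i else \<zero>)"
      using fc i act[OF _ fX i] by (intro finsum_cong') auto
    also have "\<dots> = f i" using finsum_singleton[of i "{..<m}" "\<lambda>_. f i"] i fc by simp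
    finally show ?thesis using Xi[OF i] fX[OF i] act[OF i _ i] by (auto simp: right_unit_def)
  qed
  have "\<exists>i<m. f i \<otimes> v = v"
  proof (rule ccontr)
    assume none: "\<not> ?thesis"
    have "v = (\<Oplus>i\<in>{..<m}. f i \<otimes> v)"
      using e_v finsum_ldistr[of "{..<m}" v f] fc v_closed unfolding f(2) by auto
    also have "\<dots> = (\<Oplus>i\<in>{..<m}. \<zero>)"
      using none component_v[OF comp] by (intro finsum_cong') auto
    finally show False using v_nonzero by simp
  qed
  then obtain i where i: "i < m" "f i \<otimes> v = v" by blast
  show ?thesis
  proof (rule ex1I[of _ i])
    show "i < m \<and> hom_nonzero (X i)" using component_hom_iff[OF comp[OF i(1)]] i by simp
  next
    fix j assume j: "j < m \<and> hom_nonzero (X j)"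
    then have "f j \<otimes> v = v" using component_hom_iff[OF comp[OF conjunct1[OF j]]] by blast
    then have "(f i \<otimes> f j) \<otimes> v = v" using i j fc v_closed by (simp add: m_assoc)
    then show "j = i" using act[OF i(1) fX[OF i(1)], of j] j v_closed v_nonzero by (auto split: if_splits)
  qed
qed

section \<open>The simple quotient of an indecomposable component\<close>

lemma maximal_submodule:
  assumes P: "component P f" "f \<otimes> v = v" "indecomposable R (lmod P)"
    and X: "left_ideal X" "X \<subseteq> P"
  shows "X = P \<or> X \<subseteq> {x \<in> P. x \<otimes> v \<in> J}"
proof (rule disjCI)
  note D = right_unitD[OF conjunct1[OF P(1)]]
  have Xc: "\<And>y. y \<in> X \<Longrightarrow> y \<in> carrier R" using X(1) left_idealD by blast
  assume "\<not> X \<subseteq> {x \<in> P. x \<otimes> v \<in> J}"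
  \<comment> \<open>\<open>J_maximal\<close> gives r with rxv = v. Then right multiplication by rx
    is bijective on P, and its image lies in X because rx does.\<close>
  then obtain x where x: "x \<in> X" "x \<otimes> v \<notin> J" using X(2) by auto
  then obtain r where r: "r \<in> carrier R" "r \<otimes> (x \<otimes> v) = v"
    using J_maximal[of "x \<otimes> v"] PIdl_memI[OF Xc, of x v] by auto
  have rx: "r \<otimes> x \<in> X" using left_idealD(5)[OF X(1)] r x by simp
  then have "r \<otimes> x \<in> P" "(r \<otimes> x) \<otimes> v = v" using X(2) r x Xc v_closed by (auto simp: m_assoc)
  then have "bij_betw (\<lambda>y. y \<otimes> (r \<otimes> x)) P P" by (rule fitting_component[OF P])
  then have "P = (\<lambda>y. y \<otimes> (r \<otimes> x)) ` P" by (simp add: bij_betw_def)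
  also have "\<dots> \<subseteq> X" using left_idealD(5)[OF X(1) _ rx] left_idealD(2)[OF D(1)] by auto
  finally show "X = P" using X(2) by auto
qed

text \<open>The preimage of J under x \<mapsto> xv is the largest proper submodule. Stated as an
  equation for Q, this delivers existence and uniqueness of the simple quotient at once.\<close>

lemma simple_quotient_component:
  assumes P: "component P f" "f \<otimes> v = v" "indecomposable R (lmod P)"
  shows "Module.submodule Q R (lmod P) \<and> simple_module R (quotient_module (lmod P) Q)
    \<longleftrightarrow> Q = {x \<in> P. x \<otimes> v \<in> J}" (is "_ \<longleftrightarrow> Q = ?Q")
proof -
  note D = right_unitD[OF conjunct1[OF P(1)]]
  interpret M: left_module R "lmod P" by (rule left_module_lmod[OF D(1)])
  have Pc: "\<And>y. y \<in> P \<Longrightarrow> y \<in> carrier R" using D(1) left_idealD by blast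
  have Q: "left_ideal ?Q"
    unfolding left_ideal_def using left_idealD[OF D(1)] left_idealD[OF left_ideal_J] v_closed
    by (auto simp: l_distr m_assoc)
  have Qs: "Module.submodule ?Q R (lmod P)" using Q by (auto simp: submodule_lmod[OF D(1)])
  have ne: "?Q \<noteq> P" using D(2) P(2) v_notin_J by (metis (mono_tags, lifting) mem_Collect_eq)
  show ?thesis
  proof
    assume l: "Module.submodule Q R (lmod P) \<and> simple_module R (quotient_module (lmod P) Q)"
    then have "left_ideal Q" "Q \<subseteq> P" "Q \<noteq> P"
      using M.simple_quotient_iff[of Q] by (auto simp: submodule_lmod[OF D(1)])
    then have "Q \<subseteq> ?Q" using maximal_submodule[OF P] by blast
    then show "Q = ?Q" using l Qs ne M.simple_quotient_iff[of Q] by auto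
  next
    assume Q_eq: "Q = ?Q"
    have "X = ?Q \<or> X = P" if "left_ideal X" "X \<subseteq> P" "?Q \<subseteq> X" for X
      using maximal_submodule[OF P that(1,2)] that(3) by blast
    then show "Module.submodule Q R (lmod P) \<and> simple_module R (quotient_module (lmod P) Q)"
      using Qs ne M.simple_quotient_iff[OF Qs] unfolding Q_eq by (auto simp: submodule_lmod[OF D(1)])
  qed
qed

text \<open>Right multiplication by v maps P onto Rv, since rv = (rf)v.\<close>

lemma quotient_component_iso:
  assumes P: "component P f" "f \<otimes> v = v"
  shows "module_iso R (quotient_module (lmod P) {x \<in> P. x \<otimes> v \<in> J}) (quotient_module (lmod (PIdl v)) J)"
proof (rule module_iso_quotient)
  note D = right_unitD[OF conjunct1[OF P(1)]]
  have Pc: "\<And>y. y \<in> P \<Longrightarrow> y \<in> carrier R" using D(1) left_idealD by blast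
  show "left_module R (lmod P)" by (rule left_module_lmod[OF D(1)])
  show "left_module R (lmod (PIdl v))" by (rule left_module_lmod[OF left_ideal_PIdl[OF v_closed]])
  show "(\<lambda>x. x \<otimes> v) \<in> LinearCombinations.module_hom R (lmod P) (lmod (PIdl v))"
    using Pc v_closed PIdl_memI by (auto simp: LinearCombinations.module_hom_def l_distr m_assoc)
  have "r \<otimes> v \<in> (\<lambda>x. x \<otimes> v) ` P" if r: "r \<in> carrier R" for r
  proof -
    have "r \<otimes> v = (r \<otimes> f) \<otimes> v" using r P(2) v_closed D(3) by (simp add: m_assoc)
    then show ?thesis using left_idealD(5)[OF D(1) r D(2)] by blast
  qed
  then show "(\<lambda>x. x \<otimes> v) ` carrier (lmod P) = carrier (lmod (PIdl v))"
    using Pc PIdl_memI by (auto simp: cgenideal_def)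
  show "Module.submodule J R (lmod (PIdl v))"
    using left_ideal_J J_subset by (simp add: submodule_lmod[OF left_ideal_PIdl[OF v_closed]])
qed simp

end

section \<open>The group algebra\<close>

context group
begin

text \<open>Constancy on the left cosets of B is shared by all elements of kG b and inherited by the
  left ideal generated by any such function, as in \<open>right_invariant_PIdl\<close>.\<close>

abbreviation right_invariant :: "'a set \<Rightarrow> ('a \<Rightarrow> 'k::field) \<Rightarrow> bool" where
  "right_invariant B y \<equiv> \<forall>x\<in>carrier G. \<forall>b\<in>B. y (x \<otimes> b) = y x"

lemma group_algebra_carrier_iff: "a \<in> carrier (group_algebra G) \<longleftrightarrow> (\<forall>x. x \<notin> carrier G \<longrightarrow> a x = 0)"
  by (simp add: group_algebra_def)

lemma group_algebra_add: "(a \<oplus>\<^bsub>group_algebra G\<^esub> b) = (\<lambda>x. a x + b x)"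
  by (simp add: group_algebra_def)

lemma group_algebra_zero: "\<zero>\<^bsub>group_algebra G\<^esub> = (\<lambda>x. 0)"
  by (simp add: group_algebra_def)

lemma group_algebra_smult: "c \<odot>\<^bsub>group_algebra G\<^esub> a = (\<lambda>x. c * a x)"
  by (simp add: group_algebra_def)

lemma group_algebra_mult:
  "x \<in> carrier G \<Longrightarrow> (a \<otimes>\<^bsub>group_algebra G\<^esub> b) x = (\<Sum>y\<in>carrier G. a y * b (inv y \<otimes> x))"
  by (simp add: group_algebra_def)

lemma group_algebra_smult_closed:
  "a \<in> carrier (group_algebra G) \<Longrightarrow> c \<odot>\<^bsub>group_algebra G\<^esub> a \<in> carrier (group_algebra G)"
  by (simp add: group_algebra_def)

lemma group_algebra_smult_assoc:
  "c \<odot>\<^bsub>group_algebra G\<^esub> a \<otimes>\<^bsub>group_algebra G\<^esub> b = c \<odot>\<^bsub>group_algebra G\<^esub> (a \<otimes>\<^bsub>group_algebra G\<^esub> b)"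
  by (rule ext) (simp add: group_algebra_def sum_distrib_left mult.assoc)

lemma group_algebra_smult_right:
  "a \<otimes>\<^bsub>group_algebra G\<^esub> (c \<odot>\<^bsub>group_algebra G\<^esub> b) = c \<odot>\<^bsub>group_algebra G\<^esub> (a \<otimes>\<^bsub>group_algebra G\<^esub> b)"
  by (rule ext) (simp add: group_algebra_def sum_distrib_left mult.left_commute)

lemma right_invariant_mult:
  assumes "B \<subseteq> carrier G" "right_invariant B b"
  shows "right_invariant B (a \<otimes>\<^bsub>group_algebra G\<^esub> b)"
proof (intro ballI)
  fix x c assume x: "x \<in> carrier G" and c: "c \<in> B"
  have cc: "c \<in> carrier G" using assms(1) c by auto
  have "b (inv y \<otimes> (x \<otimes> c)) = b (inv y \<otimes> x)" if "y \<in> carrier G" for y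
    using that x c cc assms(2) by (simp add: m_assoc[symmetric])
  then show "(a \<otimes>\<^bsub>group_algebra G\<^esub> b) (x \<otimes> c) = (a \<otimes>\<^bsub>group_algebra G\<^esub> b) x"
    using x cc by (simp add: group_algebra_mult)
qed

lemma u_sum_apply:
  assumes "finite (carrier G)" "U \<subseteq> carrier G"
  shows "u_sum G U \<sigma> x = (if x \<in> U then \<sigma> x else 0)"
proof -
  have fU: "finite U" using assms finite_subset by auto
  have "u_sum G U \<sigma> x = (\<Sum>u\<in>U. (\<sigma> u \<odot>\<^bsub>group_algebra G\<^esub> of_elt u) x)"
    unfolding u_sum_def using assms
    by (intro finsum_group_algebra fU) (auto intro!: group_algebra_smult_closed of_elt_closed)
  also have "\<dots> = (\<Sum>u\<in>U. if u = x then \<sigma> x else 0)"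
    by (intro sum.cong) (auto simp: group_algebra_smult of_elt_def)
  finally show ?thesis using fU by simp
qed

lemma u_sum_closed: "finite (carrier G) \<Longrightarrow> U \<subseteq> carrier G \<Longrightarrow> u_sum G U \<sigma> \<in> carrier (group_algebra G)"
  by (auto simp: group_algebra_carrier_iff u_sum_apply)

lemma u_sum_mult:
  assumes "finite (carrier G)" "U \<subseteq> carrier G" "x \<in> carrier G"
  shows "(u_sum G U \<sigma> \<otimes>\<^bsub>group_algebra G\<^esub> a) x = (\<Sum>u\<in>U. \<sigma> u * a (inv u \<otimes> x))"
proof -
  have "(u_sum G U \<sigma> \<otimes>\<^bsub>group_algebra G\<^esub> a) x = (\<Sum>y\<in>carrier G. if y \<in> U then \<sigma> y * a (inv y \<otimes> x) else 0)"
    unfolding group_algebra_mult[OF assms(3)] u_sum_apply[OF assms(1,2)] by (intro sum.cong) auto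
  also have "\<dots> = (\<Sum>y\<in>U. \<sigma> y * a (inv y \<otimes> x))"
    using assms by (simp add: sum.If_cases Int_absorb1)
  finally show ?thesis .
qed

lemma b_sum_eq: "b_sum G B = u_sum G B (\<lambda>_. 1)"
  unfolding b_sum_def u_sum_def group_algebra_smult by simp

lemma right_invariant_b_sum:
  assumes "finite (carrier G)" "subgroup B G"
  shows "right_invariant B (b_sum G B)"
proof (intro ballI)
  fix x b assume x: "x \<in> carrier G" and b: "b \<in> B"
  have BG: "B \<subseteq> carrier G" using subgroup.subset[OF assms(2)] .
  have "x \<otimes> b \<in> B \<longleftrightarrow> x \<in> B"
  proof
    assume "x \<otimes> b \<in> B"
    then have "x \<otimes> b \<otimes> inv b \<in> B" using b subgroup.m_closed[OF assms(2)] subgroup.m_inv_closed[OF assms(2)] by blast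
    then show "x \<in> B" using x b BG by (auto simp: m_assoc)
  next
    assume "x \<in> B" then show "x \<otimes> b \<in> B" using b subgroup.m_closed[OF assms(2)] by blast
  qed
  then show "b_sum G B (x \<otimes> b) = b_sum G B x" by (simp add: b_sum_eq u_sum_apply[OF assms(1) BG])
qed

lemma right_invariant_PIdl:
  assumes "B \<subseteq> carrier G" "right_invariant B a" "y \<in> PIdl\<^bsub>group_algebra G\<^esub> a"
  shows "right_invariant B y"
  using right_invariant_mult[OF assms(1,2)] assms(3) unfolding cgenideal_def by blast

subsection \<open>The invariant form\<close>

text \<open>The form picks coset representatives by \<open>SOME\<close>; on right-invariant
  functions any other choice gives the same value.\<close>

lemma perm_form_sum:
  assumes a: "right_invariant B a" and b: "right_invariant B b"
    and rep: "\<And>C. C \<in> (\<lambda>g. g <# B) ` carrier G \<Longrightarrow> r C \<in> C"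
  shows "perm_form G B a b = (\<Sum>C\<in>(\<lambda>g. g <# B) ` carrier G. a (r C) * b (r C))"
  unfolding perm_form_def
proof (rule sum.cong[OF refl])
  fix C assume C: "C \<in> (\<lambda>g. g <# B) ` carrier G"
  then obtain g where g: "g \<in> carrier G" "C = g <# B" by auto
  have c: "a x = a g \<and> b x = b g" if "x \<in> C" for x
    using that g a b by (auto simp: l_coset_def)
  have "(SOME g. g \<in> C) \<in> C" using rep[OF C] by (rule someI)
  then show "a (SOME g. g \<in> C) * b (SOME g. g \<in> C) = a (r C) * b (r C)"
    using c rep[OF C] by metis
qed

text \<open>G-invariance of the form: left translation by z permutes the left cosets of B.\<close>

lemma perm_form_translate:
  assumes B: "subgroup B G" and z: "z \<in> carrier G"
    and a: "right_invariant B a" and b: "right_invariant B b"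
  shows "perm_form G B a (\<lambda>x. b (inv z \<otimes> x)) = perm_form G B (\<lambda>x. a (z \<otimes> x)) b"
proof -
  let ?L = "(\<lambda>g. g <# B) ` carrier G"
  have BG: "B \<subseteq> carrier G" using subgroup.subset[OF B] .
  define r where "r C = (SOME g. g \<in> C)" for C :: "'a set"
  have r: "r C \<in> C" if C: "C \<in> ?L" for C
  proof -
    from C obtain g where g: "g \<in> carrier G" "C = g <# B" by auto
    have "g \<in> C" using g subgroup.one_closed[OF B] by (force simp: l_coset_def)
    then show ?thesis unfolding r_def by (rule someI)
  qed
  have Lc: "C \<subseteq> carrier G" if "C \<in> ?L" for C using that l_coset_subset_G[OF BG] by auto
  have zL: "w <# C \<in> ?L" if "C \<in> ?L" "w \<in> carrier G" for C w
    using that by (auto simp: lcos_m_assoc[OF BG] intro!: imageI)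
  have zz: "w <# (inv w <# C) = C" "inv w <# (w <# C) = C" if "C \<in> ?L" "w \<in> carrier G" for C w
    using that Lc[OF that(1)] by (simp_all add: lcos_m_assoc lcos_mult_one)
  have az: "right_invariant B (\<lambda>x. a (z \<otimes> x))" using a z BG by (auto simp: m_assoc[symmetric])
  have bz: "right_invariant B (\<lambda>x. b (inv z \<otimes> x))" using b z BG by (auto simp: m_assoc[symmetric])
  \<comment> \<open>The representative of C carried over from z^{-1} C. With this choice the sum
    becomes the right-hand side after reindexing C to z^{-1} C.\<close>
  have rz: "z \<otimes> r (inv z <# C) \<in> C" if C: "C \<in> ?L" for C
    using r[OF zL[OF C, of "inv z"]] zz(1)[OF C z] z by (force simp: l_coset_def)
  have "perm_form G B a (\<lambda>x. b (inv z \<otimes> x)) =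
      (\<Sum>C\<in>?L. a (z \<otimes> r (inv z <# C)) * b (inv z \<otimes> (z \<otimes> r (inv z <# C))))"
    by (rule perm_form_sum[OF a bz]) (rule rz)
  also have "\<dots> = (\<Sum>C\<in>?L. a (z \<otimes> r (inv z <# C)) * b (r (inv z <# C)))"
  proof (rule sum.cong[OF refl])
    fix C assume C: "C \<in> ?L"
    have "r (inv z <# C) \<in> carrier G" using r[OF zL[OF C]] Lc[OF zL[OF C]] z by blast
    then show "a (z \<otimes> r (inv z <# C)) * b (inv z \<otimes> (z \<otimes> r (inv z <# C))) = a (z \<otimes> r (inv z <# C)) * b (r (inv z <# C))"
      using z by (simp add: m_assoc[symmetric])
  qed
  also have "\<dots> = (\<Sum>C\<in>?L. a (z \<otimes> r C) * b (r C))"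
    by (rule sum.reindex_bij_witness[of _ "\<lambda>C. z <# C" "\<lambda>C. inv z <# C"]) (use zL zz z in auto)
  also have "\<dots> = perm_form G B (\<lambda>x. a (z \<otimes> x)) b"
    by (rule perm_form_sum[OF az b, symmetric]) (rule r)
  finally show ?thesis .
qed

text \<open>The anti-involution of kG induced by g \<mapsto> g^{-1}, extended by zero so that it
  lands in the carrier. It provides the adjoint of left multiplication with respect to the form, see
  \<open>perm_form_adjoint\<close>.\<close>

definition involute :: "('a \<Rightarrow> 'k::field) \<Rightarrow> 'a \<Rightarrow> 'k" where
  "involute a x = (if x \<in> carrier G then a (inv x) else 0)"

lemma involute_closed: "involute a \<in> carrier (group_algebra G)"
  by (simp add: involute_def group_algebra_def)

lemma perm_form_cong:
  assumes "subgroup B G" "\<And>x. x \<in> carrier G \<Longrightarrow> a x = a' x" "\<And>x. x \<in> carrier G \<Longrightarrow> b x = b' x"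
  shows "perm_form G B a b = perm_form G B a' b'"
  unfolding perm_form_def
proof (rule sum.cong[OF refl])
  fix C assume "C \<in> (\<lambda>g. g <# B) ` carrier G"
  then obtain g where g: "g \<in> carrier G" "C = g <# B" by auto
  have "g \<in> C" using g subgroup.one_closed[OF assms(1)] by (force simp: l_coset_def)
  then have "(SOME g. g \<in> C) \<in> C" by (rule someI)
  then have "(SOME g. g \<in> C) \<in> carrier G"
    using l_coset_subset_G[OF subgroup.subset[OF assms(1)] g(1)] g(2) by auto
  then show "a (SOME g. g \<in> C) * b (SOME g. g \<in> C) = a' (SOME g. g \<in> C) * b' (SOME g. g \<in> C)"
    using assms by simp
qed

lemma perm_form_sum_left: "perm_form G B (\<lambda>x. \<Sum>y\<in>Y. c y * f y x) b = (\<Sum>y\<in>Y. c y * perm_form G B (f y) b)"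
  unfolding perm_form_def by (simp add: sum_distrib_left sum_distrib_right mult.assoc) (rule sum.swap)

lemma perm_form_sym: "perm_form G B a b = perm_form G B b a"
  unfolding perm_form_def by (simp add: mult.commute)

lemma perm_form_adjoint:
  assumes B: "subgroup B G"
    and a: "right_invariant B a" and b: "right_invariant B b"
  shows "perm_form G B a (r \<otimes>\<^bsub>group_algebra G\<^esub> b) = perm_form G B (involute r \<otimes>\<^bsub>group_algebra G\<^esub> a) b"
proof -
  have BG: "B \<subseteq> carrier G" using subgroup.subset[OF B] .
  have "perm_form G B a (r \<otimes>\<^bsub>group_algebra G\<^esub> b) = perm_form G B a (\<lambda>x. \<Sum>z\<in>carrier G. r z * b (inv z \<otimes> x))"
    by (rule perm_form_cong[OF B]) (auto simp: group_algebra_mult)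
  also have "\<dots> = (\<Sum>z\<in>carrier G. r z * perm_form G B a (\<lambda>x. b (inv z \<otimes> x)))"
    unfolding perm_form_sym[of B a] by (rule perm_form_sum_left)
  also have "\<dots> = (\<Sum>z\<in>carrier G. r z * perm_form G B (\<lambda>x. a (z \<otimes> x)) b)"
    using perm_form_translate[OF B _ a b] by simp
  also have "\<dots> = (\<Sum>z\<in>carrier G. involute r z * perm_form G B (\<lambda>x. a (inv z \<otimes> x)) b)"
    by (rule sum.reindex_bij_witness[of _ "\<lambda>z. inv z" "\<lambda>z. inv z"]) (auto simp: involute_def)
  also have "\<dots> = perm_form G B (\<lambda>x. \<Sum>z\<in>carrier G. involute r z * a (inv z \<otimes> x)) b"
    by (rule perm_form_sum_left[symmetric])
  also have "\<dots> = perm_form G B (involute r \<otimes>\<^bsub>group_algebra G\<^esub> a) b"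
    by (rule perm_form_cong[OF B]) (auto simp: group_algebra_mult)
  finally show ?thesis .
qed

text \<open>Pairing with the basis vector g b reads off a coordinate.\<close>

lemma perm_form_elt:
  assumes fin: "finite (carrier G)" and B: "subgroup B G" and g: "g \<in> carrier G"
    and a: "right_invariant B a"
  shows "perm_form G B a (of_elt g \<otimes>\<^bsub>group_algebra G\<^esub> b_sum G B) = a g"
proof -
  let ?L = "(\<lambda>g. g <# B) ` carrier G"
  have "a (SOME x. x \<in> C) * (of_elt g \<otimes>\<^bsub>group_algebra G\<^esub> b_sum G B) (SOME x. x \<in> C) =
      (if C = g <# B then a g else 0)" if C: "C \<in> ?L" for C
  proof -
    from C obtain h where h: "h \<in> carrier G" "C = h <# B" by auto
    have "h \<in> C" using h subgroup.one_closed[OF B] by (force simp: l_coset_def)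
    then have s: "(SOME x. x \<in> C) \<in> C" by (rule someI)
    have "(SOME x. x \<in> C) \<in> g <# B \<longleftrightarrow> C = g <# B"
      using s h g B by (metis l_repr_independence)
    moreover have "a x = a g" if "x \<in> g <# B" for x using that g a by (auto simp: l_coset_def)
    ultimately show ?thesis using s unfolding of_elt_mult_b_sum[OF fin B g] by auto
  qed
  then have "perm_form G B a (of_elt g \<otimes>\<^bsub>group_algebra G\<^esub> b_sum G B) =
      (\<Sum>C\<in>?L. if C = g <# B then a g else 0)"
    unfolding perm_form_def by (intro sum.cong) auto
  also have "\<dots> = a g" using fin g by simp
  finally show ?thesis .
qed

lemma perm_form_add_left:
  "perm_form G B (\<lambda>x. a x + a' x) b = perm_form G B a b + perm_form G B a' b"
  unfolding perm_form_def by (simp add: distrib_right sum.distrib)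

subsection \<open>Finite dimension\<close>

text \<open>Left ideals are k-subspaces because the scalar c acts as left multiplication by c times
  the unit, and all of them lie in the span of the group elements. So \<open>d\<close> is the
  dimension over k and \<open>bound\<close> the number of group elements.\<close>

lemma group_algebra_finite_length:
  assumes fin: "finite (carrier G)"
  shows "\<exists>d bound. finite_length_ring (group_algebra G :: ('k::field, 'a \<Rightarrow> 'k) module) d bound"
proof -
  let ?K = "group_algebra G :: ('k, 'a \<Rightarrow> 'k) module"
  interpret K: ring ?K by (rule group_algebra_ring[OF fin])
  \<comment> \<open>The ambient space consists of all functions on the type with pointwise
    operations; the carrier of the group algebra is the subspace of functions supported on
    G.\<close>
  interpret V: Vector_Spaces.vector_space "\<lambda>(c::'k) (a::'a \<Rightarrow> 'k) x. c * a x"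
    by unfold_locales (auto simp: algebra_simps fun_eq_iff)
  let ?E = "(of_elt :: 'a \<Rightarrow> 'a \<Rightarrow> 'k) ` carrier G"
  have finE: "finite ?E" using fin by simp
  have sub: "V.subspace X" if X: "K.left_ideal X" for X
  proof (rule V.subspaceI)
    fix x y assume "x \<in> X" "y \<in> X"
    then show "x + y \<in> X" using K.left_idealD(4)[OF X] by (auto simp: group_algebra_add plus_fun_def)
  next
    fix c x assume x: "x \<in> X"
    have "(c \<odot>\<^bsub>?K\<^esub> \<one>\<^bsub>?K\<^esub>) \<otimes>\<^bsub>?K\<^esub> x \<in> X"
      using x by (intro K.left_idealD(5)[OF X] group_algebra_smult_closed) auto
    then show "(\<lambda>xa. c * x xa) \<in> X"
      using x K.left_idealD(2)[OF X] by (simp add: group_algebra_smult_assoc) (simp add: group_algebra_smult)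
  next
    show "0 \<in> X" using K.left_idealD(3)[OF X] by (simp add: group_algebra_zero zero_fun_def)
  qed
  have span: "X \<subseteq> V.span ?E" if X: "K.left_ideal X" for X
  proof
    fix a assume "a \<in> X"
    then have a: "\<And>x. x \<notin> carrier G \<Longrightarrow> a x = 0"
      using K.left_idealD(2)[OF X] by (auto simp: group_algebra_carrier_iff)
    have expand: "a x = (\<Sum>g\<in>carrier G. a g * of_elt g x)" for x
    proof -
      have "(\<Sum>g\<in>carrier G. a g * of_elt g x) = (\<Sum>g\<in>carrier G. if g = x then a g else 0)"
        by (intro sum.cong) (auto simp: of_elt_def)
      then show ?thesis using fin a by simp
    qed
    have apply_sum: "(\<Sum>g\<in>A. (\<lambda>x. a g * of_elt g x)) x = (\<Sum>g\<in>A. a g * of_elt g x)" for A x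
      by (induction A rule: infinite_finite_induct) auto
    have "a = (\<Sum>g\<in>carrier G. (\<lambda>x. a g * of_elt g x))"
      by (rule ext) (rule trans[OF expand apply_sum[symmetric]])
    also have "\<dots> \<in> V.span ?E" by (intro V.span_sum V.span_scale V.span_base) auto
    finally show "a \<in> V.span ?E" .
  qed
  have "finite_length_ring ?K V.dim (card ?E)"
  proof unfold_locales
    fix X Y assume X: "K.left_ideal X" and Y: "K.left_ideal Y" and XY: "X \<subset> Y"
    obtain A where A: "A \<subseteq> X" "V.independent A" "X \<subseteq> V.span A" "card A = V.dim X"
      using V.basis_exists[of X] by blast
    obtain C where C: "C \<subseteq> Y" "V.independent C" "Y \<subseteq> V.span C" "card C = V.dim Y"
      using V.basis_exists[of Y] by blast
    \<comment> \<open>Adding y to a basis of X keeps it independent inside the span of a basis of Y,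
      so the dimension grows strictly.\<close>
    obtain y where y: "y \<in> Y" "y \<notin> X" using XY by blast
    have "V.span A \<subseteq> X" by (rule V.span_minimal[OF A(1) sub[OF X]])
    then have ind: "V.independent (insert y A)" using y A(2) by (intro V.independent_insertI) auto
    have "C \<subseteq> V.span ?E" using C(1) span[OF Y] by blast
    then have finC: "finite C" using V.independent_span_bound[OF finE C(2)] by blast
    have "insert y A \<subseteq> V.span C" using y A(1) XY C(3) by blast
    from V.independent_span_bound[OF finC ind this]
    have "finite (insert y A) \<and> card (insert y A) \<le> card C" .
    moreover have "y \<notin> A" using y A(1) by auto
    ultimately show "V.dim X < V.dim Y" using A(4) C(4) by auto
  next
    fix X assume X: "K.left_ideal X"
    obtain A where A: "A \<subseteq> X" "V.independent A" "X \<subseteq> V.span A" "card A = V.dim X"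
      using V.basis_exists[of X] by blast
    have "A \<subseteq> V.span ?E" using A(1) span[OF X] by blast
    then show "V.dim X \<le> card ?E" using V.independent_span_bound[OF finE A(2)] A(4) by simp
  qed
  then show ?thesis by blast
qed

subsection \<open>Homomorphism spaces\<close>

text \<open>In \<open>vectorspace_hom_space\<close> the type of the elements of \<open>M\<close> coincides with the type of the additional
  record fields of \<open>G\<close>. Replacing those fields, which are irrelevant, removes the restriction.\<close>

lemma vectorspace_hom_space_general:
  fixes M :: "('a \<Rightarrow> 'k::field, 'c, 'm) module_scheme" and M' :: "('a \<Rightarrow> 'k, 'd, 'n) module_scheme"
  assumes "finite (carrier G)" "left_module (group_algebra G) M" "left_module (group_algebra G) M'"
  shows "vectorspace class_ring (hom_space G M M')"
proof -
  define G' where "G' = \<lparr>carrier = carrier G, monoid.mult = (\<otimes>), one = \<one>, \<dots> = undefined :: 'c\<rparr>"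
  have f: "carrier G' = carrier G" "monoid.mult G' = (\<otimes>)" "\<one>\<^bsub>G'\<^esub> = \<one>" by (simp_all add: G'_def)
  have "group G'"
    by (rule groupI) (auto simp: f m_assoc intro: bexI[of _ "inv _"])
  moreover have "group_algebra G' = (group_algebra G :: ('k, 'a \<Rightarrow> 'k) module)"
    unfolding group_algebra_def m_inv_def f ..
  then have "left_module (group_algebra G') M" "left_module (group_algebra G') M'"
    "hom_space G' M M' = hom_space G M M'"
    using assms by (simp_all add: hom_space_def)
  ultimately show ?thesis using group.vectorspace_hom_space[of G' M M'] assms(1) by (simp add: f)
qed

text \<open>Elements of \<open>hom_space\<close> are homomorphisms made extensional; restricting an
  arbitrary homomorphism to X passes between the two descriptions.\<close>

lemma hom_space_nonzero_iff:
  fixes X T :: "('a \<Rightarrow> 'k::field) set"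
  assumes fin: "finite (carrier G)"
    and X: "ring.left_ideal (group_algebra G) X" and T: "ring.left_ideal (group_algebra G) T"
  defines "lm \<equiv> \<lambda>X. (regular_module (group_algebra G))\<lparr>carrier := X\<rparr>"
  shows "carrier (hom_space G (lm X) (lm T)) \<noteq> {\<zero>\<^bsub>hom_space G (lm X) (lm T)\<^esub>} \<longleftrightarrow>
    (\<exists>h\<in>LinearCombinations.module_hom (group_algebra G) (lm X) (lm T). \<exists>x\<in>X. h x \<noteq> \<zero>\<^bsub>group_algebra G\<^esub>)"
proof -
  let ?K = "group_algebra G :: ('k, 'a \<Rightarrow> 'k) module"
  interpret K: ring ?K by (rule group_algebra_ring[OF fin])
  let ?H = "hom_space G (lm X) (lm T)"
  have c: "carrier (lm Y) = Y" "\<zero>\<^bsub>lm Y\<^esub> = \<zero>\<^bsub>?K\<^esub>" for Y by (simp_all add: lm_def)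
  have H: "carrier ?H = LinearCombinations.module_hom ?K (lm X) (lm T) \<inter> extensional X"
    "\<zero>\<^bsub>?H\<^esub> = (\<lambda>x\<in>X. \<zero>\<^bsub>?K\<^esub>)" by (simp_all add: hom_space_def c)
  interpret V: vectorspace class_ring ?H
    unfolding lm_def
    by (rule vectorspace_hom_space_general[OF fin K.left_module_lmod[OF X] K.left_module_lmod[OF T]])
  have z: "\<zero>\<^bsub>?H\<^esub> \<in> carrier ?H" by (rule V.zero_closed)
  have r: "restrict h X \<in> carrier ?H" if "h \<in> LinearCombinations.module_hom ?K (lm X) (lm T)" for h
    using that K.left_idealD(4,5)[OF X] unfolding H
    by (auto simp: LinearCombinations.module_hom_def lm_def)
  show ?thesis
  proof
    assume "carrier ?H \<noteq> {\<zero>\<^bsub>?H\<^esub>}"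
    then obtain h where h: "h \<in> carrier ?H" "h \<noteq> \<zero>\<^bsub>?H\<^esub>" using z by blast
    have "\<exists>x\<in>X. h x \<noteq> \<zero>\<^bsub>?K\<^esub>"
    proof (rule ccontr)
      assume "\<not> ?thesis"
      then have "h = (\<lambda>x\<in>X. \<zero>\<^bsub>?K\<^esub>)" using h(1) unfolding H
        by (intro extensionalityI[of _ X]) auto
      then show False using h(2) H(2) by simp
    qed
    then show "\<exists>h\<in>LinearCombinations.module_hom ?K (lm X) (lm T). \<exists>x\<in>X. h x \<noteq> \<zero>\<^bsub>?K\<^esub>"
      using h(1) unfolding H by blast
  next
    assume "\<exists>h\<in>LinearCombinations.module_hom ?K (lm X) (lm T). \<exists>x\<in>X. h x \<noteq> \<zero>\<^bsub>?K\<^esub>"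
    then obtain h x where h: "h \<in> LinearCombinations.module_hom ?K (lm X) (lm T)" "x \<in> X" "h x \<noteq> \<zero>\<^bsub>?K\<^esub>"
      by blast
    have "restrict h X x \<noteq> (\<lambda>x\<in>X. \<zero>\<^bsub>?K\<^esub>) x" using h(2,3) by simp
    then have "restrict h X \<noteq> \<zero>\<^bsub>?H\<^esub>" unfolding H by metis
    then show "carrier ?H \<noteq> {\<zero>\<^bsub>?H\<^esub>}" using r[OF h(1)] by blast
  qed
qed

text \<open>h(x) = x h(e), and h(e) is fixed by e, hence a multiple of v. So \<phi>, the map x
  \<mapsto> xv, spans the space of homomorphisms, and it is non-zero since it sends e to v.\<close>

lemma dim_hom_space_eq_1:
  fixes X T :: "('a \<Rightarrow> 'k::field) set"
  assumes fin: "finite (carrier G)"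
    and X: "ring.right_unit (group_algebra G) X e" and T: "ring.left_ideal (group_algebra G) T"
    and v: "v \<in> T" "v \<noteq> \<zero>\<^bsub>group_algebra G\<^esub>" "e \<otimes>\<^bsub>group_algebra G\<^esub> v = v"
    and inv: "\<And>t. t \<in> T \<Longrightarrow> e \<otimes>\<^bsub>group_algebra G\<^esub> t = t \<Longrightarrow> \<exists>c. t = c \<odot>\<^bsub>group_algebra G\<^esub> v"
  defines "lm \<equiv> \<lambda>X. (regular_module (group_algebra G))\<lparr>carrier := X\<rparr>"
  shows "vectorspace.dim class_ring (hom_space G (lm X) (lm T)) = 1"
proof -
  let ?K = "group_algebra G :: ('k, 'a \<Rightarrow> 'k) module"
  interpret K: ring ?K by (rule group_algebra_ring[OF fin])
  let ?H = "hom_space G (lm X) (lm T)"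
  note X' = K.right_unitD[OF X]
  have Xc: "\<And>x. x \<in> X \<Longrightarrow> x \<in> carrier ?K" using K.left_idealD(2)[OF X'(1)] .
  have vc: "v \<in> carrier ?K" using K.left_idealD(2)[OF T v(1)] .
  have lm: "carrier (lm Y) = Y" "\<zero>\<^bsub>lm Y\<^esub> = \<zero>\<^bsub>?K\<^esub>" "add (lm Y) = add ?K" "smult (lm Y) = mult ?K" for Y
    by (simp_all add: lm_def)
  have H: "carrier ?H = LinearCombinations.module_hom ?K (lm X) (lm T) \<inter> extensional X"
    "\<zero>\<^bsub>?H\<^esub> = (\<lambda>x\<in>X. \<zero>\<^bsub>?K\<^esub>)"
    "c \<odot>\<^bsub>?H\<^esub> h = (\<lambda>x\<in>X. (c \<odot>\<^bsub>?K\<^esub> \<one>\<^bsub>?K\<^esub>) \<otimes>\<^bsub>?K\<^esub> h x)" for c h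
    by (simp_all add: hom_space_def lm)
  interpret V: vectorspace class_ring ?H
    unfolding lm_def
    by (rule vectorspace_hom_space_general[OF fin K.left_module_lmod[OF X'(1)] K.left_module_lmod[OF T]])
  define \<phi> where "\<phi> = (\<lambda>x\<in>X. x \<otimes>\<^bsub>?K\<^esub> v)"
  have \<phi>: "\<phi> \<in> carrier ?H"
    unfolding H \<phi>_def
    using Xc vc K.left_idealD(5)[OF T _ v(1)] K.left_idealD(4,5)[OF X'(1)]
    by (auto simp: LinearCombinations.module_hom_def lm K.l_distr K.m_assoc)
  have "\<phi> e = v" using X'(2) v(3) by (simp add: \<phi>_def)
  then have ne: "\<phi> \<noteq> \<zero>\<^bsub>?H\<^esub>" using v(2) X'(2) unfolding H by auto
  have all: "\<exists>c. h = c \<odot>\<^bsub>?H\<^esub> \<phi>" if h: "h \<in> carrier ?H" for h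
  proof -
    have hT: "h x \<in> T" if "x \<in> X" for x using h that unfolding H by (auto simp: LinearCombinations.module_hom_def lm)
    have hs: "h (a \<otimes>\<^bsub>?K\<^esub> x) = a \<otimes>\<^bsub>?K\<^esub> h x" if "a \<in> carrier ?K" "x \<in> X" for a x
      using h that unfolding H by (auto simp: LinearCombinations.module_hom_def lm)
    have "e \<otimes>\<^bsub>?K\<^esub> h e = h e" using hs[OF X'(3,2)] X'(5) by simp
    then obtain c where c: "h e = c \<odot>\<^bsub>?K\<^esub> v" using inv[OF hT[OF X'(2)]] by blast
    have "h x = (c \<odot>\<^bsub>?K\<^esub> \<one>\<^bsub>?K\<^esub>) \<otimes>\<^bsub>?K\<^esub> \<phi> x" if x: "x \<in> X" for x
    proof -
      have "h x = x \<otimes>\<^bsub>?K\<^esub> h e" using hs[OF Xc[OF x] X'(2)] X'(4)[OF x] by simp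
      then show ?thesis using x Xc[OF x] vc
        by (simp add: c \<phi>_def group_algebra_smult_assoc group_algebra_smult_right)
    qed
    then have "h = c \<odot>\<^bsub>?H\<^esub> \<phi>" using h unfolding H by (intro extensionalityI[of _ X]) auto
    then show ?thesis by blast
  qed
  have "V.gen_set {\<phi>}"
  proof
    show "V.span {\<phi>} \<subseteq> carrier ?H" using \<phi> V.span_is_subset2[of "{\<phi>}"] by blast
    show "carrier ?H \<subseteq> V.span {\<phi>}"
    proof
      fix h assume "h \<in> carrier ?H"
      then obtain c where c: "h = c \<odot>\<^bsub>?H\<^esub> \<phi>" using all by blast
      have "V.lincomb (\<lambda>_. c) {\<phi>} = c \<odot>\<^bsub>?H\<^esub> \<phi>"
        unfolding V.lincomb_def using \<phi> V.smult_closed[of c \<phi>] by simp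
      then show "h \<in> V.span {\<phi>}" unfolding c V.span_def by (auto intro!: exI[of _ "\<lambda>_. c"] exI[of _ "{\<phi>}"])
    qed
  qed
  then show ?thesis by (rule V.dim1I[OF _ ne \<phi>])
qed

end

section \<open>Non-degenerate characters\<close>

locale nondegenerate_character = split_BN_pair G B N U S p
  for G (structure) and B N U S p +
  fixes w0 :: "'a set" and n0 :: 'a and \<sigma> :: "'a \<Rightarrow> 'k::field"
  assumes longest_w0: "longest_element (weyl_group G B N) S w0" and n0_rep: "n0 \<in> w0"
    and card_U_nonzero: "of_nat (card U) \<noteq> (0::'k)"
    and character: "\<sigma> \<in> hom (G\<lparr>carrier := U\<rparr>) (units_of class_ring)"
    and nondegenerate_char: "nondegenerate G U S n0 \<sigma>"
begin

abbreviation kG :: "('k, 'a \<Rightarrow> 'k) module" where "kG \<equiv> group_algebra G"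

end

sublocale nondegenerate_character \<subseteq> kG: ring kG
  by (rule group_algebra_ring[OF finite_G])

context nondegenerate_character
begin

abbreviation kG_mult :: "('a \<Rightarrow> 'k) \<Rightarrow> ('a \<Rightarrow> 'k) \<Rightarrow> 'a \<Rightarrow> 'k" (infixl \<open>\<star>\<close> 70) where
  "a \<star> b \<equiv> a \<otimes>\<^bsub>kG\<^esub> b"

abbreviation kG_smult :: "'k \<Rightarrow> ('a \<Rightarrow> 'k) \<Rightarrow> 'a \<Rightarrow> 'k" (infixr \<open>\<cdot>\<close> 75) where
  "c \<cdot> a \<equiv> c \<odot>\<^bsub>kG\<^esub> a"

abbreviation bsum :: "'a \<Rightarrow> 'k" where "bsum \<equiv> b_sum G B"
abbreviation usum :: "'a \<Rightarrow> 'k" where "usum \<equiv> u_sum G U \<sigma>"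
abbreviation usum' :: "'a \<Rightarrow> 'k" where "usum' \<equiv> u_sum G U (\<lambda>u. inverse (\<sigma> u))"
abbreviation n0b :: "'a \<Rightarrow> 'k" where "n0b \<equiv> of_elt n0 \<star> bsum"

definition idem :: "'a \<Rightarrow> 'k" where "idem = inverse (of_nat (card U)) \<cdot> usum"

text \<open>The vector v of the overview, bracketed like the generator in
  \<open>S_module\<close>.\<close>

definition whittaker :: "'a \<Rightarrow> 'k" where "whittaker = usum \<star> of_elt n0 \<star> bsum"

text \<open>The functions fixed by left multiplication with \<open>idem\<close>, see
  \<open>idem_fixed_iff\<close>.\<close>

definition left_equivariant :: "('a \<Rightarrow> 'k) \<Rightarrow> bool" where
  "left_equivariant y \<longleftrightarrow> y \<in> carrier kG \<and> (\<forall>u\<in>U. \<forall>x\<in>carrier G. y (u \<otimes> x) = \<sigma> u * y x)"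

lemma subgroup_U: "subgroup U G"
  by (rule incl_subgroup[OF subgroup_B normal_imp_subgroup[OF normal_U]])

lemma U_carrier [simp]: "u \<in> U \<Longrightarrow> u \<in> carrier G"
  using subgroup.mem_carrier[OF subgroup_U] .

lemma U_subset: "U \<subseteq> carrier G"
  using subgroup.subset[OF subgroup_U] .

lemma B_subset: "B \<subseteq> carrier G"
  using subgroup.subset[OF subgroup_B] .

lemma U_mult [simp]: "u \<in> U \<Longrightarrow> u' \<in> U \<Longrightarrow> u \<otimes> u' \<in> U"
  using subgroup.m_closed[OF subgroup_U] .

lemma U_inv [simp]: "u \<in> U \<Longrightarrow> inv u \<in> U"
  using subgroup.m_inv_closed[OF subgroup_U] .

lemma U_one [simp]: "\<one> \<in> U"
  using subgroup.one_closed[OF subgroup_U] .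

lemma char_mult: "u \<in> U \<Longrightarrow> u' \<in> U \<Longrightarrow> \<sigma> (u \<otimes> u') = \<sigma> u * \<sigma> u'"
  using character by (auto simp: hom_def units_of_def)

lemma char_nonzero:
  assumes "u \<in> U"
  shows "\<sigma> u \<noteq> 0"
proof -
  have "\<sigma> u \<in> Units class_ring" using character assms by (auto simp: hom_def units_of_def)
  then obtain x where "x * \<sigma> u = 1" by (auto simp: Units_def)
  then show ?thesis by auto
qed

lemma char_one: "\<sigma> \<one> = 1"
  using char_mult[of \<one> \<one>] char_nonzero[of \<one>] by simp

lemma char_inv: "u \<in> U \<Longrightarrow> \<sigma> (inv u) = inverse (\<sigma> u)"
  using inverse_unique[of "\<sigma> u" "\<sigma> (inv u)"] char_mult[of u "inv u"] by (simp add: char_one)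

lemma n0_N: "n0 \<in> N"
  using mem_Weyl[of w0 n0] longest_w0 n0_rep by (auto simp: longest_element_def)

lemma n0_carrier [simp]: "n0 \<in> carrier G"
  using n0_N by simp

lemma usum_closed [simp]: "usum \<in> carrier kG" and usum'_closed [simp]: "usum' \<in> carrier kG"
  and bsum_closed [simp]: "bsum \<in> carrier kG" and elt_closed [simp]: "of_elt n0 \<in> carrier kG"
  using u_sum_closed[OF finite_G U_subset] u_sum_closed[OF finite_G B_subset] of_elt_closed[OF n0_carrier]
  by (auto simp: b_sum_eq)

lemma smult_closed [simp]: "a \<in> carrier kG \<Longrightarrow> c \<cdot> a \<in> carrier kG"
  by (rule group_algebra_smult_closed)

lemma smult_mem: "kG.left_ideal X \<Longrightarrow> a \<in> X \<Longrightarrow> c \<cdot> a \<in> X"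
  using kG.left_idealD(5)[of X "c \<cdot> \<one>\<^bsub>kG\<^esub>" a] kG.left_idealD(2)[of X a]
  by (simp add: group_algebra_smult_assoc)

lemma smult_smult: "c \<cdot> c' \<cdot> a = (c * c') \<cdot> a"
  by (simp add: group_algebra_smult mult.assoc)

lemma smult_one: "1 \<cdot> a = a"
  by (simp add: group_algebra_smult)

lemma involute_kG [simp]: "involute r \<in> carrier kG"
  by (rule involute_closed)

lemma idem_closed [simp]: "idem \<in> carrier kG"
  by (simp add: idem_def)

section \<open>Equivariant functions as fixed points of the idempotent\<close>

lemma left_equivariant_usum: "a \<in> carrier kG \<Longrightarrow> left_equivariant (usum \<star> a)"
  unfolding left_equivariant_def
proof (intro conjI ballI)
  fix u x assume u: "u \<in> U" and x: "x \<in> carrier G"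
  have "(usum \<star> a) (u \<otimes> x) = (\<Sum>t\<in>U. \<sigma> t * a (inv t \<otimes> (u \<otimes> x)))"
    using u x by (simp add: u_sum_mult[OF finite_G U_subset])
  also have "\<dots> = (\<Sum>t\<in>U. \<sigma> u * (\<sigma> t * a (inv t \<otimes> x)))"
  proof (rule sum.reindex_bij_witness[of _ "\<lambda>t. u \<otimes> t" "\<lambda>t. inv u \<otimes> t"])
    fix t assume t: "t \<in> U"
    have "\<sigma> t = \<sigma> u * \<sigma> (inv u \<otimes> t)"
      using char_mult[of u "inv u \<otimes> t"] t u by (simp add: m_assoc[symmetric])
    moreover have "inv (inv u \<otimes> t) \<otimes> x = inv t \<otimes> (u \<otimes> x)"
      using t u x by (simp add: inv_mult_group m_assoc)
    ultimately show "\<sigma> u * (\<sigma> (inv u \<otimes> t) * a (inv (inv u \<otimes> t) \<otimes> x)) = \<sigma> t * a (inv t \<otimes> (u \<otimes> x))"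
      by simp
  qed (use u in \<open>auto simp: m_assoc[symmetric]\<close>)
  also have "\<dots> = \<sigma> u * (usum \<star> a) x"
    using x by (simp add: u_sum_mult[OF finite_G U_subset] sum_distrib_left)
  finally show "(usum \<star> a) (u \<otimes> x) = \<sigma> u * (usum \<star> a) x" .
qed simp

lemma left_equivariant_idem:
  assumes "a \<in> carrier kG"
  shows "left_equivariant (idem \<star> a)"
proof -
  have "idem \<star> a = inverse (of_nat (card U)) \<cdot> (usum \<star> a)"
    by (simp add: idem_def group_algebra_smult_assoc)
  with left_equivariant_usum[OF assms] show ?thesis
    by (auto simp: left_equivariant_def) (simp add: group_algebra_smult)
qed

text \<open>At x each u contributes \<sigma>(u) y(u^{-1} x) = y(x), so the sum counts U.\<close>

lemma usum_left_equivariant: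
  assumes "left_equivariant y"
  shows "usum \<star> y = of_nat (card U) \<cdot> y"
proof
  fix x
  show "(usum \<star> y) x = (of_nat (card U) \<cdot> y) x"
  proof (cases "x \<in> carrier G")
    case True
    have "(usum \<star> y) x = (\<Sum>u\<in>U. y x)"
      unfolding u_sum_mult[OF finite_G U_subset True]
      using assms True by (intro sum.cong) (auto simp: left_equivariant_def char_inv char_nonzero)
    then show ?thesis by (simp add: group_algebra_smult)
  next
    case False
    have "y \<in> carrier kG" using assms by (simp add: left_equivariant_def)
    with False show ?thesis using kG.m_closed[OF usum_closed, of y]
      by (simp add: group_algebra_carrier_iff[of y] group_algebra_carrier_iff[of "usum \<star> y"] group_algebra_smult)
  qed
qed

lemma idem_left_equivariant: "left_equivariant y \<Longrightarrow> idem \<star> y = y"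
  unfolding idem_def group_algebra_smult_assoc
  using card_U_nonzero by (simp add: usum_left_equivariant smult_smult smult_one)

lemma idem_fixed_iff: "a \<in> carrier kG \<Longrightarrow> idem \<star> a = a \<longleftrightarrow> left_equivariant a"
  using left_equivariant_idem[of a] idem_left_equivariant[of a] by auto

lemma idem_idem: "idem \<star> idem = idem"
proof -
  have "left_equivariant usum" using left_equivariant_usum[of "\<one>\<^bsub>kG\<^esub>"] by simp
  then show ?thesis
    using idem_left_equivariant[of usum] by (simp add: idem_def group_algebra_smult_right)
qed

lemma PIdl_usum: "PIdl\<^bsub>kG\<^esub> usum = PIdl\<^bsub>kG\<^esub> idem"
proof
  have I: "kG.left_ideal (PIdl\<^bsub>kG\<^esub> usum)" "kG.left_ideal (PIdl\<^bsub>kG\<^esub> idem)" by (auto intro: kG.left_ideal_PIdl)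
  show "PIdl\<^bsub>kG\<^esub> idem \<subseteq> PIdl\<^bsub>kG\<^esub> usum"
    using smult_mem[OF I(1) kG.PIdl_self] by (intro kG.PIdl_subset I) (simp add: idem_def)
  have "usum = of_nat (card U) \<cdot> idem" using card_U_nonzero by (simp add: idem_def smult_smult smult_one)
  then show "PIdl\<^bsub>kG\<^esub> usum \<subseteq> PIdl\<^bsub>kG\<^esub> idem"
    using smult_mem[OF I(2) kG.PIdl_self[OF idem_closed], of "of_nat (card U)"] by (intro kG.PIdl_subset I) simp
qed

lemma right_unit_gelfand_graev: "kG.right_unit (PIdl\<^bsub>kG\<^esub> usum) idem"
  unfolding PIdl_usum by (rule kG.right_unit_PIdl) (auto simp: idem_idem)

section \<open>The line of equivariant functions in the permutation module\<close>

text \<open>By the Bruhat decomposition such a function is determined by its values on \<open>N\<close>. At \<open>n \<notin> w0\<close> the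
  value is multiplied by \<open>\<sigma> u \<noteq> 1\<close> for some \<open>u\<close> with \<open>n\<inverse> u n \<in> B\<close>, so that it vanishes.\<close>

lemma equivariant_eq_zero:
  assumes y: "left_equivariant y" and r: "right_invariant B y" and z: "y n0 = 0"
  shows "y = \<zero>\<^bsub>kG\<^esub>"
proof
  have y_left: "y (u \<otimes> x) = \<sigma> u * y x" if "u \<in> U" "x \<in> carrier G" for u x
    using y that by (simp add: left_equivariant_def)
  have w0c: "w0 \<in> carrier Weyl" using longest_w0 by (simp add: longest_element_def)
  have N0: "y n = 0" if n: "n \<in> N" for n
  proof (cases "n \<in> w0")
    case True
    have "inv n0 \<otimes> n \<in> inv\<^bsub>Weyl\<^esub> w0 \<otimes>\<^bsub>Weyl\<^esub> w0"
      by (rule mult_rep[OF _ w0c inv_rep[OF w0c n0_rep] True]) (use w0c in simp)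
    then have "inv n0 \<otimes> n \<in> B" using w0c by (simp add: one_Weyl)
    then have "y (n0 \<otimes> (inv n0 \<otimes> n)) = y n0" using r by simp
    moreover have "n0 \<otimes> (inv n0 \<otimes> n) = n" using n by (simp add: m_assoc[symmetric])
    ultimately show ?thesis using z by simp
  next
    case False
    obtain s where s: "s \<in> S" and H: "\<forall>ns\<in>s. \<forall>u\<in>root_part G U n0 ns. inv n \<otimes> u \<otimes> n \<in> B"
      using ex_root_part_conj[OF longest_w0 n0_rep n False] by blast
    obtain ns where ns: "ns \<in> s" using ex_rep s S_subset by blast
    obtain u where u: "u \<in> root_part G U n0 ns" "\<sigma> u \<noteq> 1"
      using nondegenerate_char s ns by (auto simp: nondegenerate_def)
    then have uU: "u \<in> U" by (simp add: root_part_def)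
    have "y (n \<otimes> (inv n \<otimes> u \<otimes> n)) = y n" using H ns u r n by simp
    moreover have "n \<otimes> (inv n \<otimes> u \<otimes> n) = u \<otimes> n" using n uU by (simp add: m_assoc[symmetric])
    ultimately have "\<sigma> u * y n = y n" using y_left[OF uU] n by simp
    then show ?thesis using u(2) by simp
  qed
  fix x
  show "y x = \<zero>\<^bsub>kG\<^esub> x"
  proof (cases "x \<in> carrier G")
    case True
    then obtain u n b where "u \<in> U" "n \<in> N" "b \<in> B" "x = u \<otimes> n \<otimes> b" using ex_UNB by blast
    then show ?thesis using r y_left N0 by (simp add: group_algebra_zero)
  next
    case False
    then show ?thesis using y by (simp add: left_equivariant_def group_algebra_carrier_iff group_algebra_zero)
  qed
qed

lemma right_invariant_bsum: "right_invariant B bsum"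
  by (rule right_invariant_b_sum[OF finite_G subgroup_B])

lemma right_invariant_left_mult: "right_invariant B b \<Longrightarrow> right_invariant B (a \<star> b)"
  by (rule right_invariant_mult[OF B_subset])

lemma whittaker_eq: "whittaker = usum \<star> n0b"
  unfolding whittaker_def by (rule kG.m_assoc) auto

lemma whittaker_closed [simp]: "whittaker \<in> carrier kG"
  by (simp add: whittaker_def)

lemma left_equivariant_whittaker: "left_equivariant whittaker"
  unfolding whittaker_eq by (rule left_equivariant_usum) simp

lemma right_invariant_whittaker: "right_invariant B whittaker"
  unfolding whittaker_def by (rule right_invariant_left_mult[OF right_invariant_bsum])

text \<open>The cosets u n0 B are pairwise distinct: an equality gives a non-trivial element of U
  conjugated into B by n0^{-1}, against \<open>longest_U_Int\<close>.\<close>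

lemma n0_coset:
  assumes "u \<in> U" "inv u \<otimes> n0 \<in> n0 <# B"
  shows "u = \<one>"
proof -
  obtain b where "b \<in> B" "inv u \<otimes> n0 = n0 \<otimes> b" using assms(2) by (auto simp: l_coset_def)
  then have "inv n0 \<otimes> (inv u \<otimes> n0) \<in> B" by (simp add: m_assoc[symmetric])
  then have "inv u = \<one>"
    using longest_U_Int[OF longest_w0 n0_rep, of "inv u"] assms(1) by (simp add: m_assoc)
  then show ?thesis using assms(1) by simp
qed

text \<open>Shared by the computations for \<open>n0b\<close> and for the Steinberg element, where
  among the points u^{-1} n0 only u = 1 contributes.\<close>

lemma usum_apply_n0:
  assumes a: "\<And>u. u \<in> U \<Longrightarrow> a (inv u \<otimes> n0) = (if u = \<one> then c else 0)"
  shows "(usum \<star> a) n0 = c"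
proof -
  have "(usum \<star> a) n0 = (\<Sum>u\<in>U. if u = \<one> then c else 0)"
    unfolding u_sum_mult[OF finite_G U_subset n0_carrier]
    by (intro sum.cong) (auto simp: a char_one)
  also have "\<dots> = c" using finite_subset[OF U_subset finite_G] by simp
  finally show ?thesis .
qed

lemma whittaker_n0: "whittaker n0 = 1"
  unfolding whittaker_eq
proof (rule usum_apply_n0)
  fix u assume u: "u \<in> U"
  have "n0 \<in> n0 <# B" using B_one by (force simp: l_coset_def)
  then have "inv u \<otimes> n0 \<in> n0 <# B \<longleftrightarrow> u = \<one>" using n0_coset[OF u] by (cases "u = \<one>") auto
  then show "n0b (inv u \<otimes> n0) = (if u = \<one> then 1 else 0)"
    unfolding of_elt_mult_b_sum[OF finite_G subgroup_B n0_carrier] by simp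
qed

text \<open>Subtracting y(n0) times \<open>whittaker\<close>, which has value 1 at n0, leaves an
  equivariant function vanishing at n0.\<close>

lemma equivariant_eq:
  assumes y: "left_equivariant y" and r: "right_invariant B y"
  shows "y = y n0 \<cdot> whittaker"
proof -
  let ?z = "\<lambda>x. y x - y n0 * whittaker x"
  have "left_equivariant ?z"
    using y left_equivariant_whittaker
    by (auto simp: left_equivariant_def group_algebra_carrier_iff right_diff_distrib mult.left_commute)
  moreover have "right_invariant B ?z" using r right_invariant_whittaker by simp
  ultimately have z: "?z = \<zero>\<^bsub>kG\<^esub>" by (rule equivariant_eq_zero) (simp add: whittaker_n0)
  show ?thesis
  proof
    fix x
    show "y x = (y n0 \<cdot> whittaker) x"
      using fun_cong[OF z, of x] unfolding group_algebra_zero group_algebra_smult by simp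
  qed
qed

lemma whittaker_nonzero: "whittaker \<noteq> \<zero>\<^bsub>kG\<^esub>"
  using whittaker_n0 by (auto simp: group_algebra_zero)

lemma idem_whittaker: "idem \<star> whittaker = whittaker"
  by (rule idem_left_equivariant[OF left_equivariant_whittaker])

lemma smult_one_right: "a \<in> carrier kG \<Longrightarrow> c \<cdot> a = a \<star> (c \<cdot> \<one>\<^bsub>kG\<^esub>)"
  by (simp add: group_algebra_smult_right)

lemma fixed_multiple:
  assumes "t \<in> carrier kG" "right_invariant B t" "idem \<star> t = t"
  shows "\<exists>c. t = c \<cdot> whittaker"
  using equivariant_eq[of t] idem_fixed_iff[of t] assms by blast

text \<open>f maps \<open>whittaker\<close> to a vector fixed by \<open>idem\<close>, hence to a
  multiple c of itself, and c^2 = c since f is idempotent.\<close>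

lemma idempotent_whittaker:
  assumes "f \<in> carrier kG" "idem \<star> f = f" "f \<star> f = f"
  shows "f \<star> whittaker = whittaker \<or> f \<star> whittaker = \<zero>\<^bsub>kG\<^esub>"
proof -
  have "idem \<star> (f \<star> whittaker) = f \<star> whittaker"
    using assms by (simp add: kG.m_assoc[symmetric])
  then obtain c where c: "f \<star> whittaker = c \<cdot> whittaker"
    using fixed_multiple[of "f \<star> whittaker"] right_invariant_left_mult[OF right_invariant_whittaker] assms by auto
  have "f \<star> (f \<star> whittaker) = f \<star> whittaker" using assms by (simp add: kG.m_assoc[symmetric])
  then have "(c * c) \<cdot> whittaker = c \<cdot> whittaker"
    by (simp add: c group_algebra_smult_right smult_smult)
  from fun_cong[OF this, of n0] have "c * c = c" by (simp add: group_algebra_smult whittaker_n0)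
  then have "c = 0 \<or> c = 1" by auto
  then show ?thesis using c by (auto simp: group_algebra_smult group_algebra_zero)
qed

text \<open>By \<open>equivariant_eq\<close>, \<open>usum\<close> sends y to a multiple of
  \<open>whittaker\<close>; the multiple is the value at n0, and dividing by it gives r.\<close>

lemma whittaker_mem:
  assumes X: "kG.left_ideal X" and y: "y \<in> X" "right_invariant B y" "(usum \<star> y) n0 \<noteq> 0"
  shows "\<exists>r\<in>carrier kG. r \<star> y = whittaker"
proof -
  have yc: "y \<in> carrier kG" using kG.left_idealD(2)[OF X y(1)] .
  let ?c = "(usum \<star> y) n0"
  have eq: "usum \<star> y = ?c \<cdot> whittaker"
    by (rule equivariant_eq[OF left_equivariant_usum[OF yc] right_invariant_left_mult[OF y(2)]])
  have "(inverse ?c \<cdot> usum) \<star> y = inverse ?c \<cdot> ?c \<cdot> whittaker"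
    unfolding group_algebra_smult_assoc by (rule arg_cong[OF eq])
  also have "\<dots> = whittaker" using y(3) by (simp add: smult_smult smult_one)
  finally show ?thesis by (intro bexI[of _ "inverse ?c \<cdot> usum"]) auto
qed

lemma right_invariant_perm: "y \<in> PIdl\<^bsub>kG\<^esub> bsum \<Longrightarrow> right_invariant B y"
  using right_invariant_PIdl[OF B_subset right_invariant_bsum] .

lemma whittaker_perm: "whittaker \<in> PIdl\<^bsub>kG\<^esub> bsum"
  unfolding whittaker_def by (rule kG.PIdl_memI) simp

subsection \<open>The Steinberg module\<close>

context
  fixes n :: "'a set \<Rightarrow> 'a"
  assumes n_rep: "\<And>w. w \<in> carrier Weyl \<Longrightarrow> n w \<in> w"
begin

abbreviation steinberg :: "'a \<Rightarrow> 'k" where "steinberg \<equiv> steinberg_element G B N S n"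

lemma n_carrier: "w \<in> carrier Weyl \<Longrightarrow> n w \<in> carrier G"
  using mem_Weyl(1)[OF _ n_rep] by simp

lemma finite_Weyl: "finite (carrier Weyl)"
  using finite_subset[OF subgroup.subset[OF subgroup_N] finite_G] by (simp add: carrier_Weyl)

lemma steinberg_summand_closed:
  "w \<in> carrier Weyl \<Longrightarrow> ((- 1) ^ word_length Weyl S w) \<cdot> (of_elt (n w) \<star> bsum) \<in> carrier kG"
  by (intro smult_closed kG.m_closed bsum_closed of_elt_closed n_carrier)

lemma steinberg_apply:
  "steinberg x = (\<Sum>w\<in>carrier Weyl. (- 1) ^ word_length Weyl S w * (if x \<in> n w <# B then 1 else 0))"
proof -
  have "steinberg x = (\<Sum>w\<in>carrier Weyl. (((- 1) ^ word_length Weyl S w) \<cdot> (of_elt (n w) \<star> bsum)) x)"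
    unfolding steinberg_element_def
    by (intro finsum_group_algebra finite_Weyl) (use steinberg_summand_closed in blast)
  also have "\<dots> = (\<Sum>w\<in>carrier Weyl. (- 1) ^ word_length Weyl S w * (if x \<in> n w <# B then 1 else 0))"
    by (intro sum.cong) (auto simp: group_algebra_smult of_elt_mult_b_sum[OF finite_G subgroup_B n_carrier])
  finally show ?thesis .
qed

lemma steinberg_closed [simp]: "steinberg \<in> carrier kG"
  unfolding steinberg_element_def by (rule kG.finsum_closed) (use steinberg_summand_closed in blast)

lemma right_invariant_steinberg: "right_invariant B steinberg"
proof (intro ballI)
  fix x b assume x: "x \<in> carrier G" and b: "b \<in> B"
  have "x \<otimes> b \<in> n w <# B \<longleftrightarrow> x \<in> n w <# B" if w: "w \<in> carrier Weyl" for w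
    using right_invariant_left_mult[OF right_invariant_bsum, of "of_elt (n w)"] x b
    unfolding of_elt_mult_b_sum[OF finite_G subgroup_B n_carrier[OF w]] by (metis zero_neq_one)
  then show "steinberg (x \<otimes> b) = steinberg x" unfolding steinberg_apply by (intro sum.cong) auto
qed

text \<open>If u^{-1} n0 lies in n_w B, then Bn_wB = Bn0B and so w = w0; the coset is then n0 B, and
  \<open>n0_coset\<close> gives u = 1. Only the sign attached to w0 survives, and a sign is
  invertible in any field.\<close>

lemma usum_steinberg_n0: "(usum \<star> steinberg) n0 = (- 1) ^ word_length Weyl S w0"
proof (rule usum_apply_n0)
  fix u assume u: "u \<in> U"
  have w0c: "w0 \<in> carrier Weyl" using longest_w0 by (simp add: longest_element_def)
  have n0w0: "n w0 \<in> N" "w0 = cl (n w0)" using mem_Weyl[OF w0c n_rep[OF w0c]] by auto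
  have w0_coset: "n w0 <# B = n0 <# B"
  proof -
    have "inv n0 \<otimes> n w0 \<in> inv\<^bsub>Weyl\<^esub> w0 \<otimes>\<^bsub>Weyl\<^esub> w0"
      by (rule mult_rep[OF _ w0c inv_rep[OF w0c n0_rep] n_rep[OF w0c]]) (use w0c in simp)
    then have "inv n0 \<otimes> n w0 \<in> B" using w0c by (simp add: one_Weyl)
    then have "n0 \<otimes> (inv n0 \<otimes> n w0) \<in> n0 <# B" by (auto simp: l_coset_def)
    then have "n w0 \<in> n0 <# B" using n0w0 by (simp add: m_assoc[symmetric])
    then show ?thesis using l_repr_independence[OF _ n0_carrier subgroup_B] by metis
  qed
  have mem: "inv u \<otimes> n0 \<in> n w <# B \<longleftrightarrow> w = w0 \<and> u = \<one>" if w: "w \<in> carrier Weyl" for w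
  proof
    assume m: "inv u \<otimes> n0 \<in> n w <# B"
    have nw: "n w \<in> N" "w = cl (n w)" using mem_Weyl[OF w n_rep[OF w]] by auto
    obtain b where b: "b \<in> B" "inv u \<otimes> n0 = n w \<otimes> b" using m by (auto simp: l_coset_def)
    have "\<one> \<otimes> n w \<otimes> b \<in> dcoset (n w)" using b by (intro dcosetI) auto
    then have "inv u \<otimes> n0 \<in> dcoset (n w)" using b nw by simp
    moreover have "inv u \<otimes> n0 \<otimes> \<one> \<in> dcoset n0" using u U_subset_B by (intro dcosetI) auto
    then have "inv u \<otimes> n0 \<in> dcoset n0" using u by simp
    ultimately have "dcoset (n w) = dcoset n0" using dcoset_eq nw(1) n0_carrier N_carrier by metis
    then have "cl (n w) = cl n0" using dcoset_inj[OF n0_N nw(1)] by simp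
    also have "cl n0 = w0" using mem_Weyl(2)[OF w0c n0_rep] by simp
    finally have "w = w0" using nw by simp
    then show "w = w0 \<and> u = \<one>" using n0_coset[OF u] m w0_coset by simp
  next
    assume "w = w0 \<and> u = \<one>"
    moreover have "n0 \<in> n0 <# B" using B_one by (force simp: l_coset_def)
    ultimately show "inv u \<otimes> n0 \<in> n w <# B" using w0_coset by simp
  qed
  have "steinberg (inv u \<otimes> n0) =
      (\<Sum>w\<in>carrier Weyl. if w = w0 then if u = \<one> then (- 1) ^ word_length Weyl S w0 else 0 else 0)"
    unfolding steinberg_apply by (intro sum.cong) (auto simp: mem)
  then show "steinberg (inv u \<otimes> n0) = (if u = \<one> then (- 1) ^ word_length Weyl S w0 else 0)"
    using finite_Weyl w0c by simp
qed

lemma whittaker_steinberg: "whittaker \<in> PIdl\<^bsub>kG\<^esub> steinberg"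
proof -
  obtain r where "r \<in> carrier kG" "r \<star> steinberg = whittaker"
    using whittaker_mem[of "carrier kG" steinberg] right_invariant_steinberg usum_steinberg_n0
    by (auto simp: kG.left_ideal_def)
  then show ?thesis using kG.PIdl_memI by metis
qed

lemma right_invariant_steinberg_module: "y \<in> PIdl\<^bsub>kG\<^esub> steinberg \<Longrightarrow> right_invariant B y"
  using right_invariant_PIdl[OF B_subset right_invariant_steinberg] .

end

subsection \<open>The form on \<open>S\<^sub>\<sigma>\<close>\<close>

abbreviation whittaker' :: "'a \<Rightarrow> 'k" where "whittaker' \<equiv> usum' \<star> of_elt n0 \<star> bsum"

text \<open>The submodule divided out in \<open>D_module\<close>. It plays the role of J in
  \<open>multiplicity_one\<close>.\<close>

definition radical :: "('a \<Rightarrow> 'k) set" where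
  "radical = PIdl\<^bsub>kG\<^esub> whittaker \<inter> perp G B (PIdl\<^bsub>kG\<^esub> whittaker')"

text \<open>Inverting u turns \<sigma>(u)^{-1} into \<sigma>(u). This is why the inverse character
  appears on the other side of the form.\<close>

lemma involute_usum': "involute usum' = usum"
proof
  fix x show "involute usum' x = usum x"
  proof (cases "x \<in> U")
    case True
    then show ?thesis by (simp add: involute_def u_sum_apply[OF finite_G U_subset] char_inv)
  next
    case False
    then have "x \<in> carrier G \<Longrightarrow> inv x \<notin> U" using U_inv[of "inv x"] by auto
    with False show ?thesis by (auto simp: involute_def u_sum_apply[OF finite_G U_subset])
  qed
qed

lemma involute_involute: "r \<in> carrier kG \<Longrightarrow> involute (involute r) = r"
  by (auto simp: involute_def group_algebra_carrier_iff)

lemma whittaker'_eq: "whittaker' = usum' \<star> n0b"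
  by (rule kG.m_assoc) auto

lemma right_invariant_n0b: "right_invariant B n0b"
  by (rule right_invariant_left_mult[OF right_invariant_bsum])

text \<open>Moving \<open>usum'\<close> to the left argument turns it into \<open>usum\<close>, and
  pairing with n0 b evaluates at n0. Orthogonality thus becomes the condition of
  \<open>whittaker_mem\<close>.\<close>

lemma form_whittaker':
  assumes a: "right_invariant B a"
  shows "perm_form G B a whittaker' = (usum \<star> a) n0"
proof -
  have "perm_form G B a whittaker' = perm_form G B (usum \<star> a) n0b"
    unfolding whittaker'_eq perm_form_adjoint[OF subgroup_B a right_invariant_n0b] involute_usum' ..
  also have "\<dots> = (usum \<star> a) n0"
    by (rule perm_form_elt[OF finite_G subgroup_B n0_carrier right_invariant_left_mult[OF a]])
  finally show ?thesis .
qed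

lemma right_invariant_PIdl_whittaker: "y \<in> PIdl\<^bsub>kG\<^esub> whittaker \<Longrightarrow> right_invariant B y"
  using right_invariant_PIdl[OF B_subset right_invariant_whittaker] .

lemma right_invariant_whittaker': "right_invariant B whittaker'"
  by (rule right_invariant_left_mult[OF right_invariant_bsum])

lemma whittaker'_closed [simp]: "whittaker' \<in> carrier kG"
  by simp

lemma PIdl_whittaker_perm: "PIdl\<^bsub>kG\<^esub> whittaker \<subseteq> PIdl\<^bsub>kG\<^esub> bsum"
  by (rule kG.PIdl_subset[OF kG.left_ideal_PIdl whittaker_perm]) simp

lemma radical_iff:
  "y \<in> radical \<longleftrightarrow> y \<in> PIdl\<^bsub>kG\<^esub> whittaker \<and> (\<forall>z\<in>PIdl\<^bsub>kG\<^esub> whittaker'. perm_form G B y z = 0)"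
  using PIdl_whittaker_perm
  by (auto simp: radical_def perp_def perm_module_def lideal_def)

text \<open>The orthogonal space of a left ideal is again a left ideal, because the adjoint of r is
  left multiplication by its involute.\<close>

lemma left_ideal_radical: "kG.left_ideal radical"
  unfolding kG.left_ideal_def
proof (intro conjI ballI)
  have I: "kG.left_ideal (PIdl\<^bsub>kG\<^esub> whittaker)" "kG.left_ideal (PIdl\<^bsub>kG\<^esub> whittaker')"
    by (auto intro: kG.left_ideal_PIdl)
  show "radical \<subseteq> carrier kG" using kG.left_idealD(1)[OF I(1)] by (auto simp: radical_iff)
  show "\<zero>\<^bsub>kG\<^esub> \<in> radical"
    using kG.left_idealD(3)[OF I(1)] by (simp add: radical_iff perm_form_def group_algebra_zero)
  fix x assume x: "x \<in> radical"
  {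
    fix y assume "y \<in> radical"
    with x show "x \<oplus>\<^bsub>kG\<^esub> y \<in> radical"
      using kG.left_idealD(4)[OF I(1), of x y] by (auto simp: radical_iff group_algebra_add perm_form_add_left)
  }
  fix r assume r: "r \<in> carrier kG"
  have "perm_form G B (r \<star> x) z = 0" if z: "z \<in> PIdl\<^bsub>kG\<^esub> whittaker'" for z
  proof -
    have "perm_form G B x (involute r \<star> z) = perm_form G B (involute (involute r) \<star> x) z"
      by (rule perm_form_adjoint[OF subgroup_B right_invariant_PIdl_whittaker
            right_invariant_PIdl[OF B_subset right_invariant_whittaker' z]])
        (use x in \<open>simp add: radical_iff\<close>)
    moreover have "involute r \<star> z \<in> PIdl\<^bsub>kG\<^esub> whittaker'" by (rule kG.left_idealD(5)[OF I(2) involute_closed z])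
    ultimately show ?thesis using x r by (simp add: involute_involute radical_iff)
  qed
  then show "r \<star> x \<in> radical" using kG.left_idealD(5)[OF I(1) r] x by (simp add: radical_iff)
qed

text \<open>Its pairing with \<open>whittaker'\<close> is the order of U in k, which is non-zero by
  assumption.\<close>

lemma whittaker_notin_radical: "whittaker \<notin> radical"
proof
  assume "whittaker \<in> radical"
  then have "perm_form G B whittaker whittaker' = 0" by (simp add: radical_iff kG.PIdl_self)
  then have "(usum \<star> whittaker) n0 = 0" by (simp add: form_whittaker'[OF right_invariant_whittaker])
  then show False
    using card_U_nonzero
    by (simp add: usum_left_equivariant[OF left_equivariant_whittaker] group_algebra_smult whittaker_n0)
qed

text \<open>An element y outside pairs non-trivially with some q \<open>whittaker'\<close>. Moving q
  across the form gives a multiple of y whose image under \<open>usum\<close> does not vanish at n0,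
  and \<open>whittaker_mem\<close> finishes.\<close>

lemma radical_maximal:
  assumes y: "y \<in> PIdl\<^bsub>kG\<^esub> whittaker" "y \<notin> radical"
  shows "\<exists>r\<in>carrier kG. r \<star> y = whittaker"
proof -
  have I: "kG.left_ideal (PIdl\<^bsub>kG\<^esub> whittaker)" by (rule kG.left_ideal_PIdl) simp
  have yr: "right_invariant B y" by (rule right_invariant_PIdl_whittaker[OF y(1)])
  obtain z where z: "z \<in> PIdl\<^bsub>kG\<^esub> whittaker'" "perm_form G B y z \<noteq> 0" using y by (auto simp: radical_iff)
  then obtain q where q: "q \<in> carrier kG" "z = q \<star> whittaker'" by (auto simp: cgenideal_def)
  have "perm_form G B y z = perm_form G B (involute q \<star> y) whittaker'"
    unfolding q(2) by (rule perm_form_adjoint[OF subgroup_B yr right_invariant_whittaker'])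
  also have "\<dots> = (usum \<star> (involute q \<star> y)) n0"
    by (rule form_whittaker'[OF right_invariant_left_mult[OF yr]])
  finally have "(usum \<star> (involute q \<star> y)) n0 \<noteq> 0" using z(2) by simp
  then obtain r where r: "r \<in> carrier kG" "r \<star> (involute q \<star> y) = whittaker"
    using whittaker_mem[OF I kG.left_idealD(5)[OF I involute_closed y(1)] right_invariant_left_mult[OF yr]]
    by blast
  then have "(r \<star> involute q) \<star> y = whittaker"
    using kG.left_idealD(2)[OF I y(1)] by (simp add: kG.m_assoc)
  then show ?thesis using r(1) by (intro bexI[of _ "r \<star> involute q"]) auto
qed

section \<open>Transfer to the Gelfand-Graev and Steinberg modules\<close>

lemma multiplicity_one_steinberg:
  assumes n_rep: "\<And>w. w \<in> carrier Weyl \<Longrightarrow> n w \<in> w"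
    and len: "finite_length_ring kG d l"
  shows "multiplicity_one kG d l (PIdl\<^bsub>kG\<^esub> usum) idem whittaker radical
    (PIdl\<^bsub>kG\<^esub> steinberg_element G B N S n)"
proof -
  let ?\<Gamma> = "PIdl\<^bsub>kG\<^esub> usum" and ?T = "PIdl\<^bsub>kG\<^esub> steinberg_element G B N S n"
  interpret finite_length_ring kG d l by (rule len)
  have T: "kG.left_ideal ?T" by (rule kG.left_ideal_PIdl[OF steinberg_closed[OF n_rep]])
  show ?thesis
  proof unfold_locales
    show "kG.right_unit ?\<Gamma> idem" by (rule right_unit_gelfand_graev)
    show "idem \<star> whittaker = whittaker" by (rule idem_whittaker)
    show "f \<star> whittaker = whittaker \<or> f \<star> whittaker = \<zero>\<^bsub>kG\<^esub>"
      if "f \<in> ?\<Gamma>" "idem \<star> f = f" "f \<star> f = f" for f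
      using idempotent_whittaker that kG.left_idealD(2)[OF kG.right_unitD(1)[OF right_unit_gelfand_graev]] by blast
    show "radical \<subseteq> PIdl\<^bsub>kG\<^esub> whittaker" by (simp add: radical_def)
    show "\<exists>r\<in>carrier kG. r \<star> y = whittaker" if "y \<in> PIdl\<^bsub>kG\<^esub> whittaker" "y \<notin> radical" for y
      using radical_maximal that .
    show "kG.left_ideal ?T" by (rule T)
    show "whittaker \<in> ?T" by (rule whittaker_steinberg[OF n_rep])
    fix t assume t: "t \<in> ?T" "idem \<star> t = t"
    have "t \<in> carrier kG" using kG.left_idealD(2)[OF T t(1)] .
    then obtain c where "t = c \<cdot> whittaker"
      using fixed_multiple[of t] right_invariant_steinberg_module[OF n_rep t(1)] t(2) by blast
    \<comment> \<open>The abstract locale speaks of a ring without scalars; a scalar c enters it as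
      right multiplication by c times the unit.\<close>
    then have "t = whittaker \<star> (c \<cdot> \<one>\<^bsub>kG\<^esub>)"
      using smult_one_right[OF whittaker_closed] by (rule trans)
    then show "\<exists>z\<in>carrier kG. t = whittaker \<star> z" using smult_closed[OF kG.one_closed] by blast
  qed (auto simp: whittaker_nonzero left_ideal_radical whittaker_notin_radical)
qed

lemma dim_hom_gelfand_graev:
  assumes T: "kG.left_ideal T" "whittaker \<in> T" and inv: "\<And>t. t \<in> T \<Longrightarrow> right_invariant B t"
  shows "vectorspace.dim class_ring (hom_space G (kG.lmod (PIdl\<^bsub>kG\<^esub> usum)) (kG.lmod T)) = 1"
proof (rule dim_hom_space_eq_1[OF finite_G right_unit_gelfand_graev T whittaker_nonzero idem_whittaker])
  show "\<exists>c. t = c \<cdot> whittaker" if "t \<in> T" "idem \<star> t = t" for t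
    using fixed_multiple[of t] inv kG.left_idealD(2)[OF T(1)] that by blast
qed

lemma module_lmod_eqs:
  "gelfand_graev G U \<sigma> = kG.lmod (PIdl\<^bsub>kG\<^esub> usum)"
  "perm_module G B = kG.lmod (PIdl\<^bsub>kG\<^esub> bsum)"
  "steinberg_module G B N S n = kG.lmod (PIdl\<^bsub>kG\<^esub> steinberg_element G B N S n)"
  "D_module G B U n0 \<sigma> = quotient_module (kG.lmod (PIdl\<^bsub>kG\<^esub> whittaker)) radical"
  by (simp_all add: gelfand_graev_def perm_module_def steinberg_module_def D_module_def S_module_def
      lideal_def whittaker_def radical_def)

end

theorem mainTheorem3:
  fixes G :: "('g, 'r) monoid_scheme" and B N U :: "'g set" and S :: "'g set set" and p :: nat
    and n :: "'g set \<Rightarrow> 'g" and w0 :: "'g set" and n0 :: 'g and \<sigma> :: "'g \<Rightarrow> 'k::field"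
  assumes "split_BN_pair G B N U S p"
    and "\<And>w. w \<in> carrier (weyl_group G B N) \<Longrightarrow> n w \<in> w"
    and "longest_element (weyl_group G B N) S w0" and "n0 \<in> w0"
    and "of_nat (card U) \<noteq> (0::'k)"
    and "\<sigma> \<in> hom (G\<lparr>carrier := U\<rparr>) (units_of class_ring)"
    and "nondegenerate G U S n0 \<sigma>"
  shows
    "let kG = group_algebra G;
         \<Gamma> = gelfand_graev G U \<sigma>;
         St = steinberg_module G B N S n;
         sub = (\<lambda>X. \<Gamma>\<lparr>carrier := X\<rparr>);
         Hom_nonzero = (\<lambda>X. carrier (hom_space G (sub X) St) \<noteq> {\<zero>\<^bsub>hom_space G (sub X) St\<^esub>});
         is_P_St = (\<lambda>P. direct_summand kG \<Gamma> P \<and> indecomposable kG (sub P) \<and> Hom_nonzero P);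
         simple_quotient_by = (\<lambda>P Q. Module.submodule Q kG (sub P) \<and>
            simple_module kG (quotient_module (sub P) Q))
     in projective_module kG \<Gamma> \<and>
        vectorspace.dim class_ring (hom_space G \<Gamma> St) = 1 \<and>
        vectorspace.dim class_ring (hom_space G \<Gamma> (perm_module G B)) = 1 \<and>
        (\<exists>P. is_P_St P) \<and>
        (\<forall>P P'. is_P_St P \<longrightarrow> is_P_St P' \<longrightarrow> module_iso kG (sub P) (sub P')) \<and>
        (\<forall>(m::nat) X. internal_direct_sum kG \<Gamma> {..<m} X \<longrightarrow>
           (\<forall>i<m. indecomposable kG (sub (X i))) \<longrightarrow> (\<exists>!i. i < m \<and> Hom_nonzero (X i))) \<and>
        (\<forall>P. is_P_St P \<longrightarrow> projective_module kG (sub P) \<and>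
           (\<exists>!Q. simple_quotient_by P Q) \<and>
           (\<forall>Q. simple_quotient_by P Q \<longrightarrow>
              module_iso kG (quotient_module (sub P) Q) (D_module G B U n0 \<sigma>)))"
proof -
  interpret nondegenerate_character G B N U S p w0 n0 \<sigma>
    using assms by (intro nondegenerate_character.intro nondegenerate_character_axioms.intro)
  obtain d l where len: "finite_length_ring kG d l"
    using group_algebra_finite_length[OF finite_G, where 'k = 'k] by blast
  let ?\<Gamma> = "PIdl\<^bsub>kG\<^esub> usum" and ?T = "PIdl\<^bsub>kG\<^esub> steinberg_element G B N S n"
  interpret M: multiplicity_one kG d l ?\<Gamma> idem whittaker radical ?T
    by (rule multiplicity_one_steinberg[OF assms(2) len])
  let ?Hom_nonzero = "\<lambda>X. carrier (hom_space G (kG.lmod X) (kG.lmod ?T)) \<noteq> {\<zero>\<^bsub>hom_space G (kG.lmod X) (kG.lmod ?T)\<^esub>}"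
  let ?is_P = "\<lambda>P. direct_summand kG (kG.lmod ?\<Gamma>) P \<and> indecomposable kG (kG.lmod P) \<and> ?Hom_nonzero P"
  have hom_iff: "?Hom_nonzero X \<longleftrightarrow> M.hom_nonzero X" if "kG.left_ideal X" for X
    by (rule hom_space_nonzero_iff[OF finite_G that M.left_ideal_T])
  \<comment> \<open>The module-theoretic description of P_St is reduced to the single equation f v =
    v for the idempotent of the summand; all later claims are then statements about such f.\<close>
  have P_iff: "?is_P P \<longleftrightarrow> (\<exists>f. M.component P f \<and> f \<star> whittaker = whittaker \<and> indecomposable kG (kG.lmod P))" for P
  proof
    assume P: "?is_P P"
    then obtain f where f: "M.component P f" using kG.direct_summand_iff[OF M.right_unit_\<Gamma>] by blast
    moreover have "M.hom_nonzero P" using P hom_iff kG.right_unitD(1) f by blast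
    ultimately show "\<exists>f. M.component P f \<and> f \<star> whittaker = whittaker \<and> indecomposable kG (kG.lmod P)"
      using M.component_hom_iff[OF f] P by blast
  next
    assume "\<exists>f. M.component P f \<and> f \<star> whittaker = whittaker \<and> indecomposable kG (kG.lmod P)"
    then obtain f where f: "M.component P f" "f \<star> whittaker = whittaker" "indecomposable kG (kG.lmod P)" by blast
    then have "?Hom_nonzero P" using hom_iff[OF kG.right_unitD(1)] M.component_hom_iff[OF f(1)] by blast
    then show "?is_P P" using f kG.direct_summand_iff[OF M.right_unit_\<Gamma>] by blast
  qed
  have index: "\<exists>!i. i < m \<and> ?Hom_nonzero (X i)"
    if X: "internal_direct_sum kG (kG.lmod ?\<Gamma>) {..<m::nat} X" for m X
  proof -
    have "kG.left_ideal (X i)" if "i < m" for i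
      using X that kG.submodule_lmod[OF kG.right_unitD(1)[OF M.right_unit_\<Gamma>]]
      by (auto simp: internal_direct_sum_def)
    then have "i < m \<and> ?Hom_nonzero (X i) \<longleftrightarrow> i < m \<and> M.hom_nonzero (X i)" for i using hom_iff by blast
    then show ?thesis using M.ex1_component[OF X] by simp
  qed
  have main: "projective_module kG (kG.lmod ?\<Gamma>) \<and>
    vectorspace.dim class_ring (hom_space G (kG.lmod ?\<Gamma>) (kG.lmod ?T)) = 1 \<and>
    vectorspace.dim class_ring (hom_space G (kG.lmod ?\<Gamma>) (kG.lmod (PIdl\<^bsub>kG\<^esub> bsum))) = 1 \<and>
    (\<exists>P. ?is_P P) \<and>
    (\<forall>P P'. ?is_P P \<longrightarrow> ?is_P P' \<longrightarrow> module_iso kG (kG.lmod P) (kG.lmod P')) \<and>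
    (\<forall>(m::nat) X. internal_direct_sum kG (kG.lmod ?\<Gamma>) {..<m} X \<longrightarrow>
       (\<forall>i<m. indecomposable kG (kG.lmod (X i))) \<longrightarrow> (\<exists>!i. i < m \<and> ?Hom_nonzero (X i))) \<and>
    (\<forall>P. ?is_P P \<longrightarrow> projective_module kG (kG.lmod P) \<and>
       (\<exists>!Q. Module.submodule Q kG (kG.lmod P) \<and> simple_module kG (quotient_module (kG.lmod P) Q)) \<and>
       (\<forall>Q. Module.submodule Q kG (kG.lmod P) \<and> simple_module kG (quotient_module (kG.lmod P) Q) \<longrightarrow>
          module_iso kG (quotient_module (kG.lmod P) Q) (quotient_module (kG.lmod (PIdl\<^bsub>kG\<^esub> whittaker)) radical)))"
    (is "_ \<and> _ \<and> _ \<and> _ \<and> ?iso \<and> ?index \<and> ?quot")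
  proof (intro conjI)
    show "projective_module kG (kG.lmod ?\<Gamma>)" by (rule kG.projective_right_unit[OF M.right_unit_\<Gamma>])
    show "vectorspace.dim class_ring (hom_space G (kG.lmod ?\<Gamma>) (kG.lmod ?T)) = 1"
      by (rule dim_hom_gelfand_graev[OF M.left_ideal_T M.v_in_T])
        (rule right_invariant_steinberg_module[OF assms(2)])
    show "vectorspace.dim class_ring (hom_space G (kG.lmod ?\<Gamma>) (kG.lmod (PIdl\<^bsub>kG\<^esub> bsum))) = 1"
      by (rule dim_hom_gelfand_graev[OF kG.left_ideal_PIdl[OF bsum_closed] whittaker_perm right_invariant_perm])
    show "\<exists>P. ?is_P P" unfolding P_iff by (rule M.ex_indecomposable_component)
    show ?iso unfolding P_iff using M.component_iso by blast
    show ?index using index by blast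
    show ?quot
    proof (intro allI impI)
      fix P assume "?is_P P"
      then obtain f where f: "M.component P f" "f \<star> whittaker = whittaker" "indecomposable kG (kG.lmod P)"
        unfolding P_iff by blast
      show "projective_module kG (kG.lmod P) \<and>
         (\<exists>!Q. Module.submodule Q kG (kG.lmod P) \<and> simple_module kG (quotient_module (kG.lmod P) Q)) \<and>
         (\<forall>Q. Module.submodule Q kG (kG.lmod P) \<and> simple_module kG (quotient_module (kG.lmod P) Q) \<longrightarrow>
            module_iso kG (quotient_module (kG.lmod P) Q) (quotient_module (kG.lmod (PIdl\<^bsub>kG\<^esub> whittaker)) radical))"
        \<comment> \<open>Being a simple quotient becomes an equation for Q, so the unique existence
          is immediate and only the isomorphism for that Q remains.\<close>
        unfolding M.simple_quotient_component[OF f]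
        using kG.projective_right_unit[OF conjunct1[OF f(1)]] M.quotient_component_iso[OF f(1,2)] by simp
    qed
  qed
  \<comment> \<open>Submodules of \<Gamma> are written as carrier updates of its record, which is
    itself a carrier update of the regular module; the outer update overrides the inner one.\<close>
  have sub: "(kG.lmod Y)\<lparr>carrier := X\<rparr> = kG.lmod X" for X Y by simp
  show ?thesis
    unfolding Let_def module_lmod_eqs sub by (rule main)
qed

end
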